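(* For $n\ge 1$ let $U_n$ be the set of $n$-stranded non-crossing pure gliders and let $V_n=\{(\operatorname{per}(g),T_g,\operatorname{width}(g)) : g\in U_n\}$ be the set of descriptions of its elements. There is an algorithm which, for every $n\geq 1$, given the finite set $V_n$ as input, terminates and returns exactly the set $V_{n+1}$. Consequently, starting from $V_1$ and iterating, for every $n$ one can compute $V_n$ in finite time, and one can decide whether a given description of an $n$-stranded grid pattern is the description of a pure glider.
   Context: **Cells.** A cell has a left and a right slot and is of one of eight types: $[n,n]$ (empty); $[s,n]$, $[n,s]$, $[s,s]$; $[r,n]$; $[n,l]$; $[r,l]$ (a Z-crossing); $\overline{[r,l]}$ (an S-crossing). The symbols $s,r,l$ are strands (straight, turning right, turning left); $n$ means no strand. A cell has state E if it is empty, S if it contains an $s$, T if it contains an $r$ or an $l$. A strand exits its cell to the left if it is an $s$ in the left slot or an $l$; it exits to the right if it is an $s$ in the right slot or an $r$. **Generations.** A generation with $n$ strands is a map $\delta$ from $\mathbb Z$ to cell types containing exactly $n$ strands in total, with $\delta(0)$ nonempty and $\delta(j)$ empty for $j<0$ (so generations are recorded up to horizontal translation). It is written as the string of cells $\delta(0)\delta(1)\cdots\delta(m)$, where $\delta(m)$ is the last nonempty cell; its width is $m+1$. The width of a pattern is the maximum of the widths of its generations (if bounded). Strand $k$ of $\delta$ is the $k$-th strand from the left. **Grid patterns.** An ($n$-stranded) grid pattern is a finite or infinite list $g=[\delta_1,\delta_2,\dots]$ of generations with $n$ strands. For consecutive generations $\delta,\delta'$, the child of the adjacent cells $\delta(k),\delta(k+1)$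 is $\delta'(k+1)$ if some strand of $\delta(0)$ exits to the left, and $\delta'(k)$ otherwise. The pattern is continuous if for all consecutive generations $\delta,\delta'$ and all $k$, the child of $\delta(k),\delta(k+1)$ has its left slot occupied iff a strand of $\delta(k)$ exits to the right, and its right slot occupied iff a strand of $\delta(k+1)$ exits to the left. Composition of patterns is concatenation of lists; $a^\infty$ is $a$ repeated infinitely often. If $g$ is of the form $a^\infty$, $\operatorname{per}(g)$ is the shortest $a$ with $g=a^\infty$, and $|\operatorname{per}(g)|$ is its number of generations. **Rules.** A turning rule is a string $t=t_0t_1\cdots t_8\in\{0,1\}^9$ with $t_4=0$; the bits $0,1,\dots,8$ correspond in order to the pairs SS, SE, ST, ES, EE, ET, TS, TE, TT. It is a turning rule of a continuous pattern $g$ if, whenever adjacent cells $A,B$ (left, right) of a generation have a nonempty child $C$ in the next generation and the pair (state of $A$, state of $B$) corresponds to bit $i$, then $C$ has state T if $t_i=1$ and state S if $t_i=0$. A crossing rule assigns a bit (Z- or S-crossing) to each of the nine pairs of crossing statuses (none, Z, S) of $A,B$, and prescribes the type of any child that is a crossing. An SCA pattern is a continuous grid pattern that has a turning rule and a crossing rule. **Speed.** For a generation $\delta$ put $e(\delta)=1$ if $\delta(0)=[n,l]$, $e(\delta)=-1$ if $\delta(0)=[r,n]$, and $e(\delta)=0$ otherwise. The speed of $g=a^\infty$ with $a=\operatorname{per}(g)$ is the symbol $\frac{d}{|a|}$ with $d=\sum_{\delta\in a}e(\delta)$; it is positive, negative or zero according to $d$. **Repeating patterns and gliders.** A null chain in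 $a=[\delta_1,\dots,\delta_k]$ is a sequence of empty cells $C_1,\dots,C_k$, $C_i$ a cell of $\delta_i$, such that $\delta_1$ has nonempty cells both to the left and to the right of $C_1$, and each $C_{i+1}$ is the child of $C_i$ and one of its two horizontal neighbours. A repeating SCA pattern is an SCA pattern of the form $g=a^\infty$, $a=\operatorname{per}(g)$, such that $a$ has no null chain. A glider is a repeating SCA pattern of nonzero speed. **Non-crossing, subpatterns, pure, $T_g$.** A pattern is non-crossing if no generation contains a crossing ($[r,l]$ or $\overline{[r,l]}$). For a non-crossing $n$-stranded pattern $g$ and $1\le k\le n$, $g_k^l$ (resp. $g_k^r$) is the $k$-stranded pattern obtained by deleting, in every generation, all strands except the first (resp. last) $k$ from the left, and renormalizing generations. A pure glider is a glider of positive speed having a turning rule with bit 1 (SE) equal to 0, or a glider of negative speed having a turning rule with bit 3 (ES) equal to 0. For $g\in U_n$, $T_g$ is the (finite) set of turning rules $t$ such that $t$ is a turning rule of $g_k^l$ for all $1\le k\le n$ (if $g$ has positive speed), resp. of $g_k^r$ for all $1\le k\le n$ (if $g$ has negative speed). *)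

theory Defs
  imports Main "HOL-Library.Nat_Bijection"
begin

section \<open>Cells and generations\<close>

(* SN = [s,n], NS = [n,s], SS = [s,s], RN = [r,n], NL = [n,l];
   ZX is the Z-crossing [r,l] and SX the S-crossing (the overlined [r,l]). *)
datatype cell = Empty | SN | NS | SS | RN | NL | ZX | SX

datatype state = StateS | StateE | StateT

datatype crossing_status = NoCrossing | ZCrossing | SCrossing

fun left_occupied :: "cell \<Rightarrow> bool" where
  "left_occupied c \<longleftrightarrow> c \<in> {SN, SS, RN, ZX, SX}"

fun right_occupied :: "cell \<Rightarrow> bool" where
  "right_occupied c \<longleftrightarrow> c \<in> {NS, SS, NL, ZX, SX}"

fun strands :: "cell \<Rightarrow> nat" where
  "strands c = of_bool (left_occupied c) + of_bool (right_occupied c)"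

fun exits_left :: "cell \<Rightarrow> bool" where
  "exits_left c \<longleftrightarrow> c \<in> {SN, SS, NL, ZX, SX}"

fun exits_right :: "cell \<Rightarrow> bool" where
  "exits_right c \<longleftrightarrow> c \<in> {NS, SS, RN, ZX, SX}"

fun cell_state :: "cell \<Rightarrow> state" where
  "cell_state Empty = StateE"
| "cell_state SN = StateS"
| "cell_state NS = StateS"
| "cell_state SS = StateS"
| "cell_state RN = StateT"
| "cell_state NL = StateT"
| "cell_state ZX = StateT"
| "cell_state SX = StateT"

fun cell_crossing :: "cell \<Rightarrow> crossing_status" where
  "cell_crossing c = (if c = ZX then ZCrossing else if c = SX then SCrossing else NoCrossing)"

type_synonym generation = "int \<Rightarrow> cell"

definition gen_support :: "generation \<Rightarrow> int set" where
  "gen_support \<delta> = {j. \<delta> j \<noteq> Empty}"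

definition strand_count :: "generation \<Rightarrow> nat" where
  "strand_count \<delta> = (\<Sum>j\<in>gen_support \<delta>. strands (\<delta> j))"

(* Without the finiteness condition the sum in strand_count would be 0 by convention. *)
definition is_generation :: "nat \<Rightarrow> generation \<Rightarrow> bool" where
  "is_generation n \<delta> \<longleftrightarrow>
     finite (gen_support \<delta>) \<and> strand_count \<delta> = n \<and> \<delta> 0 \<noteq> Empty \<and> (\<forall>j<0. \<delta> j = Empty)"

definition gen_width :: "generation \<Rightarrow> nat" where
  "gen_width \<delta> = nat (Max (gen_support \<delta>)) + 1"

section \<open>Grid patterns and rules\<close>

(* All patterns below are of the form a^\<infinity> or strand-deletions of such, so only infinite
   grid patterns are needed; the generations are indexed from 0. *)
type_synonym pattern = "nat \<Rightarrow> generation"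

definition grid_pattern :: "nat \<Rightarrow> pattern \<Rightarrow> bool" where
  "grid_pattern n g \<longleftrightarrow> (\<forall>i. is_generation n (g i))"

(* The position, in the next generation, of the child of the cells k and k + 1 of \<delta>. *)
definition child_pos :: "generation \<Rightarrow> int \<Rightarrow> int" where
  "child_pos \<delta> k = (if exits_left (\<delta> 0) then k + 1 else k)"

definition child :: "generation \<Rightarrow> generation \<Rightarrow> int \<Rightarrow> cell" where
  "child \<delta> \<delta>' k = \<delta>' (child_pos \<delta> k)"

definition continuous_pattern :: "pattern \<Rightarrow> bool" where
  "continuous_pattern g \<longleftrightarrow> (\<forall>i k.
     (left_occupied (child (g i) (g (Suc i)) k) \<longleftrightarrow> exits_right (g i k)) \<and>
     (right_occupied (child (g i) (g (Suc i)) k) \<longleftrightarrow> exits_left (g i (k + 1))))"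

definition pattern_width :: "pattern \<Rightarrow> nat" where
  "pattern_width g = Max (range (\<lambda>i. gen_width (g i)))"

type_synonym turning_rule = "bool list"

definition turning_rules :: "turning_rule set" where
  "turning_rules = {t. length t = 9 \<and> \<not> t ! 4}"

fun turning_bit :: "state \<Rightarrow> state \<Rightarrow> nat" where
  "turning_bit StateS StateS = 0"
| "turning_bit StateS StateE = 1"
| "turning_bit StateS StateT = 2"
| "turning_bit StateE StateS = 3"
| "turning_bit StateE StateE = 4"
| "turning_bit StateE StateT = 5"
| "turning_bit StateT StateS = 6"
| "turning_bit StateT StateE = 7"
| "turning_bit StateT StateT = 8"

definition turning_rule_of :: "turning_rule \<Rightarrow> pattern \<Rightarrow> bool" where
  "turning_rule_of t g \<longleftrightarrow> t \<in> turning_rules \<and> (\<forall>i k.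
     let C = child (g i) (g (Suc i)) k in
     C \<noteq> Empty \<longrightarrow>
     cell_state C =
       (if t ! turning_bit (cell_state (g i k)) (cell_state (g i (k + 1))) then StateT else StateS))"

(* True stands for an S-crossing, False for a Z-crossing. *)
type_synonym crossing_rule = "crossing_status \<Rightarrow> crossing_status \<Rightarrow> bool"

definition crossing_rule_of :: "crossing_rule \<Rightarrow> pattern \<Rightarrow> bool" where
  "crossing_rule_of x g \<longleftrightarrow> (\<forall>i k.
     let C = child (g i) (g (Suc i)) k in
     C \<in> {ZX, SX} \<longrightarrow>
     C = (if x (cell_crossing (g i k)) (cell_crossing (g i (k + 1))) then SX else ZX))"

definition sca_pattern :: "nat \<Rightarrow> pattern \<Rightarrow> bool" where
  "sca_pattern n g \<longleftrightarrow> grid_pattern n g \<and> continuous_pattern g \<and>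
     (\<exists>t. turning_rule_of t g) \<and> (\<exists>x. crossing_rule_of x g)"

section \<open>Repeating patterns, speed and gliders\<close>

definition is_power :: "generation list \<Rightarrow> pattern \<Rightarrow> bool" where
  "is_power a g \<longleftrightarrow> a \<noteq> [] \<and> (\<forall>i. g i = a ! (i mod length a))"

(* Unspecified unless g is of the form a^\<infinity>. *)
definition per :: "pattern \<Rightarrow> generation list" where
  "per g = (THE a. is_power a g \<and> (\<forall>b. is_power b g \<longrightarrow> length a \<le> length b))"

definition edge_shift :: "generation \<Rightarrow> int" where
  "edge_shift \<delta> = (if \<delta> 0 = NL then 1 else if \<delta> 0 = RN then -1 else 0)"

(* The speed is the unreduced symbol d/|a|, hence a pair. *)
definition speed :: "pattern \<Rightarrow> int \<times> nat" where
  "speed g = (sum_list (map edge_shift (per g)), length (per g))"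

definition positive_speed :: "pattern \<Rightarrow> bool" where
  "positive_speed g \<longleftrightarrow> fst (speed g) > 0"

definition negative_speed :: "pattern \<Rightarrow> bool" where
  "negative_speed g \<longleftrightarrow> fst (speed g) < 0"

(* c lists the positions of the cells of the chain. The two pairs formed by the cell p and one of
   its neighbours are (p - 1, p) and (p, p + 1). *)
definition null_chain :: "generation list \<Rightarrow> int list \<Rightarrow> bool" where
  "null_chain a c \<longleftrightarrow> length c = length a \<and>
     (\<forall>i<length a. (a ! i) (c ! i) = Empty) \<and>
     (\<exists>j<c ! 0. (a ! 0) j \<noteq> Empty) \<and> (\<exists>j>c ! 0. (a ! 0) j \<noteq> Empty) \<and>
     (\<forall>i. Suc i < length a \<longrightarrow>
        c ! Suc i \<in> {child_pos (a ! i) (c ! i - 1), child_pos (a ! i) (c ! i)})"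

definition repeating_sca :: "nat \<Rightarrow> pattern \<Rightarrow> bool" where
  "repeating_sca n g \<longleftrightarrow>
     sca_pattern n g \<and> (\<exists>a. is_power a g) \<and> \<not> (\<exists>c. null_chain (per g) c)"

definition glider :: "nat \<Rightarrow> pattern \<Rightarrow> bool" where
  "glider n g \<longleftrightarrow> repeating_sca n g \<and> (positive_speed g \<or> negative_speed g)"

definition pure_glider :: "nat \<Rightarrow> pattern \<Rightarrow> bool" where
  "pure_glider n g \<longleftrightarrow> glider n g \<and>
     (positive_speed g \<and> (\<exists>t. turning_rule_of t g \<and> \<not> t ! 1) \<or>
      negative_speed g \<and> (\<exists>t. turning_rule_of t g \<and> \<not> t ! 3))"

definition non_crossing :: "pattern \<Rightarrow> bool" where
  "non_crossing g \<longleftrightarrow> (\<forall>i k. g i k \<noteq> ZX \<and> g i k \<noteq> SX)"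

section \<open>Deleting strands\<close>

(* keep_slots l r c keeps the content of the left slot iff l and that of the right slot iff r. *)
fun keep_slots :: "bool \<Rightarrow> bool \<Rightarrow> cell \<Rightarrow> cell" where
  "keep_slots True True c = c"
| "keep_slots False False c = Empty"
| "keep_slots True False c =
     (case c of SS \<Rightarrow> SN | ZX \<Rightarrow> RN | SX \<Rightarrow> RN | NS \<Rightarrow> Empty | NL \<Rightarrow> Empty | _ \<Rightarrow> c)"
| "keep_slots False True c =
     (case c of SS \<Rightarrow> NS | ZX \<Rightarrow> NL | SX \<Rightarrow> NL | SN \<Rightarrow> Empty | RN \<Rightarrow> Empty | _ \<Rightarrow> c)"

definition strands_before :: "generation \<Rightarrow> int \<Rightarrow> nat" where
  "strands_before \<delta> j = (\<Sum>i | i \<in> gen_support \<delta> \<and> i < j. strands (\<delta> i))"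

(* Strands are numbered from 1, left to right. *)
definition select_strands :: "(nat \<Rightarrow> bool) \<Rightarrow> generation \<Rightarrow> generation" where
  "select_strands P \<delta> j =
     (let m = strands_before \<delta> j in
      keep_slots (P (m + 1)) (P (m + of_bool (left_occupied (\<delta> j)) + 1)) (\<delta> j))"

definition renormalize :: "generation \<Rightarrow> generation" where
  "renormalize \<delta> j = \<delta> (j + Min (gen_support \<delta>))"

definition first_strands :: "nat \<Rightarrow> pattern \<Rightarrow> pattern" where
  "first_strands k g i = renormalize (select_strands (\<lambda>m. m \<le> k) (g i))"

definition last_strands :: "nat \<Rightarrow> pattern \<Rightarrow> pattern" where
  "last_strands k g i = renormalize (select_strands (\<lambda>m. strand_count (g i) < m + k) (g i))"

section \<open>Pure non-crossing gliders and their descriptions\<close>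

definition U :: "nat \<Rightarrow> pattern set" where
  "U n = {g. pure_glider n g \<and> non_crossing g}"

definition rules_T :: "nat \<Rightarrow> pattern \<Rightarrow> turning_rule set" where
  "rules_T n g =
     (if positive_speed g
      then {t. \<forall>k\<in>{1..n}. turning_rule_of t (first_strands k g)}
      else {t. \<forall>k\<in>{1..n}. turning_rule_of t (last_strands k g)})"

type_synonym description = "generation list \<times> turning_rule set \<times> nat"

definition V :: "nat \<Rightarrow> description set" where
  "V n = (\<lambda>g. (per g, rules_T n g, pattern_width g)) ` U n"

(* The syntactically well-formed candidate descriptions of n-stranded repeating patterns. *)
definition descriptions :: "nat \<Rightarrow> description set" where
  "descriptions n =
     {(a, T, w). a \<noteq> [] \<and> (\<forall>\<delta>\<in>set a. is_generation n \<delta>) \<and> T \<subseteq> turning_rules}"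

section \<open>Encoding of descriptions by natural numbers\<close>

fun cell_code :: "cell \<Rightarrow> nat" where
  "cell_code Empty = 0"
| "cell_code SN = 1"
| "cell_code NS = 2"
| "cell_code SS = 3"
| "cell_code RN = 4"
| "cell_code NL = 5"
| "cell_code ZX = 6"
| "cell_code SX = 7"

definition gen_string :: "generation \<Rightarrow> cell list" where
  "gen_string \<delta> = map (\<lambda>j. \<delta> (int j)) [0..<gen_width \<delta>]"

definition gen_code :: "generation \<Rightarrow> nat" where
  "gen_code \<delta> = list_encode (map cell_code (gen_string \<delta>))"

definition rule_code :: "turning_rule \<Rightarrow> nat" where
  "rule_code t = list_encode (map of_bool t)"

fun description_code :: "description \<Rightarrow> nat" where
  "description_code (a, T, w) =
     prod_encode (list_encode (map gen_code a), prod_encode (set_encode (rule_code ` T), w))"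

definition description_set_code :: "description set \<Rightarrow> nat" where
  "description_set_code D = set_encode (description_code ` D)"

(* The encodings lose no information on well-formed data. *)

lemma inj_cell_code: "inj cell_code"
proof (rule injI)
  fix x y assume "cell_code x = cell_code y"
  then show "x = y" by (cases x; cases y) simp_all
qed

lemma gen_string_inj:
  assumes "is_generation n \<delta>" "is_generation n' \<delta>'" "gen_string \<delta> = gen_string \<delta>'"
  shows "\<delta> = \<delta>'"
proof
  fix j
  have len: "gen_width \<delta> = gen_width \<delta>'"
    using arg_cong[OF assms(3), of length] by (simp add: gen_string_def)
  have out: "\<epsilon> j = Empty" if "is_generation m \<epsilon>" "j < 0 \<or> j \<ge> int (gen_width \<epsilon>)" for m \<epsilon>
  proof (rule ccontr)
    assume "\<epsilon> j \<noteq> Empty"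
    then have "j \<in> gen_support \<epsilon>" by (simp add: gen_support_def)
    then have "j \<le> Max (gen_support \<epsilon>)"
      using that(1) by (simp add: is_generation_def)
    then show False
      using that \<open>\<epsilon> j \<noteq> Empty\<close>
      by (auto simp: is_generation_def gen_width_def split: if_splits)
  qed
  show "\<delta> j = \<delta>' j"
  proof (cases "j < 0 \<or> j \<ge> int (gen_width \<delta>)")
    case True
    then show ?thesis using out[OF assms(1)] out[OF assms(2)] len by simp
  next
    case False
    then have "nat j < gen_width \<delta>" "0 \<le> j" by auto
    then show ?thesis
      using arg_cong[OF assms(3), of "\<lambda>xs. xs ! nat j"] len by (simp add: gen_string_def)
  qed
qed

lemma inj_gen_code: "inj_on gen_code {\<delta>. \<exists>n. is_generation n \<delta>}"
  by (rule inj_onI) (auto simp: gen_code_def list_encode_eq inj_map_eq_map[OF inj_cell_code] intro: gen_string_inj)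

lemma inj_rule_code: "inj rule_code"
proof -
  have "inj (of_bool :: bool \<Rightarrow> nat)" by (rule injI) (simp add: of_bool_def split: if_splits)
  then show ?thesis by (auto intro!: injI simp: rule_code_def list_encode_eq inj_map_eq_map)
qed

lemma finite_turning_rules: "finite turning_rules"
  using finite_lists_length_eq[of "UNIV :: bool set" 9]
  by (rule finite_subset[rotated]) (auto simp: turning_rules_def)

lemma inj_description_code: "inj_on description_code (\<Union>n. descriptions n)"
proof (rule inj_onI)
  fix d d' :: description
  assume mem: "d \<in> (\<Union>n. descriptions n)" "d' \<in> (\<Union>n. descriptions n)"
    and code: "description_code d = description_code d'"
  obtain a T w a' T' w' where d: "d = (a, T, w)" "d' = (a', T', w')"
    by (cases d; cases d')
  obtain n n' where D: "(a, T, w) \<in> descriptions n" "(a', T', w') \<in> descriptions n'"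
    using mem d by blast
  have eq: "description_code (a, T, w) = description_code (a', T', w')"
    using code d by simp
  have "inj_on gen_code (set a \<union> set a')"
    by (rule inj_on_subset[OF inj_gen_code]) (use D in \<open>auto simp: descriptions_def\<close>)
  moreover have "map gen_code a = map gen_code a'" using eq by (simp add: list_encode_eq)
  ultimately have "a = a'" by (rule map_inj_on[rotated])
  have "finite T" "finite T'"
    using D finite_subset[OF _ finite_turning_rules] by (auto simp: descriptions_def)
  then have "rule_code ` T = rule_code ` T'"
    using eq by (simp add: set_encode_eq)
  then have "T = T'" by (simp add: inj_image_eq_iff[OF inj_rule_code])
  then show "d = d'" using \<open>a = a'\<close> eq d by simp
qed

lemma per_is_power:
  assumes "is_power b g"
  shows "is_power (per g) g"
proof -
  let ?P = "\<lambda>a. is_power a g \<and> (\<forall>b. is_power b g \<longrightarrow> length a \<le> length b)"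
  obtain a where a: "?P a"
    using ex_has_least_nat[of "\<lambda>a. is_power a g" b length] assms by blast
  have "c = a" if "?P c" for c
  proof (rule nth_equalityI)
    show len: "length c = length a" using that a by (meson le_antisym)
    fix i assume "i < length c"
    then have "i mod length c = i" "i mod length a = i" using len by simp_all
    moreover have "g i = c ! (i mod length c)" "g i = a ! (i mod length a)"
      using that a unfolding is_power_def by blast+
    ultimately show "c ! i = a ! i" by simp
  qed
  with a have "?P (per g)" unfolding per_def by (rule theI)
  then show ?thesis by blast
qed

lemma V_subset_descriptions:
  assumes "n \<ge> 1"
  shows "V n \<subseteq> descriptions n"
proof
  fix d assume "d \<in> V n"
  then obtain g where g: "g \<in> U n" and d: "d = (per g, rules_T n g, pattern_width g)"
    by (auto simp: V_def)
  have rep: "repeating_sca n g"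
    using g by (simp add: U_def pure_glider_def glider_def)
  then have pow: "is_power (per g) g"
    using per_is_power by (auto simp: repeating_sca_def)
  have "is_generation n \<delta>" if mem: "\<delta> \<in> set (per g)" for \<delta>
  proof -
    obtain i where i: "i < length (per g)" "\<delta> = per g ! i"
      using mem by (auto simp: in_set_conv_nth)
    moreover have "g i = per g ! (i mod length (per g))"
      using pow unfolding is_power_def by blast
    ultimately have "\<delta> = g i" by simp
    then show ?thesis
      using rep by (simp add: repeating_sca_def sca_pattern_def grid_pattern_def)
  qed
  moreover have "rules_T n g \<subseteq> turning_rules"
    using assms by (auto simp: rules_T_def turning_rule_of_def split: if_splits)
  ultimately show "d \<in> descriptions n"
    using pow by (simp add: d descriptions_def is_power_def)
qed

section \<open>Algorithms: partial recursive functions\<close>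

datatype recf =
    Zero
  | Succ
  | Proj nat
  | Comp recf "recf list"
  | PrimRec recf recf
  | Mu recf

(* None means that the computation diverges (or that too few arguments are supplied).
   PrimRec f g: h(0, ys) = f(ys), h(m + 1, ys) = g(m, h(m, ys), ys).
   Mu f: the least m with f(m, xs) = 0, provided f(i, xs) converges for all i < m. *)
primrec run :: "recf \<Rightarrow> nat list \<Rightarrow> nat option" where
  "run Zero = (\<lambda>xs. Some 0)"
| "run Succ = (\<lambda>xs. case xs of [] \<Rightarrow> None | x # _ \<Rightarrow> Some (Suc x))"
| "run (Proj i) = (\<lambda>xs. if i < length xs then Some (xs ! i) else None)"
| "run (Comp f gs) = (\<lambda>xs.
     let ys = map (\<lambda>h. h xs) (map run gs) in
     if None \<in> set ys then None else run f (map the ys))"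
| "run (PrimRec f g) = (\<lambda>xs. case xs of [] \<Rightarrow> None
     | x # ys \<Rightarrow> rec_nat (run f ys) (\<lambda>m r. case r of None \<Rightarrow> None | Some v \<Rightarrow> run g (m # v # ys)) x)"
| "run (Mu f) = (\<lambda>xs.
     if \<exists>m. run f (m # xs) = Some 0 \<and> (\<forall>i<m. run f (i # xs) \<noteq> None)
     then Some (LEAST m. run f (m # xs) = Some 0) else None)"

end

theory Submission
  imports Defs
begin

text \<open>All three algorithms come from one bound: an \<open>n\<close>-stranded non-crossing pure glider has width at most
  \<open>3 n + 1\<close>. Non-crossing patterns are deterministic, so the period is then at most \<open>8 ^ (3 n + 1)\<close>, and
  \<open>V n\<close> is found by testing finitely many candidates, all of whose conditions can be checked on one
  period. Since \<open>V n\<close> is never empty, \<open>n\<close> can be recovered from \<open>V n\<close>, which turns the algorithm for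
  \<open>n \<mapsto> V n\<close> into one for \<open>V n \<mapsto> V (n + 1)\<close>.

  For the width bound take positive speed (the other case is its mirror image), and assume that the
  strands do not move left all the time. Purity (SE = 0) implies that no strand ever turns right: a
  right-turning strand always has a neighbour to its right, which forces, for the rightmost such strand,
  either a pair of strands that oscillates at speed zero forever or a configuration that recurs at a fixed
  position every three steps backwards in time; both contradict the drift of the pattern. Without right
  turns, a strand is never influenced from its right, and when it is not influenced from its left either,
  it cycles through the moves left, left, right. So its deviation from speed \<open>1/3\<close> changes only in
  contact with its left neighbour, where it is at most that of the neighbour plus a constant; and contacts
  exist as there is no null chain.\<close>

section \<open>Width of non-crossing strand flows\<close>

text \<open>Two devices carry the width bound. Strands never cross, so a strand is identified for
  all time by its rank, the number of strands to its right, and its path can be read off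
  \<open>count_from\<close>, whose change in time at a place is the flux through that place.
  Moreover, periodicity stands in for a two-sided time axis: generation 0 has no predecessor, but
  shifting by \<open>m\<close> periods moves a configuration by \<open>m * D\<close> places and
  supplies as many earlier steps as are wanted. Hence a local configuration that is forced to recur,
  forwards or backwards, with a mean displacement other than \<open>D\<close> places to the left per
  \<open>p\<close> steps puts nonempty cells arbitrarily far out in one single generation. Directly
  or through \<open>RN_neighbour\<close>, this is the contradiction in the case distinction on the
  bits ST and TT. The bit ET splits off the rigid case: if it is 1, the leftmost strand keeps
  turning left once it has started to, and then all strands move left in every step. The factor 3
  stems from a potential that grows by at most 7 from one strand to the next, while one place counts
  3.\<close>

lemma cell_simps [simp]:
  "\<not> left_occupied Empty" "left_occupied SN" "\<not> left_occupied NS" "left_occupied SS" "left_occupied RN" "\<not> left_occupied NL" "left_occupied ZX" "left_occupied SX"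
  "\<not> right_occupied Empty" "\<not> right_occupied SN" "right_occupied NS" "right_occupied SS" "\<not> right_occupied RN" "right_occupied NL" "right_occupied ZX" "right_occupied SX"
  "\<not> exits_left Empty" "exits_left SN" "\<not> exits_left NS" "exits_left SS" "\<not> exits_left RN" "exits_left NL" "exits_left ZX" "exits_left SX"
  "\<not> exits_right Empty" "\<not> exits_right SN" "exits_right NS" "exits_right SS" "exits_right RN" "\<not> exits_right NL" "exits_right ZX" "exits_right SX"
  "strands Empty = 0" "strands SN = 1" "strands NS = 1" "strands SS = 2" "strands RN = 1" "strands NL = 1" "strands ZX = 2" "strands SX = 2"
  by simp_all

declare left_occupied.simps [simp del] right_occupied.simps [simp del]
  exits_left.simps [simp del] exits_right.simps [simp del] strands.simps [simp del]

lemma add_numeral_commute: "(2::int) + x = x + 2" "(3::int) + x = x + 3"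
  by simp_all

text \<open>Where two strands meet, the child is \<open>SS\<close> whatever \<open>\<tau>\<close>
  says: a turning child with two strands would be a crossing.\<close>

fun next_cell :: "(state \<Rightarrow> state \<Rightarrow> bool) \<Rightarrow> cell \<Rightarrow> cell \<Rightarrow> cell" where
  "next_cell \<tau> A B =
     (if exits_right A then
        if exits_left B then SS
        else if \<tau> (cell_state A) (cell_state B) then RN else SN
      else if exits_left B then
        if \<tau> (cell_state A) (cell_state B) then NL else NS
      else Empty)"

text \<open>Coordinates are skewed such that the child of the cells \<open>x\<close> and \<open>x + 1\<close> is at \<open>x\<close>: a strand that exits
  to the right keeps its position and one that exits to the left moves by \<open>-1\<close>. Positive speed becomes
  \<open>2 * D > p\<close>.\<close>

locale strand_flow =
  fixes c :: "nat \<Rightarrow> int \<Rightarrow> cell" and \<tau> :: "state \<Rightarrow> state \<Rightarrow> bool"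
    and p :: nat and D :: int and n :: nat
  assumes no_crossing: "c t x \<noteq> ZX" "c t x \<noteq> SX"
    and left_slot: "left_occupied (c (Suc t) x) \<longleftrightarrow> exits_right (c t x)"
    and right_slot: "right_occupied (c (Suc t) x) \<longleftrightarrow> exits_left (c t (x + 1))"
    and turning: "c (Suc t) x \<noteq> Empty \<Longrightarrow>
      cell_state (c (Suc t) x) = (if \<tau> (cell_state (c t x)) (cell_state (c t (x + 1))) then StateT else StateS)"
    and SE: "\<not> \<tau> StateS StateE"
    and finite_support: "finite {x. c t x \<noteq> Empty}"
    and total: "(\<Sum>x | c t x \<noteq> Empty. strands (c t x)) = n"
    and periodic: "c (t + p) x = c t (x + D)"
    and p_pos: "p > 0"
    and drift: "2 * D > int p"
    and no_null_chain: "\<And>d. \<lbrakk>\<And>i. c i (d i) = Empty; \<And>i. d (Suc i) \<in> {d i, d i - 1};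
        \<exists>y<d 0. c 0 y \<noteq> Empty; \<exists>y>d 0. c 0 y \<noteq> Empty\<rbrakk> \<Longrightarrow> False"
begin

lemma cell_cases:
  obtains "c t x = Empty" | "c t x = SN" | "c t x = NS" | "c t x = SS" | "c t x = RN" | "c t x = NL"
  using no_crossing[of t x] by (cases "c t x") auto

lemma step: "c (Suc t) x = next_cell \<tau> (c t x) (c t (x + 1))"
  using left_slot[of t x] right_slot[of t x] turning[of t x] no_crossing[of "Suc t" x]
  by (cases "c (Suc t) x") (auto split: if_splits)

text \<open>A set bit would make the child a crossing. Every meeting of two strands is thus evidence
  about the rule, used below both to read off bits and to exclude meetings.\<close>

lemma no_turn_collision:
  assumes "exits_right (c t x)" "exits_left (c t (x + 1))"
  shows "\<not> \<tau> (cell_state (c t x)) (cell_state (c t (x + 1)))"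
  using left_slot[of t x] right_slot[of t x] turning[of t x] no_crossing[of "Suc t" x] assms
  by (cases "c (Suc t) x") (auto split: if_splits)

lemma periodic_mult: "c (t + m * p) x = c t (x + int m * D)"
proof (induction m arbitrary: x)
  case (Suc m)
  have "c (t + Suc m * p) x = c ((t + m * p) + p) x" by (simp add: algebra_simps)
  also have "\<dots> = c t (x + D + int m * D)" using Suc.IH[of "x + D"] by (simp add: periodic)
  also have "x + D + int m * D = x + int (Suc m) * D" by (simp add: algebra_simps)
  finally show ?case .
qed simp

lemma periodic_mult': "c (t + m * p) (x - int m * D) = c t x"
  by (simp add: periodic_mult)

lemma D_pos: "D > 0"
  using drift by simp

lemma support_bounds:
  obtains a b where "\<And>x. c t x \<noteq> Empty \<Longrightarrow> a \<le> x \<and> x \<le> b"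
proof -
  let ?S = "{x. c t x \<noteq> Empty}"
  have "Min ?S \<le> x \<and> x \<le> Max ?S" if "c t x \<noteq> Empty" for x
    using that finite_support[of t] by simp
  then show ?thesis using that by blast
qed

text \<open>Closes the recurrence arguments: the \<open>f m\<close> are places forced in one
  generation by shifting over more and more periods.\<close>

lemma not_unbounded_left:
  assumes "\<And>m. c t (f m) \<noteq> Empty" and "\<And>m. f m \<le> b - int m"
  shows False
proof -
  obtain a a' where a: "\<And>x. c t x \<noteq> Empty \<Longrightarrow> a \<le> x \<and> x \<le> a'"
    using support_bounds by blast
  have "a \<le> b - int (nat (b - a + 1))"
    using a[OF assms(1)[of "nat (b - a + 1)"]] assms(2)[of "nat (b - a + 1)"] by linarith
  then show False by (simp split: if_splits)
qed

lemma not_unbounded_right: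
  assumes "\<And>m. c t (f m) \<noteq> Empty" and "\<And>m. f m \<ge> b + int m"
  shows False
proof -
  obtain a a' where a: "\<And>x. c t x \<noteq> Empty \<Longrightarrow> a \<le> x \<and> x \<le> a'"
    using support_bounds by blast
  have "b + int (nat (a' - b + 1)) \<le> a'"
    using a[OF assms(1)[of "nat (a' - b + 1)"]] assms(2)[of "nat (a' - b + 1)"] by linarith
  then show False by (simp split: if_splits)
qed

section \<open>Counting strands and following them by rank\<close>

definition count_from :: "nat \<Rightarrow> int \<Rightarrow> nat" where
  "count_from t x = (\<Sum>y | c t y \<noteq> Empty \<and> x \<le> y. strands (c t y))"

lemma count_from_Suc: "count_from t x = strands (c t x) + count_from t (x + 1)"
proof -
  have "{y. c t y \<noteq> Empty \<and> x \<le> y} =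
      (if c t x = Empty then {} else {x}) \<union> {y. c t y \<noteq> Empty \<and> x + 1 \<le> y}"
    by (auto simp: order_le_less)
  moreover have "finite {y. c t y \<noteq> Empty \<and> x + 1 \<le> y}"
    using finite_support[of t] by (rule rev_finite_subset) auto
  ultimately show ?thesis
    unfolding count_from_def by (simp add: sum.union_disjoint)
qed

lemma strands_pos: "c t x \<noteq> Empty \<Longrightarrow> strands (c t x) > 0"
  by (cases "c t x") auto

lemma count_from_antimono: "x \<le> y \<Longrightarrow> count_from t y \<le> count_from t x"
  unfolding count_from_def by (intro sum_mono2) (use finite_support[of t] in \<open>auto intro: rev_finite_subset\<close>)

lemma count_from_le: "count_from t x \<le> n"
  unfolding count_from_def total[of t, symmetric] by (intro sum_mono2) (use finite_support[of t] in auto)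

lemma count_from_left: "\<exists>a. \<forall>x\<le>a. count_from t x = n"
proof -
  obtain a b where "\<And>x. c t x \<noteq> Empty \<Longrightarrow> a \<le> x \<and> x \<le> b"
    using support_bounds[of t] by metis
  then have "{y. c t y \<noteq> Empty \<and> x \<le> y} = {y. c t y \<noteq> Empty}" if "x \<le> a" for x
    using that by fastforce
  then show ?thesis unfolding count_from_def total[of t, symmetric] by metis
qed

lemma count_from_right: "\<exists>b. \<forall>x\<ge>b. count_from t x = 0"
proof -
  obtain a b where "\<And>x. c t x \<noteq> Empty \<Longrightarrow> a \<le> x \<and> x \<le> b"
    using support_bounds[of t] by metis
  then have "{y. c t y \<noteq> Empty \<and> x \<le> y} = {}" if "x \<ge> b + 1" for x
    using that by fastforce
  then show ?thesis unfolding count_from_def by (metis sum.empty)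
qed

text \<open>Conservation of strands: the count changes only by what leaves cell \<open>x\<close> to
  the left, which is at most one strand. Both counts vanish far to the right, and the induction
  moves leftwards from there.\<close>

lemma count_from_step: "count_from (Suc t) x + of_bool (exits_left (c t x)) = count_from t x"
proof -
  obtain b b' where "\<forall>x\<ge>b. count_from t x = 0" "\<forall>x\<ge>b'. count_from (Suc t) x = 0"
    using count_from_right by metis
  then have far: "count_from t x = 0 \<and> count_from (Suc t) x = 0" if "x \<ge> max b b'" for x
    using that by simp
  show ?thesis
  proof (cases "x \<ge> max b b'")
    case True
    then have "c t x = Empty"
      using far[OF True] count_from_Suc[of t x] strands_pos[of t x] by fastforce
    then show ?thesis using far[OF True] by simp
  next
    case False
    then have "x \<le> max b b'" by linarith
    then show ?thesis
    proof (induction x rule: int_le_induct)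
      case base
      have "c t (max b b') = Empty"
        using far[of "max b b'"] count_from_Suc[of t "max b b'"] strands_pos[of t "max b b'"] by fastforce
      then show ?case using far[of "max b b'"] by simp
    next
      case (step x)
      have "strands (c (Suc t) (x - 1)) =
          of_bool (exits_right (c t (x - 1))) + of_bool (exits_left (c t x))"
        using left_slot[of t "x - 1"] right_slot[of t "x - 1"] by (simp add: strands.simps)
      moreover have "strands (c t (x - 1)) =
          of_bool (exits_right (c t (x - 1))) + of_bool (exits_left (c t (x - 1)))"
        by (cases "c t (x - 1)") auto
      ultimately show ?case
        using count_from_Suc[of t "x - 1"] count_from_Suc[of "Suc t" "x - 1"] step.IH by simp
    qed
  qed
qed

lemma count_from_time: "count_from (Suc t) x \<le> count_from t x"
  using count_from_step[of t x] by linarith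

lemma count_from_periodic: "count_from (t + m * p) x = count_from t (x + int m * D)"
proof -
  have "{y. c t y \<noteq> Empty \<and> x + int m * D \<le> y} = (\<lambda>y. y + int m * D) ` {y. c t (y + int m * D) \<noteq> Empty \<and> x \<le> y}"
    by (auto simp: image_iff intro!: exI[of _ "_ - int m * D"])
  then show ?thesis unfolding count_from_def periodic_mult
    by (simp add: sum.reindex inj_on_def)
qed

text \<open>Strands of rank \<open>0, \<dots>, n - 1\<close> are counted from the right.\<close>

lemma ex1_pos:
  assumes "r < n"
  shows "\<exists>!x. count_from t (x + 1) \<le> r \<and> r < count_from t x"
proof -
  obtain a b where a: "count_from t a = n" and b: "\<forall>x\<ge>b. count_from t x = 0"
    using count_from_left count_from_right by (metis order_refl)
  define k where "k = (LEAST k. count_from t (a + int k) \<le> r)"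
  have "count_from t (a + int (nat (b - a))) \<le> r"
    using b by simp
  then have k: "count_from t (a + int k) \<le> r" unfolding k_def by (rule LeastI)
  have "k \<noteq> 0"
  proof
    assume "k = 0"
    then have "count_from t a \<le> r" using k by simp
    then show False using a assms by linarith
  qed
  then obtain j where j: "k = Suc j" by (cases k) auto
  then have "\<not> count_from t (a + int j) \<le> r" using not_less_Least[of j "\<lambda>k. count_from t (a + int k) \<le> r"] k_def by simp
  then have 1: "count_from t (a + int j + 1) \<le> r \<and> r < count_from t (a + int j)"
    using k j by (simp add: algebra_simps)
  moreover have "y = x" if "count_from t (x + 1) \<le> r \<and> r < count_from t x"
      "count_from t (y + 1) \<le> r \<and> r < count_from t y" for x y
    using that count_from_antimono[of "x + 1" y t] count_from_antimono[of "y + 1" x t] by fastforce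
  ultimately show ?thesis by blast
qed

text \<open>A cell with two strands is the \<open>pos\<close> of two consecutive ranks, the left
  slot having the larger one.\<close>

definition pos :: "nat \<Rightarrow> nat \<Rightarrow> int" where
  "pos t r = (THE x. count_from t (x + 1) \<le> r \<and> r < count_from t x)"

lemma pos:
  assumes "r < n"
  shows "count_from t (pos t r + 1) \<le> r" "r < count_from t (pos t r)"
  using theI'[OF ex1_pos[OF assms, of t]] unfolding pos_def by auto

lemma pos_eqI: "count_from t (x + 1) \<le> r \<Longrightarrow> r < count_from t x \<Longrightarrow> pos t r = x"
  unfolding pos_def using ex1_pos[of r t] count_from_le[of t x] by (intro the1_equality) auto

lemma pos_ge: "r < n \<Longrightarrow> r < count_from t x \<Longrightarrow> x \<le> pos t r"
  using pos(1)[of r t] count_from_antimono[of "pos t r + 1" x t] by (cases "x \<le> pos t r") auto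

lemma pos_antimono: "s < n \<Longrightarrow> r \<le> s \<Longrightarrow> pos t s \<le> pos t r"
  using pos(2)[of s t] by (intro pos_ge) auto

lemma pos_nonempty: "r < n \<Longrightarrow> c t (pos t r) \<noteq> Empty"
  using pos[of r t] count_from_Suc[of t "pos t r"] by auto

lemma nonempty_pos:
  assumes "c t x \<noteq> Empty"
  obtains r where "r < n" "pos t r = x"
proof (rule that)
  show "pos t (count_from t (x + 1)) = x"
    using strands_pos[OF assms] count_from_Suc[of t x] by (intro pos_eqI) auto
  show "count_from t (x + 1) < n"
    using strands_pos[OF assms] count_from_Suc[of t x] count_from_le[of t x] by linarith
qed

text \<open>A strand that is no longer counted at its old place is found one place to the left: what
  cell \<open>pos t r - 1\<close> emits to the left is covered by its own strands, so rank
  \<open>r\<close> is not pushed past it.\<close>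

lemma pos_step:
  assumes "r < n"
  shows "pos (Suc t) r = (if r < count_from (Suc t) (pos t r) then pos t r else pos t r - 1)"
proof (cases "r < count_from (Suc t) (pos t r)")
  case True
  then show ?thesis
    using pos[OF assms, of t] count_from_time[of t "pos t r + 1"] by (auto intro!: pos_eqI)
next
  case False
  have "of_bool (exits_left (c t (pos t r - 1))) \<le> strands (c t (pos t r - 1))"
    by (cases "c t (pos t r - 1)") auto
  then have "count_from t (pos t r) \<le> count_from (Suc t) (pos t r - 1)"
    using count_from_Suc[of t "pos t r - 1"] count_from_step[of t "pos t r - 1"]
    by simp
  then show ?thesis
    using False pos[OF assms, of t] by (auto intro!: pos_eqI)
qed

lemma pos_periodic: "r < n \<Longrightarrow> pos (t + m * p) r = pos t r - int m * D"
  using pos[of r t] by (intro pos_eqI) (simp_all add: count_from_periodic)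

text \<open>The evolution read backwards, in the form used to reconstruct earlier generations cell
  by cell.\<close>

lemma parents:
  assumes "c (Suc t) x = a"
  shows "left_occupied a = exits_right (c t x)" "right_occupied a = exits_left (c t (x + 1))"
    "a \<noteq> Empty \<Longrightarrow> \<tau> (cell_state (c t x)) (cell_state (c t (x + 1))) = (cell_state a = StateT)"
  using left_slot[of t x] right_slot[of t x] turning[of t x] assms by (auto split: if_splits)

text \<open>If the cell to the right is empty, then, because of SE = 0, the same holds one step earlier; but a strand
  cannot have turned right forever, as the pattern drifts to the left.\<close>

lemma RN_neighbour:
  assumes "c t x = RN"
  shows "c t (x + 1) \<noteq> Empty"
proof
  assume E: "c t (x + 1) = Empty"
  have persist: "c s y = RN \<and> c s (y + 1) = Empty" if "c (s + k) y = RN \<and> c (s + k) (y + 1) = Empty" for s k y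
    using that
  proof (induction k)
    case (Suc k)
    then have "c (s + k) y = RN \<and> c (s + k) (y + 1) = Empty"
      using parents[of "s + k" y RN] parents[of "s + k" "y + 1" Empty] SE
      by (cases rule: cell_cases[of "s + k" y]; cases rule: cell_cases[of "s + k" "y + 1"]) auto
    then show ?case by (rule Suc.IH)
  qed simp
  have "c 0 (x - int m * D) = RN" for m
  proof -
    have "c (t + m * p) (x - int m * D + 1) = Empty"
      using E by (simp add: periodic_mult)
    then have "c (0 + (t + m * p)) (x - int m * D) = RN \<and> c (0 + (t + m * p)) (x - int m * D + 1) = Empty"
      using assms by (simp add: periodic_mult')
    then show ?thesis using persist by blast
  qed
  moreover have "x - int m * D \<le> x - int m" for m
    using D_pos by (simp add: mult_le_cancel_left1)
  ultimately show False using not_unbounded_left[of 0 "\<lambda>m. x - int m * D" x] by simp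
qed

section \<open>The leftmost strand\<close>

lemma leftmost_pos:
  assumes "n > 0"
  shows "count_from t (pos t (n - 1)) = n" and "y < pos t (n - 1) \<Longrightarrow> c t y = Empty"
proof -
  show *: "count_from t (pos t (n - 1)) = n"
    using pos(2)[of "n - 1" t] count_from_le[of t "pos t (n - 1)"] assms by linarith
  show "c t y = Empty" if "y < pos t (n - 1)"
  proof (rule ccontr)
    assume "c t y \<noteq> Empty"
    then have "count_from t (y + 1) < count_from t y"
      using count_from_Suc[of t y] strands_pos by simp
    moreover have "n \<le> count_from t (y + 1)"
      using that count_from_antimono[of "y + 1" "pos t (n - 1)" t] * by simp
    ultimately show False using count_from_le[of t y] by simp
  qed
qed

text \<open>Otherwise each left move would put the leftmost strand into \<open>NS\<close>, as
  nothing is to its left, and so be followed by a step in place. Then at most every second step goes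
  left and \<open>2 * D \<le> p\<close>.\<close>

lemma ex_leftmost_NL:
  assumes "n > 0"
  shows "\<exists>t. c t (pos t (n - 1)) = NL"
proof (rule ccontr)
  assume no_NL: "\<not> ?thesis"
  \<comment> \<open>\<open>b t\<close> is 1 if the leftmost strand moves left in step
    \<open>t\<close>, and 0 if it stays.\<close>
  define b where "b t = pos t (n - 1) - pos (Suc t) (n - 1)" for t
  have two: "b t + b (Suc t) \<le> 1" for t
  proof -
    have bnd: "b s \<in> {0, 1}" for s
      using pos_step[of "n - 1" s] assms by (simp add: b_def)
    let ?x = "pos t (n - 1)"
    have "b (Suc t) = 0" if "b t = 1"
    proof -
      have x: "pos (Suc t) (n - 1) = ?x - 1" using that by (simp add: b_def)
      have "right_occupied (c (Suc t) (?x - 1))"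
      proof -
        have "count_from (Suc t) ?x \<noteq> n"
          using x leftmost_pos(1)[OF assms, of "Suc t"] pos(1)[of "n - 1" "Suc t"] assms by simp
        then show ?thesis
          using count_from_step[of t ?x] leftmost_pos(1)[OF assms, of t] right_slot[of t "?x - 1"]
          by (cases "exits_left (c t ?x)") auto
      qed
      moreover have "\<not> left_occupied (c (Suc t) (?x - 1))"
        using left_slot[of t "?x - 1"] leftmost_pos(2)[OF assms, of "?x - 1" t] by simp
      moreover have "c (Suc t) (?x - 1) \<noteq> NL" using no_NL x by metis
      ultimately have "c (Suc t) (?x - 1) = NS"
        by (cases rule: cell_cases[of "Suc t" "?x - 1"]) auto
      then have "count_from (Suc (Suc t)) (?x - 1) = n"
        using count_from_step[of "Suc t" "?x - 1"] leftmost_pos(1)[OF assms, of "Suc t"] x by simp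
      then show ?thesis
        using pos_step[of "n - 1" "Suc t"] assms x by (simp add: b_def)
    qed
    then show ?thesis using bnd[of t] bnd[of "Suc t"] by auto
  qed
  \<comment> \<open>Over one period the sums of \<open>b t\<close> and of \<open>b (Suc t)\<close>
    both telescope to \<open>D\<close>.\<close>
  have "(\<Sum>t<k. b t) = pos 0 (n - 1) - pos k (n - 1)" for k
    by (induction k) (simp_all add: b_def)
  moreover have "(\<Sum>t<k. b (Suc t)) = pos 1 (n - 1) - pos (Suc k) (n - 1)" for k
    by (induction k) (simp_all add: b_def)
  moreover have "pos (s + p) (n - 1) = pos s (n - 1) - D" for s
    using pos_periodic[of "n - 1" s 1] assms by simp
  from this[of 0] this[of 1] have "pos p (n - 1) = pos 0 (n - 1) - D"
    "pos (Suc p) (n - 1) = pos 1 (n - 1) - D" by simp_all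
  ultimately have "(\<Sum>t<p. b t + b (Suc t)) = 2 * D" by (simp add: sum.distrib)
  moreover have "(\<Sum>t<p. b t + b (Suc t)) \<le> (\<Sum>t<p. 1)"
    by (rule sum_mono) (rule two)
  ultimately show False using drift by simp
qed

text \<open>With ET = 1 a leftmost \<open>NL\<close> reproduces itself, so the leftmost strand moves
  left in every step from some time on and \<open>D = p\<close>. No strand can cover
  \<open>p\<close> places in \<open>p\<close> steps if it ever stays.\<close>

lemma all_move_left:
  assumes "\<tau> StateE StateT" "r < n"
  shows "pos (Suc t) r = pos t r - 1"
proof -
  have n: "n > 0" using assms(2) by simp
  obtain t0 where t0: "c t0 (pos t0 (n - 1)) = NL" using ex_leftmost_NL[OF n] by blast
  let ?x = "pos t0 (n - 1)"
  have run: "c (t0 + k) (pos (t0 + k) (n - 1)) = NL \<and> pos (t0 + k) (n - 1) = ?x - int k" for k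
  proof (induction k)
    case (Suc k)
    let ?y = "pos (t0 + k) (n - 1)"
    have "count_from (Suc (t0 + k)) ?y = n - 1"
      using count_from_step[of "t0 + k" ?y] conjunct1[OF Suc.IH] leftmost_pos(1)[OF n, of "t0 + k"]
      by (simp del: One_nat_def)
    then have "pos (Suc (t0 + k)) (n - 1) = ?y - 1"
      using pos_step[of "n - 1" "t0 + k"] n by simp
    moreover have "c (Suc (t0 + k)) (?y - 1) = NL"
      using step[of "t0 + k" "?y - 1"] conjunct1[OF Suc.IH] leftmost_pos(2)[OF n, of "?y - 1" "t0 + k"] assms(1) by simp
    ultimately show ?case using Suc.IH by simp
  qed (use t0 in simp)
  have "D = int p"
    using run[of p] pos_periodic[of "n - 1" t0 1] n by simp
  then have per: "pos (s + p) r = pos s r - int p" for s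
    using pos_periodic[OF assms(2), of s 1] by simp
  have ge: "pos (s + k) r \<ge> pos s r - int k" for s k
  proof (induction k)
    case (Suc k)
    then show ?case using pos_step[OF assms(2), of "s + k"] by (auto split: if_splits)
  qed simp
  have "pos (Suc t + (p - 1)) r = pos t r - int p"
    using per[of t] p_pos by simp
  then have "pos (Suc t) r \<noteq> pos t r"
    using ge[of "Suc t" "p - 1"] p_pos by (auto simp: of_nat_diff)
  then show ?thesis using pos_step[OF assms(2), of t] by (auto split: if_splits)
qed

text \<open>The left parent of a leftmost \<open>NL\<close> is empty, so one of these two bits must
  have produced it. The \<open>NL\<close> is taken one period later to make sure that it has
  parents.\<close>

lemma ES_or_ET:
  assumes "n > 0"
  shows "\<tau> StateE StateS \<or> \<tau> StateE StateT"
proof -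
  obtain t0 where t0: "c t0 (pos t0 (n - 1)) = NL" using ex_leftmost_NL[OF assms] by blast
  define x where "x = pos t0 (n - 1) - D"
  obtain t where t: "t0 + p = Suc t" using p_pos by (metis add_Suc_right gr0_implies_Suc)
  have NL: "c (Suc t) x = NL" and x: "x = pos (Suc t) (n - 1)"
    using t0 t periodic[of t0 x] pos_periodic[of "n - 1" t0 1] assms by (simp_all add: x_def)
  have "\<not> exits_left (c t x)"
    using leftmost_pos(2)[OF assms, of "x - 1" "Suc t"] x parents[of t "x - 1" Empty] by simp
  moreover have "\<not> exits_right (c t x)" using parents[OF NL] by simp
  ultimately have "c t x = Empty" by (cases rule: cell_cases[of t x]) auto
  then show ?thesis
    using parents[OF NL] by (cases rule: cell_cases[of t "x + 1"]) auto
qed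

section \<open>Excluding right turns\<close>

text \<open>Each copy shifted by \<open>m\<close> periods descends in place to time 0, where the
  copies are unbounded to the left.\<close>

lemma back_to_start:
  assumes "P t x" and "\<And>s y. P (Suc s) y \<Longrightarrow> P s y"
    and shift: "\<And>s y m. P s y \<Longrightarrow> P (s + m * p) (y - int m * D)"
    and "\<And>s y. P s y \<Longrightarrow> c s y \<noteq> Empty"
  shows False
proof -
  have desc: "P s y" if "P (s + k) y" for s y k
    using that by (induction k) (use assms(2) in auto)
  have "P 0 (x - int m * D)" for m
    using shift[OF assms(1), of m] desc[of 0 "t + m * p"] by simp
  then have "c 0 (x - int m * D) \<noteq> Empty" for m using assms(4) by blast
  moreover have "x - int m * D \<le> x - int m" for m
    using D_pos by (simp add: mult_le_cancel_left1)
  ultimately show False using not_unbounded_left[of 0 "\<lambda>m. x - int m * D" x] by simp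
qed

text \<open>The strands of rank \<open>r\<close> and \<open>r - 1\<close> meet at \<open>x\<close> after one of them has turned right. If nothing interferes,
  this recurs after four steps at \<open>x - 2\<close>, which is speed zero.\<close>

definition locked :: "nat \<Rightarrow> nat \<Rightarrow> int \<Rightarrow> bool" where
  "locked r t x \<longleftrightarrow> c t x \<in> {NS, SS} \<and> c t (x + 1) = NS \<and> c (Suc t) x = RN \<and>
     c (Suc t) (x + 1) \<in> {SN, SS} \<and> c (Suc (Suc t)) x = SS \<and> count_from (Suc t) (x + 1) = r"

text \<open>A strand in \<open>RN\<close> is alone in its cell, so its rank is the count to its
  right. Hence strands of rank below \<open>r\<close> never turn right; whether rank
  \<open>r\<close> itself does is left open.\<close>

definition min_rank :: "nat \<Rightarrow> bool" where
  "min_rank r \<longleftrightarrow> (\<forall>t x. c t x = RN \<longrightarrow> r \<le> count_from t (x + 1))"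

text \<open>Take the right-turning strand of least rank at the start of a right turn. By SE = 0 and
  minimality its right neighbour must be \<open>NS\<close>, which gives SS = 1. The neighbour does
  not turn right next, so the two strands meet one step later, which gives TS = 0.\<close>

lemma ex_locked:
  assumes "c t x = RN"
  shows "\<exists>r s y. min_rank r \<and> locked r s y \<and> \<tau> StateS StateS \<and> \<not> \<tau> StateT StateS"
proof -
  let ?Q = "\<lambda>r. \<exists>t x. c t x = RN \<and> count_from t (x + 1) = r"
  define r where "r = (LEAST r. ?Q r)"
  have Q: "?Q r" unfolding r_def by (rule LeastI_ex) (use assms in auto)
  have min: "r \<le> count_from t x'" if "c t x = RN" "x' = x + 1" for t x x'
    unfolding r_def by (rule Least_le) (use that in auto)
  then have mr: "min_rank r" unfolding min_rank_def by blast
  let ?P = "\<lambda>s y. c s y = RN \<and> count_from s (y + 1) = r"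
  \<comment> \<open>A right turn that never begins could be traced back to time 0.\<close>
  have "\<exists>s y. ?P (Suc s) y \<and> \<not> ?P s y"
  proof (rule ccontr)
    assume no: "\<not> ?thesis"
    obtain t0 x0 where P0: "?P t0 x0" using Q by blast
    show False
    proof (rule back_to_start[of ?P, OF P0])
      show "?P s y" if "?P (Suc s) y" for s y using no that by blast
      show "?P (s + m * p) (y - int m * D)" if "?P s y" for s y m
        using that by (simp add: periodic_mult count_from_periodic)
    qed simp
  qed
  then obtain s y where RN: "c (Suc s) y = RN" and rank: "count_from (Suc s) (y + 1) = r" and notP: "\<not> ?P s y"
    by blast
  have er: "exits_right (c s y)" and nel: "\<not> exits_left (c s (y + 1))"
    and turn: "\<tau> (cell_state (c s y)) (cell_state (c s (y + 1)))"
    using parents[OF RN] by simp_all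
  have rank': "count_from s (y + 1) = r"
    using count_from_step[of s "y + 1"] nel rank by simp
  have "c s y \<noteq> RN" using notP rank' by blast
  then have y: "c s y \<in> {NS, SS}" using er by (cases rule: cell_cases[of s y]) auto
  have "c s (y + 1) \<noteq> RN"
    using min[of s "y + 1" "y + 1 + 1"] count_from_Suc[of s "y + 1"] rank' by fastforce
  then have y1: "c s (y + 1) = NS"
    using nel turn y SE by (cases rule: cell_cases[of s "y + 1"]) auto
  have SS: "\<tau> StateS StateS" using turn y y1 by auto
  have "left_occupied (c (Suc s) (y + 1))" using left_slot[of s "y + 1"] y1 by simp
  moreover have "c (Suc s) (y + 1) \<noteq> RN"
    using min[of "Suc s" "y + 1" "y + 1 + 1"] count_from_Suc[of "Suc s" "y + 1"] rank by fastforce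
  ultimately have y1': "c (Suc s) (y + 1) \<in> {SN, SS}"
    by (cases rule: cell_cases[of "Suc s" "y + 1"]) auto
  have "c (Suc (Suc s)) y = SS" using step[of "Suc s" y] RN y1' by auto
  moreover have "\<not> \<tau> StateT StateS"
    using no_turn_collision[of "Suc s" y] RN y1' by auto
  ultimately show ?thesis using mr y y1 RN y1' rank SS unfolding locked_def by blast
qed

text \<open>A \<open>locked\<close> pair that a third strand keeps from meeting again.\<close>

definition escaping :: "nat \<Rightarrow> int \<Rightarrow> bool" where
  "escaping t x \<longleftrightarrow> c t x \<in> {NS, SS} \<and> c t (x + 1) = NS \<and> c (Suc t) x = RN \<and>
     c (Suc t) (x + 1) \<in> {SN, SS} \<and> c (Suc (Suc t)) x = SS \<and> c (Suc (Suc t)) (x - 1) = SN \<and>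
     c (Suc (Suc (Suc t))) (x - 2) = NL"

context
  notes add_numeral_commute [simp]
  assumes ES: "\<tau> StateE StateS" and ET: "\<not> \<tau> StateE StateT"
    and SS: "\<tau> StateS StateS" and TS: "\<not> \<tau> StateT StateS"
begin

text \<open>After the meeting the left strand passes through \<open>NL\<close> at
  \<open>x - 1\<close> and arrives at \<open>x - 2\<close> beside the right strand in
  \<open>NS\<close>. If it does not turn there, SS = 1 starts the next right turn. If it does, then,
  as ET = 0, a third strand must have been at \<open>x - 2\<close> one step earlier.\<close>

lemma locked_forward:
  assumes "min_rank r" "locked r t x"
  shows "locked r (t + 4) (x - 2) \<or>
    c (t + 3) (x - 1) = NL \<and> c (t + 4) (x - 2) = NL \<and>
      (c (t + 3) (x - 2) = SN \<and> \<tau> StateS StateT \<or> c (t + 3) (x - 2) = NL \<and> \<tau> StateT StateT)"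
proof -
  define t1 t2 t3 t4 t5 where t: "t1 = Suc t" "t2 = Suc t1" "t3 = Suc t2" "t4 = Suc t3" "t5 = Suc t4"
  have t3_eq: "t + 3 = t3" and t4_eq: "t + 4 = t4" by (simp_all add: t)
  have L: "c t1 x = RN" "c t1 (x + 1) \<in> {SN, SS}" "c t2 x = SS" "count_from t1 (x + 1) = r"
    using assms(2) by (simp_all add: locked_def t)
  have SN_SS: "c (Suc s) y \<in> {SN, SS}" if "exits_right (c s y)" "count_from (Suc s) (y + 1) < r" for s y
    using that left_slot[of s y] assms(1) unfolding min_rank_def
    by (cases rule: cell_cases[of "Suc s" y]) (auto simp flip: not_less)
  have n2: "count_from t2 (x + 1) + 1 = r"
    using count_from_step[of t1 "x + 1"] L by (auto simp flip: t)
  have n2': "count_from t2 x = r + 1"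
    using count_from_Suc[of t2 x] L n2 by simp
  have t3x: "c t3 x \<in> {SN, SS}"
    unfolding t(3) using L count_from_time[of t2 "x + 1"] n2 by (intro SN_SS) auto
  have n3: "count_from t3 x = r"
    using count_from_step[of t2 x] L n2' by (simp flip: t)
  have t3x1: "c t3 (x - 1) = NL"
  proof -
    \<comment> \<open>Going straight, the left strand would meet the right one in states S and S,
      where SS = 1 would give a crossing.\<close>
    have "\<not> (exits_right (c t3 (x - 1)) \<and> cell_state (c t3 (x - 1)) = StateS)"
      using no_turn_collision[of t3 "x - 1"] t3x SS by auto
    moreover have "right_occupied (c t3 (x - 1))" using right_slot[of t2 "x - 1"] L by (simp add: t)
    ultimately show ?thesis by (cases rule: cell_cases[of t3 "x - 1"]) auto
  qed
  have n3': "count_from t3 (x - 1) = r + 1"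
    using count_from_Suc[of t3 "x - 1"] n3 t3x1 by simp
  have t4x1: "c t4 (x - 1) = NS"
    using step[of t3 "x - 1"] t3x t3x1 TS by (auto simp flip: t)
  have n4: "count_from t4 (x - 1) = r"
    using count_from_step[of t3 "x - 1"] t3x1 n3' by (simp flip: t)
  have n4': "count_from t4 x + 1 = r"
    using count_from_step[of t3 x] t3x n3 by (auto simp flip: t)
  have n5: "count_from t5 (x - 1) = r"
    using count_from_step[of t4 "x - 1"] t4x1 n4 by (simp flip: t)
  have t5x1: "c t5 (x - 1) \<in> {SN, SS}"
    unfolding t(5) using t4x1 count_from_time[of t4 x] n4' by (intro SN_SS) auto
  have t4x2: "right_occupied (c t4 (x - 2))" using right_slot[of t3 "x - 2"] t3x1 by (simp add: t)
  show ?thesis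
  proof (cases "c t4 (x - 2) = NL")
    case False
    then have t4x2: "c t4 (x - 2) \<in> {NS, SS}"
      using t4x2 by (cases rule: cell_cases[of t4 "x - 2"]) auto
    then have t5x2: "c t5 (x - 2) = RN"
      using step[of t4 "x - 2"] t4x1 SS by (auto simp flip: t)
    moreover have "c (Suc t5) (x - 2) = SS"
      using step[of t5 "x - 2"] t5x1 t5x2 by auto
    ultimately have "locked r t4 (x - 2)"
      unfolding locked_def using t4x2 t4x1 t5x1 n5 by (simp add: t)
    then show ?thesis by (simp add: t4_eq)
  next
    case True
    then have "c t3 (x - 2) = SN \<and> \<tau> StateS StateT \<or> c t3 (x - 2) = NL \<and> \<tau> StateT StateT"
      using parents[of t3 "x - 2" NL] t3x1 ET
      by (cases rule: cell_cases[of t3 "x - 2"]) (auto simp: t)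
    then show ?thesis using True t3x1 by (simp add: t3_eq t4_eq)
  qed
qed

text \<open>With SS, ST and TT all 1, (T, S) is the only pair of nonempty cells in which strands can
  meet or which can have a straight child. This forces the relevant cells of the previous
  round.\<close>

lemma locked_backward:
  assumes "min_rank r" "locked r (u + 4) x" "\<tau> StateS StateT" "\<tau> StateT StateT"
  shows "locked r u (x + 2)"
proof -
  define t4 t3 t2 t1 t0 where t: "t4 = u" "t3 = Suc t4" "t2 = Suc t3" "t1 = Suc t2" "t0 = Suc t1"
  have eq: "u + 4 = t0" by (simp add: t)
  have L: "c t0 x \<in> {NS, SS}" "c t0 (x + 1) = NS" "count_from (Suc t0) (x + 1) = r"
    using assms(2) unfolding eq by (simp_all add: locked_def)
  have n0: "count_from t0 (x + 1) = r" using count_from_step[of t0 "x + 1"] L by simp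
  have a1: "exits_left (c t1 (x + 1))" "\<not> exits_right (c t1 (x + 1))" "exits_left (c t1 (x + 2))"
    "\<not> \<tau> (cell_state (c t1 (x + 1))) (cell_state (c t1 (x + 2)))"
    using L parents[of t1 x "c t0 x"] parents[of t1 "x + 1" NS] by (auto simp: t)
  have b1: "c t1 (x + 1) = NL" and b1': "c t1 (x + 2) \<in> {SN, SS}"
    using a1 SS assms(3,4)
    by (cases rule: cell_cases[of t1 "x + 1"]; cases rule: cell_cases[of t1 "x + 2"]; simp)+
  have n1: "count_from t1 (x + 2) = r"
    using count_from_step[of t1 "x + 1"] count_from_Suc[of t1 "x + 1"] b1 n0 by (simp flip: t)
  have "exits_right (c t2 (x + 2))" "exits_left (c t2 (x + 2))"
    using parents[of t2 "x + 2" "c t1 (x + 2)"] parents[of t2 "x + 1" NL] b1 b1' by (auto simp: t)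
  then have b2: "c t2 (x + 2) = SS" by (cases rule: cell_cases[of t2 "x + 2"]) auto
  have n2: "count_from t2 (x + 3) + 1 = r"
    using count_from_step[of t2 "x + 2"] count_from_Suc[of t2 "x + 2"] b2 n1 by (simp flip: t)
  have a3: "exits_right (c t3 (x + 2))" "exits_left (c t3 (x + 3))"
    "\<not> \<tau> (cell_state (c t3 (x + 2))) (cell_state (c t3 (x + 3)))"
    using parents[of t3 "x + 2" SS] b2 by (auto simp: t)
  have b3: "c t3 (x + 2) = RN" and b3': "c t3 (x + 3) \<in> {SN, SS}"
    using a3 SS assms(3,4)
    by (cases rule: cell_cases[of t3 "x + 2"]; cases rule: cell_cases[of t3 "x + 3"]; simp)+
  have n3: "count_from t3 (x + 3) = r"
    using count_from_step[of t3 "x + 3"] b3' n2 by (auto simp flip: t)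
  have a4: "exits_right (c t4 (x + 2))" "\<not> exits_left (c t4 (x + 3))" "exits_right (c t4 (x + 3))"
    "\<tau> (cell_state (c t4 (x + 2))) (cell_state (c t4 (x + 3)))"
    using parents[of t4 "x + 2" RN] parents[of t4 "x + 3" "c t3 (x + 3)"] b3 b3' by (auto simp: t)
  have n4: "count_from t4 (x + 3) = r" using count_from_step[of t4 "x + 3"] a4 n3 by (simp flip: t)
  have "c t4 (x + 3) \<noteq> RN"
  proof
    assume RN: "c t4 (x + 3) = RN"
    then have "r \<le> count_from t4 (x + 3 + 1)" using assms(1) unfolding min_rank_def by blast
    then show False using count_from_Suc[of t4 "x + 3"] RN n4 by simp
  qed
  then have b4': "c t4 (x + 3) = NS" using a4 by (cases rule: cell_cases[of t4 "x + 3"]) auto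
  then have "c t4 (x + 2) \<in> {NS, SS}"
    using a4 TS by (cases rule: cell_cases[of t4 "x + 2"]) auto
  then show ?thesis
    unfolding locked_def using b4' b3 b3' b2 n3 by (simp add: t)
qed

text \<open>Reconstructing the past of such an escape leads to a strand in \<open>RN\<close> with an
  empty cell to its right. This may take two generations before the locked pair, hence
  \<open>u + 2\<close>.\<close>

lemma no_escape_ST:
  assumes "locked r (u + 2) x" "c (u + 5) (x - 1) = NL" "c (u + 5) (x - 2) = SN"
    and ST: "\<tau> StateS StateT" and TT: "\<not> \<tau> StateT StateT"
  shows False
proof -
  define t1 t2 t3 t4 t5 where t: "t1 = Suc u" "t2 = Suc t1" "t3 = Suc t2" "t4 = Suc t3" "t5 = Suc t4"
  have eq: "u + 2 = t2" "u + 5 = t5" by (simp_all add: t)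
  have L: "c t2 x \<in> {NS, SS}" "c t2 (x + 1) = NS"
    using assms(1) unfolding eq by (simp_all add: locked_def)
  have t5: "c (Suc t4) (x - 1) = NL" "c (Suc t4) (x - 2) = SN"
    using assms(2,3) eq by (simp_all add: t)
  have "\<not> exits_left (c t4 (x - 1))" "\<not> exits_right (c t4 (x - 1))"
    using parents[OF t5(1)] parents[OF t5(2)] by simp_all
  then have t4x1: "c t4 (x - 1) = Empty" by (cases rule: cell_cases[of t4 "x - 1"]) auto
  have "exits_right (c t4 (x - 2))" using parents[OF t5(2)] by simp
  moreover have "c t4 (x - 2) \<noteq> RN" using RN_neighbour[of t4 "x - 2"] t4x1 by auto
  ultimately have t4x2: "c t4 (x - 2) \<in> {NS, SS}" by (cases rule: cell_cases[of t4 "x - 2"]) auto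
  have "exits_left (c t3 (x - 1))" "\<not> exits_right (c t3 (x - 1))"
    using parents[of t3 "x - 2" "c t4 (x - 2)"] parents[of t3 "x - 1" Empty] t4x2 t4x1 by (auto simp: t)
  then consider "c t3 (x - 1) = SN" | "c t3 (x - 1) = NL" by (cases rule: cell_cases[of t3 "x - 1"]) auto
  then show False
  proof cases
    case 1
    then have a: "exits_right (c t2 (x - 1))" "\<not> exits_left (c t2 x)"
      "\<not> \<tau> (cell_state (c t2 (x - 1))) (cell_state (c t2 x))"
      using parents[of t2 "x - 1" SN] by (simp_all add: t)
    then have t2: "c t2 x = NS" using L by auto
    have t2': "c t2 (x - 1) = RN"
      using a t2 SS by (cases rule: cell_cases[of t2 "x - 1"]) auto
    have "\<not> exits_left (c t1 x)" "\<not> exits_right (c t1 x)"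
      using parents[of t1 "x - 1" RN] parents[of t1 x NS] t2 t2' by (simp_all add: t)
    then have t1: "c t1 x = Empty" by (cases rule: cell_cases[of t1 x]) auto
    then have "c t1 (x - 1) = RN"
      using parents[of t1 "x - 1" RN] t2' SE by (cases rule: cell_cases[of t1 "x - 1"]) (auto simp: t)
    then show False using RN_neighbour[of t1 "x - 1"] t1 by simp
  next
    case 2
    then have "exits_left (c t2 x)" using parents[of t2 "x - 1" NL] by (simp add: t)
    then have t2: "c t2 x = SS" using L by auto
    have a: "exits_right (c t1 x)" "exits_left (c t1 (x + 1))" "\<not> exits_right (c t1 (x + 1))"
      "exits_left (c t1 (x + 2))" "\<not> \<tau> (cell_state (c t1 x)) (cell_state (c t1 (x + 1)))"
      "\<not> \<tau> (cell_state (c t1 (x + 1))) (cell_state (c t1 (x + 2)))"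
      using parents[of t1 x SS] parents[of t1 "x + 1" NS] t2 L by (simp_all add: t)
    have t1': "c t1 (x + 1) = NL"
      using a SS ST by (cases rule: cell_cases[of t1 "x + 1"]; cases rule: cell_cases[of t1 "x + 2"]) auto
    then have t1: "c t1 x = RN"
      using a ST by (cases rule: cell_cases[of t1 x]) auto
    have "\<not> exits_left (c u (x + 1))" "\<not> exits_right (c u (x + 1))"
      using parents[of u x RN] parents[of u "x + 1" NL] t1 t1' by (simp_all add: t)
    then have u: "c u (x + 1) = Empty" by (cases rule: cell_cases[of u "x + 1"]) auto
    then have "c u x = RN"
      using parents[of u x RN] t1 SE by (cases rule: cell_cases[of u x]) (auto simp: t)
    then show False using RN_neighbour[of u x] u by simp
  qed
qed

text \<open>Here an escape is locally possible, but its past is forced until the same configuration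
  appears at the same place three steps earlier. The times are \<open>u + 4\<close> and
  \<open>u + 1\<close> because the exclusion of \<open>RN\<close> at \<open>x + 1\<close> also looks
  at generation \<open>u\<close>.\<close>

lemma escaping_backward:
  assumes "escaping (u + 4) x" and ST: "\<not> \<tau> StateS StateT" and TT: "\<tau> StateT StateT"
  shows "escaping (u + 1) x"
proof -
  define t1 t2 t3 t4 t5 t6 t7 where t: "t1 = Suc u" "t2 = Suc t1" "t3 = Suc t2" "t4 = Suc t3"
    "t5 = Suc t4" "t6 = Suc t5" "t7 = Suc t6"
  have eq: "u + 4 = t4" "u + 1 = t1" by (simp_all add: t)
  have E: "c t4 x \<in> {NS, SS}" "c t4 (x + 1) = NS" "c t5 x = RN" "c t5 (x + 1) \<in> {SN, SS}"
    "c t6 x = SS" "c t6 (x - 1) = SN" "c t7 (x - 2) = NL"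
    using assms(1) unfolding eq by (simp_all add: escaping_def t)
  have "exits_right (c t5 (x - 1))" "\<not> \<tau> (cell_state (c t5 (x - 1))) StateT"
    using parents[of t5 "x - 1" SN] E by (simp_all add: t)
  then have t5x1: "c t5 (x - 1) \<in> {NS, SS}" using TT by (cases rule: cell_cases[of t5 "x - 1"]) auto
  have "exits_left (c t4 x)" using parents[of t4 "x - 1" "c t5 (x - 1)"] t5x1 by (auto simp: t)
  then have t4: "c t4 x = SS" using E by auto
  have "\<not> \<tau> (cell_state (c t4 (x - 1))) StateS"
    using parents[of t4 "x - 1" "c t5 (x - 1)"] t5x1 t4 by (auto simp: t)
  then have "cell_state (c t4 (x - 1)) = StateT"
    using SS ES by (cases rule: cell_cases[of t4 "x - 1"]) auto
  moreover have t6x2: "c t6 (x - 2) \<in> {Empty, SN}"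
    using parents[of t6 "x - 2" NL] E TS by (cases rule: cell_cases[of t6 "x - 2"]) (auto simp: t)
  have "c t4 (x - 1) \<noteq> RN"
  proof
    assume "c t4 (x - 1) = RN"
    then have "c t5 (x - 1) = SS" using t5x1 left_slot[of t4 "x - 1"] by (auto simp: t)
    then show False using right_slot[of t5 "x - 2"] t6x2 by (auto simp: t)
  qed
  ultimately have t4x1: "c t4 (x - 1) = NL" by (cases rule: cell_cases[of t4 "x - 1"]) auto
  then have t5x1: "c t5 (x - 1) = NS" using t5x1 left_slot[of t4 "x - 1"] by (auto simp: t)
  have t5x2: "c t5 (x - 2) = NL"
  proof -
    have "right_occupied (c t5 (x - 2))" using right_slot[of t4 "x - 2"] t4x1 by (simp add: t)
    moreover have "\<not> exits_right (c t5 (x - 2)) \<or> \<not> right_occupied (c t5 (x - 2))"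
    proof (rule ccontr)
      assume *: "\<not> ?thesis"
      then have "c t6 (x - 2) = SN" using left_slot[of t5 "x - 2"] t6x2 by (auto simp: t)
      then show False
        using * parents[of t5 "x - 2" SN] t5x1 SS by (cases rule: cell_cases[of t5 "x - 2"]) (auto simp: t)
    qed
    ultimately show ?thesis by (cases rule: cell_cases[of t5 "x - 2"]) auto
  qed
  have t4x2: "c t4 (x - 2) = NL"
    using parents[of t4 "x - 2" NL] t5x2 t4x1 ET ST by (cases rule: cell_cases[of t4 "x - 2"]) (auto simp: t)
  have t3: "c t3 x = SS"
    using parents[of t3 x SS] parents[of t3 "x - 1" NL] t4 t4x1 by (cases rule: cell_cases[of t3 x]) (auto simp: t)
  have t3x1: "c t3 (x - 1) = SN"
    using parents[of t3 "x - 1" NL] parents[of t3 "x - 2" NL] t4x1 t4x2 t3 TS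
    by (cases rule: cell_cases[of t3 "x - 1"]) (auto simp: t)
  have t3x3: "c t3 (x + 1) = NL"
    using parents[of t3 x SS] parents[of t3 "x + 1" NS] t4 E t3 SS
    by (cases rule: cell_cases[of t3 "x + 1"]) (auto simp: t)
  have t3x4: "c t3 (x + 2) \<in> {SN, SS}"
    using parents[of t3 "x + 1" NS] E t3x3 TT by (cases rule: cell_cases[of t3 "x + 2"]) (auto simp: t)
  have t2x2: "c t2 (x + 2) = SS"
    using parents[of t2 "x + 2" "c t3 (x + 2)"] parents[of t2 "x + 1" NL] t3x3 t3x4
    by (cases rule: cell_cases[of t2 "x + 2"]) (auto simp: t)
  have t2x1: "c t2 (x + 1) = SN"
    using parents[of t2 x SS] parents[of t2 "x + 1" NL] t3 t3x3 t2x2 TS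
    by (cases rule: cell_cases[of t2 "x + 1"]) (auto simp: t)
  have t2: "c t2 x = RN"
    using parents[of t2 x SS] t3 t2x1 SS by (cases rule: cell_cases[of t2 x]) (auto simp: t)
  have a1: "exits_right (c t1 x)" "\<not> exits_left (c t1 (x + 1))" "exits_right (c t1 (x + 1))"
    "\<not> exits_left (c t1 (x + 2))" "exits_right (c t1 (x + 2))"
    "\<not> \<tau> (cell_state (c t1 (x + 1))) (cell_state (c t1 (x + 2)))"
    "\<tau> (cell_state (c t1 x)) (cell_state (c t1 (x + 1)))"
    using parents[of t1 x RN] parents[of t1 "x + 1" SN] parents[of t1 "x + 2" SS] t2 t2x1 t2x2 by (simp_all add: t)
  have "c t1 (x + 1) \<noteq> RN"
  proof
    assume RN: "c t1 (x + 1) = RN"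
    then have "c t1 (x + 2) = NS" using a1 TT by (cases rule: cell_cases[of t1 "x + 2"]) auto
    then have "\<not> exits_left (c u (x + 2))" "\<not> exits_right (c u (x + 2))"
      using parents[of u "x + 1" RN] parents[of u "x + 2" NS] RN by (simp_all add: t)
    then have u: "c u (x + 2) = Empty" by (cases rule: cell_cases[of u "x + 2"]) auto
    then have "c u (x + 1) = RN"
      using parents[of u "x + 1" RN] RN SE by (cases rule: cell_cases[of u "x + 1"]) (auto simp: t)
    then show False using RN_neighbour[of u "x + 1"] u by simp
  qed
  then have t1x1: "c t1 (x + 1) = NS" using a1 by (cases rule: cell_cases[of t1 "x + 1"]) auto
  then have "c t1 x \<in> {NS, SS}" using a1 TS by (cases rule: cell_cases[of t1 x]) auto
  then show ?thesis
    unfolding eq escaping_def using t1x1 t2 t2x1 t3 t3x1 t4x2 by (simp add: t)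
qed

end

text \<open>Four cases for (ST, TT). For (1, 1) a locked pair recurs into the past. Otherwise it
  recurs into the future once an escape is excluded: by its past for (1, 0), by the regress of
  \<open>escaping\<close> for (0, 1), and by the bits themselves for (0, 0).\<close>

lemma no_RN:
  assumes n: "n > 0" and ET: "\<not> \<tau> StateE StateT"
  shows "c t x \<noteq> RN"
proof
  assume "c t x = RN"
  then obtain r s y where mr: "min_rank r" and L: "locked r s y"
      and SS: "\<tau> StateS StateS" and TS: "\<not> \<tau> StateT StateS"
    using ex_locked by blast
  have ES: "\<tau> StateE StateS" using ES_or_ET[OF n] ET by blast
  have shift: "locked r (u + m * p) z" if "locked r u (z + int m * D)" for u m z
  proof -
    have "c (Suc (u + m * p)) w = c (Suc u) (w + int m * D)"
      "c (Suc (Suc (u + m * p))) w = c (Suc (Suc u)) (w + int m * D)"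
      "count_from (Suc (u + m * p)) w = count_from (Suc u) (w + int m * D)" for w
      using periodic_mult[of "Suc u" m w] periodic_mult[of "Suc (Suc u)" m w]
        count_from_periodic[of "Suc u" m w] by simp_all
    note sh = this
    have "z + 1 + int m * D = z + int m * D + 1" by simp
    then show ?thesis using that unfolding locked_def periodic_mult sh by (simp only:)
  qed
  have nonempty: "c u z \<noteq> Empty" if "locked r u z" for u z
    using that by (auto simp: locked_def)
  note fwd = locked_forward[OF ES ET SS TS mr]
  have no_escape: False if fw: "\<And>u z. locked r u z \<Longrightarrow> locked r (u + 4) (z - 2)"
  proof -
    have many: "locked r (s + 4 * k) (y - 2 * int k)" for k
    proof (induction k)
      case (Suc k)
      then show ?case using fw[of "s + 4 * k" "y - 2 * int k"] by (simp add: algebra_simps)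
    qed (use L in simp)
    \<comment> \<open>\<open>4 * j\<close> periods contain \<open>j * p\<close> rounds of four
      steps. Each round moves the pair by \<open>-2\<close>, undoing the periods moves it by
      \<open>4 * j * D\<close>, and the total is positive by \<open>drift\<close>.\<close>
    have "c s (y + int j * (4 * D - 2 * int p)) \<noteq> Empty" for j
    proof -
      have "c (s + (4 * j) * p) (y - 2 * int (j * p)) \<noteq> Empty"
        using nonempty[OF many[of "j * p"]] by (simp add: algebra_simps)
      then show ?thesis unfolding periodic_mult by (simp add: algebra_simps)
    qed
    moreover have "y + int j * (4 * D - 2 * int p) \<ge> y + int j" for j
      using drift by (simp add: mult_le_cancel_left1)
    ultimately show False
      using not_unbounded_right[of s "\<lambda>j. y + int j * (4 * D - 2 * int p)" y] by blast
  qed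
  consider "\<tau> StateS StateT" "\<tau> StateT StateT" | "\<tau> StateS StateT" "\<not> \<tau> StateT StateT"
    | "\<not> \<tau> StateS StateT" "\<tau> StateT StateT" | "\<not> \<tau> StateS StateT" "\<not> \<tau> StateT StateT"
    by blast
  then show False
  proof cases
    case 1
    have many: "locked r u (z + 2 * int k)" if "locked r (u + 4 * k) z" for u z k
      using that
    proof (induction k arbitrary: z)
      case (Suc k)
      then have "locked r ((u + 4 * k) + 4) z" by (simp add: algebra_simps)
      then have "locked r (u + 4 * k) (z + 2)" by (rule locked_backward[OF ES ET SS TS mr _ 1])
      then show ?case using Suc.IH[of "z + 2"] by (simp add: algebra_simps)
    qed simp
    have "c s (y - int j * (4 * D - 2 * int p)) \<noteq> Empty" for j
    proof -
      have "locked r (s + (4 * j) * p) (y - int (4 * j) * D)"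
        using L by (intro shift) simp
      then have "locked r s (y - int (4 * j) * D + 2 * int (j * p))"
        by (intro many) (simp add: algebra_simps)
      then show ?thesis using nonempty by (simp add: algebra_simps)
    qed
    moreover have "y - int j * (4 * D - 2 * int p) \<le> y - int j" for j
      using drift by (simp add: mult_le_cancel_left1)
    ultimately show False
      using not_unbounded_left[of s "\<lambda>j. y - int j * (4 * D - 2 * int p)" y] by blast
  next
    case 2
    show False
    proof (rule no_escape, rule ccontr)
      fix u z assume L: "locked r u z" and no: "\<not> locked r (u + 4) (z - 2)"
      then have esc: "c (u + 3) (z - 1) = NL" "c (u + 3) (z - 2) = SN"
        using fwd[OF L] 2 by auto
      \<comment> \<open>Two periods later at least two earlier generations exist.\<close>
      obtain v where v: "u + 2 * p = v + 2" using p_pos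
        by (metis add.commute le_Suc_ex mult_le_mono2 nat_mult_1_right Suc_leI trans_le_add2 One_nat_def)
      have "locked r (v + 2) (z - 2 * D)"
        using shift[of u "z - 2 * D" 2] L v by simp
      moreover have "c (v + 5) (z - 2 * D - 1) = NL" "c (v + 5) (z - 2 * D - 2) = SN"
      proof -
        have "u + 3 + 2 * p = v + 5" using v by simp
        from arg_cong[OF this, of c] have "c (v + 5) w = c (u + 3) (w + 2 * D)" for w
          using periodic_mult[of "u + 3" 2 w] by (metis of_nat_numeral)
        then show "c (v + 5) (z - 2 * D - 1) = NL" "c (v + 5) (z - 2 * D - 2) = SN"
          using esc by simp_all
      qed
      ultimately show False
        using no_escape_ST[OF ES ET SS TS _ _ _ 2] by blast
    qed
  next
    case 3
    show False
    proof (rule no_escape, rule ccontr)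
      fix u z assume L: "locked r u z" and no: "\<not> locked r (u + 4) (z - 2)"
      then have esc: "c (Suc (Suc (Suc u))) (z - 1) = NL" "c (Suc (Suc (Suc u))) (z - 2) = NL"
        using fwd[OF L] 3 by (auto simp: eval_nat_numeral)
      have "exits_left (c (Suc (Suc u)) (z - 1))" "\<not> exits_right (c (Suc (Suc u)) (z - 1))"
        "\<tau> (cell_state (c (Suc (Suc u)) (z - 1))) (cell_state (c (Suc (Suc u)) z))"
        using parents[OF esc(1)] parents[OF esc(2)] by simp_all
      then have "c (Suc (Suc u)) (z - 1) = SN"
        using L TS by (cases rule: cell_cases[of "Suc (Suc u)" "z - 1"]) (auto simp: locked_def)
      then have E: "escaping u z"
        using L esc by (auto simp: escaping_def locked_def)
      have shiftE: "escaping (u + m * p) w" if "escaping u (w + int m * D)" for u m w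
      proof -
        have "c (Suc (u + m * p)) v = c (Suc u) (v + int m * D)"
          "c (Suc (Suc (u + m * p))) v = c (Suc (Suc u)) (v + int m * D)"
          "c (Suc (Suc (Suc (u + m * p)))) v = c (Suc (Suc (Suc u))) (v + int m * D)" for v
          using periodic_mult[of "Suc u" m v] periodic_mult[of "Suc (Suc u)" m v]
            periodic_mult[of "Suc (Suc (Suc u))" m v] by simp_all
        note sh = this
        have "w + 1 + int m * D = w + int m * D + 1" "w - 1 + int m * D = w + int m * D - 1"
          "w - 2 + int m * D = w + int m * D - 2" by simp_all
        then show ?thesis using that unfolding escaping_def periodic_mult sh by (simp only:)
      qed
      have many: "escaping (w + 1) z" if "escaping (w + 1 + 3 * k) z" for w z k
        using that
      proof (induction k)
        case (Suc k)
        then have "escaping ((w + 3 * k) + 4) z" by (simp add: algebra_simps)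
        then have "escaping ((w + 3 * k) + 1) z" by (rule escaping_backward[OF ES ET SS TS _ 3])
        then show ?case using Suc.IH by (simp add: algebra_simps)
      qed simp
      obtain v where v: "u + p = v + 1" using p_pos by (metis Suc_eq_plus1 add_Suc_right gr0_implies_Suc)
      have "escaping (v + 1) (z - D - int j * (3 * D))" for j
      proof -
        have "escaping (u + (1 + 3 * j) * p) (z - int (1 + 3 * j) * D)"
          using E by (intro shiftE) simp
        moreover have "u + (1 + 3 * j) * p = v + 1 + 3 * (j * p)"
          using v by (simp add: algebra_simps)
        ultimately have "escaping (v + 1 + 3 * (j * p)) (z - int (1 + 3 * j) * D)" by (simp only:)
        then show ?thesis using many[of v "j * p"] by (simp add: algebra_simps)
      qed
      moreover have "escaping q w \<Longrightarrow> c q w \<noteq> Empty" for q w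
        by (auto simp: escaping_def)
      ultimately have "c (v + 1) (z - D - int j * (3 * D)) \<noteq> Empty" for j
        by blast
      moreover have "z - D - int j * (3 * D) \<le> z - D - int j" for j
        using D_pos by (simp add: mult_le_cancel_left1)
      ultimately show False
        using not_unbounded_left[of "v + 1" "\<lambda>j. z - D - int j * (3 * D)" "z - D"] by blast
    qed
  next
    case 4
    show False by (rule no_escape) (use fwd 4 in blast)
  qed
qed

section \<open>Contacts, the potential and the spread of the strands\<close>

text \<open>By the choice of \<open>pos\<close>, this says that no strand of higher rank is in the
  cell of strand \<open>r\<close> or in the cell to its left.\<close>

definition free :: "nat \<Rightarrow> nat \<Rightarrow> bool" where
  "free t r \<longleftrightarrow> count_from t (pos t r - 1) \<le> Suc r"

lemma not_free:
  assumes "r < n" "\<not> free t r"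
  shows "Suc r < n" "pos t (Suc r) \<ge> pos t r - 1"
proof -
  have r: "Suc r < count_from t (pos t r - 1)" using assms(2) by (simp add: free_def)
  then show *: "Suc r < n" using count_from_le[of t "pos t r - 1"] by simp
  show "pos t (Suc r) \<ge> pos t r - 1" using pos_ge[OF * r] .
qed

text \<open>If strand \<open>r\<close> were always free, the empty cell to its left would follow it
  through all generations: a null chain between it and strand \<open>Suc r\<close>.\<close>

lemma ex_not_free:
  assumes "Suc r < n"
  shows "\<exists>t. \<not> free t r"
proof (rule ccontr)
  assume free: "\<not> ?thesis"
  have r: "r < n" using assms by simp
  show False
  proof (rule no_null_chain[of "\<lambda>t. pos t r - 1"])
    show "c t (pos t r - 1) = Empty" for t
    proof -
      have "count_from t (pos t r - 1) \<le> Suc r" using free by (simp add: free_def)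
      then have "strands (c t (pos t r - 1)) = 0"
        using pos(2)[OF r, of t] count_from_Suc[of t "pos t r - 1"] by simp
      then show ?thesis using strands_pos[of t "pos t r - 1"] by auto
    qed
    show "pos (Suc t) r - 1 \<in> {pos t r - 1, pos t r - 1 - 1}" for t
      using pos_step[OF r, of t] by auto
    show "\<exists>y>pos 0 r - 1. c 0 y \<noteq> Empty"
      using pos_nonempty[OF r, of 0] by (intro exI[of _ "pos 0 r"]) simp
    have "pos 0 (Suc r) < pos 0 r - 1"
    proof (rule ccontr)
      assume "\<not> ?thesis"
      then have "count_from 0 (pos 0 (Suc r)) \<le> count_from 0 (pos 0 r - 1)"
        by (intro count_from_antimono) simp
      then show False
        using free pos(2)[OF assms, of 0] unfolding free_def by (meson not_le order_trans)
    qed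
    then show "\<exists>y<pos 0 r - 1. c 0 y \<noteq> Empty"
      using pos_nonempty[OF assms, of 0] by blast
  qed
qed

text \<open>The strands move rigidly, so a single contact fixes the distance of two neighbours for
  all time.\<close>

lemma spread_all_left:
  assumes "\<tau> StateE StateT" "r < n"
  shows "pos t 0 - pos t r \<le> int r"
  using assms(2)
proof (induction r)
  case (Suc r)
  have move: "pos t s = pos 0 s - int t" if "s < n" for t s
    by (induction t) (use all_move_left[OF assms(1) that] in auto)
  obtain u where u: "\<not> free u r" using ex_not_free[OF Suc.prems] by blast
  have "pos u (Suc r) \<ge> pos u r - 1" using not_free(2)[OF _ u] Suc.prems by simp
  then show ?case
    using Suc move[of r u] move[of "Suc r" u] move[of r t] move[of "Suc r" t] by simp
qed simp

text \<open>The place in the cycle \<open>SN\<close>, \<open>NL\<close>, \<open>NS\<close>. In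
  \<open>SS\<close> the strand of the right slot counts as in \<open>NS\<close> and that of the left
  slot as in \<open>SN\<close>; \<open>RN\<close> takes the default value, but \<open>no_RN\<close>
  excludes it where the cycle is used.\<close>

definition phase :: "nat \<Rightarrow> nat \<Rightarrow> int" where
  "phase t r = (case c t (pos t r) of NL \<Rightarrow> 1 | NS \<Rightarrow> 2
     | SS \<Rightarrow> if count_from t (pos t r + 1) = r then 2 else 0 | _ \<Rightarrow> 0)"

text \<open>A strand that is not influenced by its left neighbour repeats the moves left, left, right;
  the potential below is constant along this cycle.\<close>

definition potential :: "nat \<Rightarrow> nat \<Rightarrow> int" where
  "potential t r = 3 * pos t r + 2 * int t + phase t r"

lemma phase_bounds: "0 \<le> phase t r" "phase t r \<le> 2"
  by (auto simp: phase_def split: cell.split)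

context
  assumes n_pos: "n > 0" and ET: "\<not> \<tau> StateE StateT"
begin

text \<open>A left move changes the three terms by -3, 2 and 1, the step in place by 0, 2 and
  -2.\<close>

lemma potential_free:
  assumes r: "r < n" and "free t r"
  shows "potential (Suc t) r = potential t r"
proof -
  define x where "x = pos t r"
  have cnt: "count_from t (x - 1) \<le> Suc r" "r < count_from t x" "count_from t (x + 1) \<le> r"
    using assms pos[OF r, of t] by (simp_all add: free_def x_def)
  have rec: "count_from t (x - 1) = strands (c t (x - 1)) + count_from t x"
    using count_from_Suc[of t "x - 1"] by simp
  have cx: "count_from t x = Suc r" using cnt rec by simp
  have E: "c t (x - 1) = Empty" using cnt rec cx strands_pos[of t "x - 1"] by fastforce
  have rec': "Suc r = strands (c t x) + count_from t (x + 1)" using count_from_Suc[of t x] cx by simp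
  have ES: "\<tau> StateE StateS" using ES_or_ET[OF n_pos] ET by blast
  have left: "pos (Suc t) r = x - 1 \<and> c (Suc t) (x - 1) = (if c t x = NL then NS else NL)" if "exits_left (c t x)"
  proof
    show "pos (Suc t) r = x - 1"
      using pos_step[OF r, of t] count_from_step[of t x] that cx by (auto simp flip: x_def)
    show "c (Suc t) (x - 1) = (if c t x = NL then NS else NL)"
      using step[of t "x - 1"] E that ES ET by (cases rule: cell_cases[of t x]) auto
  qed
  have right: "pos (Suc t) r = x \<and> phase (Suc t) r = 0" if "c t x = NS"
  proof
    show x': "pos (Suc t) r = x"
      using pos_step[OF r, of t] count_from_step[of t x] that cx by (auto simp flip: x_def)
    have "count_from (Suc t) x = Suc r"
      using count_from_step[of t x] that cx by simp
    moreover have "left_occupied (c (Suc t) x)" using left_slot[of t x] that by simp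
    ultimately show "phase (Suc t) r = 0"
      using no_RN[OF n_pos ET, of "Suc t" x] count_from_Suc[of "Suc t" x] x'
      by (cases rule: cell_cases[of "Suc t" x]) (auto simp: phase_def)
  qed
  consider "c t x = SN" | "c t x = SS" | "c t x = NL" | "c t x = NS"
    using no_RN[OF n_pos ET, of t x] pos_nonempty[OF r, of t]
    by (cases rule: cell_cases[of t x]) (auto simp: x_def)
  then show ?thesis
  proof cases
    case 2
    then have "count_from t (x + 1) \<noteq> r" using rec' by simp
    then show ?thesis using 2 left by (simp add: potential_def phase_def x_def)
  next
    case 4
    then show ?thesis using right by (simp add: potential_def phase_def[of t] x_def)
  qed (use left in \<open>auto simp: potential_def phase_def x_def\<close>)
qed

text \<open>7 = 3 + 2 + 2: at most one place right of the neighbour, one time step, and at most 2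
  for the phase.\<close>

lemma potential_not_free:
  assumes r: "r < n" and "\<not> free t r"
  shows "potential (Suc t) r \<le> potential t (Suc r) + 7"
  using not_free[OF assms] pos_step[OF r, of t] phase_bounds[of "Suc t" r] phase_bounds[of t "Suc r"]
  by (auto simp: potential_def split: if_splits)

lemma potential_last: "potential t (n - 1) = potential 0 (n - 1)"
proof (induction t)
  case (Suc t)
  have "free t (n - 1)" using not_free(1)[of "n - 1" t] n_pos by auto
  then show ?case using potential_free[of "n - 1" t] n_pos Suc.IH by simp
qed simp

text \<open>A period changes every potential by the same amount \<open>2 * p - 3 * D\<close>. It
  vanishes because the potential of the leftmost strand, which is always free, is constant.\<close>

lemma potential_periodic:
  assumes "r < n"
  shows "potential (t + m * p) r = potential t r"
proof -
  have shift: "potential (t + m * p) s = potential t s + int m * (2 * int p - 3 * D)" if "s < n" for s t m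
    using that by (simp add: potential_def phase_def pos_periodic periodic_mult count_from_periodic algebra_simps)
  have "2 * int p - 3 * D = 0"
    using shift[of "n - 1" 0 1] potential_last[of "0 + 1 * p"] n_pos by simp
  then show ?thesis using shift[OF assms] by simp
qed

text \<open>Induction over the strands from left to right. After a contact each step either keeps
  the potential or resets it to at most the bound of the left neighbour plus 7; earlier times are
  reached by periodicity.\<close>

lemma potential_bound:
  assumes "r < n"
  shows "potential t r \<le> potential 0 (n - 1) + 7 * int (n - 1 - r)"
proof -
  have "potential t (n - 1 - k) \<le> potential 0 (n - 1) + 7 * int k" if "k < n" for k t
    using that
  proof (induction k arbitrary: t)
    case 0
    then show ?case using potential_last[of t] by simp
  next
    case (Suc k)
    define r where "r = n - 1 - Suc k"
    have r: "r < n" "Suc r < n" "n - 1 - k = Suc r" using Suc.prems by (auto simp: r_def)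
    have IH: "potential s (Suc r) \<le> potential 0 (n - 1) + 7 * int k" for s
      using Suc.IH[of s] Suc.prems r by simp
    obtain t0 where t0: "\<not> free t0 r" using ex_not_free[OF r(2)] by blast
    have after: "potential (Suc t0 + j) r \<le> potential 0 (n - 1) + 7 * int (Suc k)" for j
    proof (induction j)
      case 0
      then show ?case using potential_not_free[OF r(1) t0] IH[of t0] by simp
    next
      case (Suc j)
      show ?case
      proof (cases "free (Suc t0 + j) r")
        case True
        then show ?thesis using potential_free[OF r(1) True] Suc by simp
      next
        case False
        then show ?thesis using potential_not_free[OF r(1) False] IH[of "Suc t0 + j"] by simp
      qed
    qed
    have "Suc t0 \<le> t + Suc t0 * p"
      using p_pos by (metis Suc_leI le_add2 le_trans mult_le_mono2 nat_mult_1_right One_nat_def)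
    then obtain j where "t + Suc t0 * p = Suc t0 + j" by (metis le_iff_add)
    then show ?case
      using after[of j] potential_periodic[OF r(1), of t "Suc t0"] by (simp add: r_def)
  qed
  from this[of "n - 1 - r" t] assms show ?thesis by simp
qed

text \<open>Three times the spread is at most \<open>7 * (n - 1) + 2\<close>, which is rounded up to
  \<open>9 * n\<close>.\<close>

lemma spread_free: "pos t 0 - pos t (n - 1) \<le> 3 * int n"
proof -
  have "potential t 0 \<le> potential t (n - 1) + 7 * int (n - 1)"
    using potential_bound[of 0 t] potential_last[of t] n_pos by simp
  then show ?thesis
    using phase_bounds[of t 0] phase_bounds[of t "n - 1"] n_pos by (simp add: potential_def of_nat_diff)
qed

end

theorem width_bound:
  assumes "c t x \<noteq> Empty" "c t y \<noteq> Empty"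
  shows "y - x \<le> 3 * int n"
proof -
  obtain r s where rs: "r < n" "pos t r = x" "s < n" "pos t s = y"
    using nonempty_pos[OF assms(1)] nonempty_pos[OF assms(2)] by metis
  have "pos t (n - 1) \<le> x" "y \<le> pos t 0"
    using rs pos_antimono[of "n - 1" r t] pos_antimono[of s 0 t] by auto
  moreover have "pos t 0 - pos t (n - 1) \<le> 3 * int n"
  proof (cases "\<tau> StateE StateT")
    case True
    then show ?thesis using spread_all_left[OF True, of "n - 1" t] rs by simp
  next
    case False
    then show ?thesis using spread_free[of t] rs by simp
  qed
  ultimately show ?thesis by simp
qed

end

section \<open>Finiteness of the set of non-crossing pure gliders\<close>

text \<open>The skewed coordinate of cell 0. It drops by one exactly when \<open>child_pos\<close>
  adds 1, which undoes the renormalization.\<close>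

fun offset :: "pattern \<Rightarrow> nat \<Rightarrow> int" where
  "offset g 0 = 0"
| "offset g (Suc t) = offset g t - of_bool (exits_left (g t 0))"

definition lab :: "pattern \<Rightarrow> pattern" where
  "lab g t x = g t (x - offset g t)"

lemma child_lab: "child (g t) (g (Suc t)) (x - offset g t) = lab g (Suc t) x"
  by (simp add: child_def child_pos_def lab_def add_ac algebra_simps)

lemma per_minimal:
  assumes "is_power b g"
  shows "length (per g) \<le> length b"
proof -
  let ?P = "\<lambda>a. is_power a g \<and> (\<forall>b. is_power b g \<longrightarrow> length a \<le> length b)"
  obtain a where a: "?P a"
    using ex_has_least_nat[of "\<lambda>a. is_power a g" b length] assms by blast
  have "length a \<le> length (per g)" using a per_is_power[OF assms] by blast
  have "c = a" if "?P c" for c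
  proof (rule nth_equalityI)
    show len: "length c = length a" using that a by (meson le_antisym)
    fix i assume "i < length c"
    then have "i mod length c = i" "i mod length a = i" using len by simp_all
    moreover have "g i = c ! (i mod length c)" "g i = a ! (i mod length a)"
      using that a unfolding is_power_def by blast+
    ultimately show "c ! i = a ! i" by simp
  qed
  with a have "?P (per g)" unfolding per_def by (rule theI)
  then show ?thesis using assms by blast
qed

locale repeating_pattern =
  fixes g :: pattern and n :: nat
  assumes rep: "repeating_sca n g" and nc: "non_crossing g"
begin

definition p :: nat where "p = length (per g)"
definition D :: int where "D = - offset g p"

lemma power: "is_power (per g) g"
  using rep per_is_power by (auto simp: repeating_sca_def)

lemma p_pos: "p > 0"
  using power by (simp add: is_power_def p_def)

lemma g_nth: "g t = per g ! (t mod p)"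
  using power by (simp add: is_power_def p_def)

lemma g_periodic: "g (t + p) = g t"
  by (simp add: g_nth)

lemma g_periodic_mult: "g (t + m * p) = g t"
  by (simp add: g_nth)

lemma gen: "is_generation n (g t)"
  using rep by (simp add: repeating_sca_def sca_pattern_def grid_pattern_def)

lemma gen0: "g t 0 \<noteq> Empty" and gen_neg: "j < 0 \<Longrightarrow> g t j = Empty"
  and gen_fin: "finite (gen_support (g t))"
  using gen[of t] by (auto simp: is_generation_def)

lemma cont: "left_occupied (child (g t) (g (Suc t)) k) \<longleftrightarrow> exits_right (g t k)"
  "right_occupied (child (g t) (g (Suc t)) k) \<longleftrightarrow> exits_left (g t (k + 1))"
  using rep by (auto simp: repeating_sca_def sca_pattern_def continuous_pattern_def)

lemma lab_left: "left_occupied (lab g (Suc t) x) \<longleftrightarrow> exits_right (lab g t x)"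
  using cont(1)[of t "x - offset g t"] unfolding child_lab by (simp add: lab_def)

lemma lab_right: "right_occupied (lab g (Suc t) x) \<longleftrightarrow> exits_left (lab g t (x + 1))"
  using cont(2)[of t "x - offset g t"] unfolding child_lab by (simp add: lab_def algebra_simps)

lemma lab_turning:
  assumes "turning_rule_of r g" "lab g (Suc t) x \<noteq> Empty"
  shows "cell_state (lab g (Suc t) x) =
    (if r ! turning_bit (cell_state (lab g t x)) (cell_state (lab g t (x + 1))) then StateT else StateS)"
proof -
  have "\<forall>k. let C = child (g t) (g (Suc t)) k in
     C \<noteq> Empty \<longrightarrow>
     cell_state C = (if r ! turning_bit (cell_state (g t k)) (cell_state (g t (k + 1))) then StateT else StateS)"
    using assms(1) by (simp add: turning_rule_of_def)
  from spec[OF this, of "x - offset g t"]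
  have "lab g (Suc t) x \<noteq> Empty \<longrightarrow> cell_state (lab g (Suc t) x) =
      (if r ! turning_bit (cell_state (g t (x - offset g t))) (cell_state (g t (x - offset g t + 1))) then StateT else StateS)"
    unfolding child_lab Let_def .
  moreover have "lab g t x = g t (x - offset g t)" "lab g t (x + 1) = g t (x - offset g t + 1)"
    by (simp_all add: lab_def algebra_simps)
  ultimately show ?thesis using assms(2) by (simp only: simp_thms)
qed

lemma lab_nc: "lab g t x \<noteq> ZX" "lab g t x \<noteq> SX"
  using nc by (auto simp: non_crossing_def lab_def)

lemma offset_periodic: "offset g (t + p) = offset g t - D"
  by (induction t) (simp_all add: D_def g_periodic)

lemma lab_periodic: "lab g (t + p) x = lab g t (x + D)"
  by (simp add: lab_def offset_periodic g_periodic algebra_simps)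

lemma lab_support: "{x. lab g t x \<noteq> Empty} = (\<lambda>x. x + offset g t) ` gen_support (g t)"
  by (auto simp: lab_def gen_support_def image_iff intro!: exI[of _ "_ - offset g t"])

lemma lab_finite: "finite {x. lab g t x \<noteq> Empty}"
  unfolding lab_support using gen_fin by simp

lemma lab_total: "(\<Sum>x | lab g t x \<noteq> Empty. strands (lab g t x)) = n"
proof -
  have "(\<Sum>x | lab g t x \<noteq> Empty. strands (lab g t x)) = strand_count (g t)"
    unfolding lab_support strand_count_def by (simp add: sum.reindex inj_on_def lab_def)
  then show ?thesis using gen by (simp add: is_generation_def)
qed

text \<open>The infinite chain is cut off after one period, which is all that a null chain of
  \<open>per g\<close> asks for.\<close>

lemma lab_null_chain:
  assumes "\<And>i. lab g i (d i) = Empty" "\<And>i. d (Suc i) \<in> {d i, d i - 1}"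
    "\<exists>y<d 0. lab g 0 y \<noteq> Empty" "\<exists>y>d 0. lab g 0 y \<noteq> Empty"
  shows False
proof -
  define cs where "cs = map (\<lambda>i. d i - offset g i) [0..<p]"
  have nth: "cs ! i = d i - offset g i" if "i < p" for i
    using that by (simp add: cs_def)
  have g: "per g ! i = g i" if "i < p" for i
    using that by (simp add: g_nth)
  have "null_chain (per g) cs"
    unfolding null_chain_def p_def[symmetric]
  proof (intro conjI allI impI)
    show "length cs = p" by (simp add: cs_def)
    show "(per g ! i) (cs ! i) = Empty" if "i < p" for i
      using assms(1)[of i] that by (simp add: nth g lab_def)
    show "\<exists>j<cs ! 0. (per g ! 0) j \<noteq> Empty" "\<exists>j>cs ! 0. (per g ! 0) j \<noteq> Empty"
      using assms(3,4) p_pos by (simp_all add: nth g lab_def)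
    show "cs ! Suc i \<in> {child_pos (per g ! i) (cs ! i - 1), child_pos (per g ! i) (cs ! i)}"
      if "Suc i < p" for i
      using assms(2)[of i] that by (auto simp: nth g child_pos_def)
  qed
  then show False using rep by (auto simp: repeating_sca_def)
qed

text \<open>The edge shift is \<open>a + b - 1\<close>, where \<open>a\<close> and \<open>b\<close> tell whether the first strand moved left in the last and
  in the next step.\<close>

lemma speed_eq: "fst (speed g) = 2 * D - int p"
proof -
  define a where "a t = (of_bool (\<not> left_occupied (g t 0)) :: int)" for t
  define b where "b t = (of_bool (exits_left (g t 0)) :: int)" for t
  have es: "edge_shift (g t) = a t + b t - 1" for t
    using gen0[of t] by (cases "g t 0") (auto simp: edge_shift_def a_def b_def)
  have ab: "a (Suc t) = b t" for t
  proof (cases "exits_left (g t 0)")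
    case True
    then have "child (g t) (g (Suc t)) (-1) = g (Suc t) 0" by (simp add: child_def child_pos_def)
    then have "\<not> left_occupied (g (Suc t) 0)" using cont(1)[of t "-1"] gen_neg[of "-1" t] by simp
    then show ?thesis using True by (simp add: a_def b_def)
  next
    case False
    then have "child (g t) (g (Suc t)) 0 = g (Suc t) 0" by (simp add: child_def child_pos_def)
    moreover have "exits_right (g t 0)" using False gen0[of t] by (cases "g t 0") auto
    ultimately have "left_occupied (g (Suc t) 0)" using cont(1)[of t 0] by simp
    then show ?thesis using False by (simp add: a_def b_def)
  qed
  have sum_a: "(\<Sum>t<k. a (Suc t)) = (\<Sum>t<k. a t) + a k - a 0" for k
    by (induction k) auto
  have "a p = a 0" using g_periodic[of 0] by (simp add: a_def)
  then have "(\<Sum>t<p. a t) = (\<Sum>t<p. b t)" using sum_a[of p] by (simp add: ab)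
  moreover have "(\<Sum>t<k. b t) = - offset g k" for k
    by (induction k) (simp_all add: b_def)
  moreover have "fst (speed g) = (\<Sum>t<p. edge_shift (g t))"
    by (simp add: speed_def sum_list_sum_nth p_def[symmetric] g_nth atLeast0LessThan)
  ultimately show ?thesis by (simp add: es sum.distrib sum_subtractf D_def)
qed

end

fun mirror :: "cell \<Rightarrow> cell" where
  "mirror SN = NS" | "mirror NS = SN" | "mirror RN = NL" | "mirror NL = RN" | "mirror C = C"

lemma mirror_simps [simp]:
  "left_occupied (mirror C) = right_occupied C" "right_occupied (mirror C) = left_occupied C"
  "exits_left (mirror C) = exits_right C" "exits_right (mirror C) = exits_left C"
  "cell_state (mirror C) = cell_state C" "strands (mirror C) = strands C"
  "mirror C = Empty \<longleftrightarrow> C = Empty" "mirror C = ZX \<longleftrightarrow> C = ZX" "mirror C = SX \<longleftrightarrow> C = SX"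
  by (cases C; simp)+

context repeating_pattern
begin

lemma flow_positive:
  assumes "positive_speed g" "turning_rule_of r g" "\<not> r ! 1"
  shows "strand_flow (lab g) (\<lambda>u v. r ! turning_bit u v) p D n"
proof
  show "2 * D > int p" using assms(1) speed_eq by (simp add: positive_speed_def)
  show "False" if "\<And>i. lab g i (d i) = Empty" "\<And>i. d (Suc i) \<in> {d i, d i - 1}"
    "\<exists>y<d 0. lab g 0 y \<noteq> Empty" "\<exists>y>d 0. lab g 0 y \<noteq> Empty" for d
    using that by (rule lab_null_chain)
qed (simp_all add: lab_nc lab_left lab_right lab_turning[OF assms(2)] lab_finite lab_total lab_periodic
    p_pos assms(3)[simplified])

text \<open>The reflection also subtracts \<open>t\<close> because the skewed frame is not
  symmetric: staying and moving by \<open>-1\<close> have to change places. This turns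
  \<open>D\<close> into \<open>p - D\<close>, and swapping the arguments of the rule turns ES into
  SE.\<close>

lemma flow_negative:
  assumes "negative_speed g" "turning_rule_of r g" "\<not> r ! 3"
  shows "strand_flow (\<lambda>t x. mirror (lab g t (- x - int t))) (\<lambda>u v. r ! turning_bit v u) p (int p - D) n"
proof
  fix t x
  have sup: "{x. mirror (lab g t (- x - int t)) \<noteq> Empty} = (\<lambda>x. - x - int t) ` {x. lab g t x \<noteq> Empty}"
    by (auto simp: image_iff intro!: exI[of _ "- _ - int t"])
  show "mirror (lab g t (- x - int t)) \<noteq> ZX" "mirror (lab g t (- x - int t)) \<noteq> SX"
    using lab_nc by simp_all
  have e: "- x - int (Suc t) = - (x + 1) - int t" by simp
  show "left_occupied (mirror (lab g (Suc t) (- x - int (Suc t)))) =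
      exits_right (mirror (lab g t (- x - int t)))"
    using lab_right[of t "- x - int (Suc t)"] by simp
  show "right_occupied (mirror (lab g (Suc t) (- x - int (Suc t)))) =
      exits_left (mirror (lab g t (- (x + 1) - int t)))"
    using lab_left[of t "- x - int (Suc t)"] unfolding e by (simp only: mirror_simps)
  show "cell_state (mirror (lab g (Suc t) (- x - int (Suc t)))) =
      (if r ! turning_bit (cell_state (mirror (lab g t (- (x + 1) - int t))))
        (cell_state (mirror (lab g t (- x - int t)))) then StateT else StateS)"
    if "mirror (lab g (Suc t) (- x - int (Suc t))) \<noteq> Empty"
  proof -
    have "- (x + 1) - int t + 1 = - x - int t" by simp
    then show ?thesis
      using lab_turning[OF assms(2), of t "- x - int (Suc t)"] that unfolding e by (simp only: mirror_simps simp_thms)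
  qed
  show "\<not> r ! turning_bit StateE StateS" using assms(3) by simp
  show "finite {x. mirror (lab g t (- x - int t)) \<noteq> Empty}"
    unfolding sup using lab_finite by simp
  show "(\<Sum>x | mirror (lab g t (- x - int t)) \<noteq> Empty. strands (mirror (lab g t (- x - int t)))) = n"
    unfolding sup using lab_total[of t] by (simp add: sum.reindex inj_on_def)
  show "mirror (lab g (t + p) (- x - int (t + p))) = mirror (lab g t (- (x + (int p - D)) - int t))"
    by (simp add: lab_periodic algebra_simps)
  show "p > 0" by (rule p_pos)
  show "2 * (int p - D) > int p"
    using assms(1) speed_eq by (simp add: negative_speed_def)
next
  fix d :: "nat \<Rightarrow> int"
  assume d: "\<And>i. mirror (lab g i (- d i - int i)) = Empty" "\<And>i. d (Suc i) \<in> {d i, d i - 1}"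
    "\<exists>y<d 0. mirror (lab g 0 (- y - int 0)) \<noteq> Empty" "\<exists>y>d 0. mirror (lab g 0 (- y - int 0)) \<noteq> Empty"
  show False
  proof (rule lab_null_chain[of "\<lambda>i. - d i - int i"])
    show "- d (Suc i) - int (Suc i) \<in> {- d i - int i, - d i - int i - 1}" for i
      using d(2)[of i] by auto
    obtain y where "y > d 0" "lab g 0 (- y) \<noteq> Empty" using d(4) by auto
    then show "\<exists>y<(- d 0 - int 0). lab g 0 y \<noteq> Empty" by (intro exI[of _ "- y"]) simp
    obtain y where "y < d 0" "lab g 0 (- y) \<noteq> Empty" using d(3) by auto
    then show "\<exists>y>(- d 0 - int 0). lab g 0 y \<noteq> Empty" by (intro exI[of _ "- y"]) simp
  qed (use d(1) in simp)
qed

text \<open>Each child is \<open>next_cell\<close> of its parents, and where it is placed depends on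
  cell 0 only.\<close>

lemma deterministic:
  assumes "turning_rule_of r g" "g i = g j"
  shows "g (Suc i) = g (Suc j)"
proof
  fix x
  let ?\<tau> = "\<lambda>u v. r ! turning_bit u v"
  have step: "g (Suc t) x =
      next_cell ?\<tau> (g t (x - of_bool (exits_left (g t 0)))) (g t (x - of_bool (exits_left (g t 0)) + 1))" for t
  proof -
    define k where "k = x - of_bool (exits_left (g t 0))"
    have C: "child (g t) (g (Suc t)) k = g (Suc t) x" by (simp add: child_def child_pos_def k_def)
    have "g (Suc t) x \<noteq> Empty \<Longrightarrow> cell_state (g (Suc t) x) =
        (if ?\<tau> (cell_state (g t k)) (cell_state (g t (k + 1))) then StateT else StateS)"
      using assms(1) C unfolding turning_rule_of_def Let_def by metis
    moreover have "g (Suc t) x \<noteq> ZX" "g (Suc t) x \<noteq> SX" using nc by (simp_all add: non_crossing_def)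
    ultimately show ?thesis
      using cont[of t k] unfolding C k_def[symmetric]
      by (cases "g (Suc t) x") (auto split: if_splits)
  qed
  show "g (Suc i) x = g (Suc j) x" unfolding step assms(2) by simp
qed

text \<open>By determinism, an equality within one period would make \<open>g\<close> periodic with
  a smaller period.\<close>

lemma inj_on_period:
  assumes "turning_rule_of r g"
  shows "inj_on g {..<p}"
proof (rule linorder_inj_onI)
  fix i j assume ij: "i < j" "i \<in> {..<p}" "j \<in> {..<p}"
  show "g i \<noteq> g j"
  proof
    assume eq: "g i = g j"
    have fwd: "g (i + k) = g (j + k)" for k
    proof (induction k)
      case (Suc k)
      then show ?case using deterministic[OF assms, of "i + k" "j + k"] by simp
    qed (use eq in simp)
    define q where "q = j - i"
    have q: "g (t + q) = g t" for t
    proof -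
      \<comment> \<open>Adding \<open>i\<close> periods brings every \<open>t\<close> past the index
        \<open>i\<close>, so the eventual period \<open>q\<close> is a period from the
        start.\<close>
      have "t + i * p + q = (t + i * p - i) + j" "t + i * p = (t + i * p - i) + i"
        using ij p_pos by (simp_all add: q_def trans_le_add2)
      then have "g (t + i * p + q) = g (t + i * p)"
        using fwd[of "t + i * p - i"] by (metis add.commute)
      then show ?thesis using g_periodic_mult[of t i] g_periodic_mult[of "t + q" i]
        by (simp add: add_ac)
    qed
    have qm: "g (t + m * q) = g t" for t m
    proof (induction m)
      case (Suc m)
      then show ?case using q[of "t + m * q"] by (simp add: add_ac)
    qed simp
    have "q > 0" using ij by (simp add: q_def)
    have "g t = map g [0..<q] ! (t mod length (map g [0..<q]))" for t
    proof -
      have "g t = g (t mod q)" using qm[of "t mod q" "t div q"] by simp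
      then show ?thesis using \<open>q > 0\<close> by simp
    qed
    then have "is_power (map g [0..<q]) g" using \<open>q > 0\<close> unfolding is_power_def by simp
    then have "p \<le> q" using per_minimal by (fastforce simp: p_def)
    then show False using ij by (simp add: q_def)
  qed
qed auto

end

section \<open>Bounds on widths, periods and codes\<close>

lemma gen_width_le:
  assumes "g \<in> U n"
  shows "gen_width (g t) \<le> 3 * n + 1"
proof -
  interpret repeating_pattern g n
    using assms by unfold_locales (auto simp: U_def pure_glider_def glider_def)
  have bound: "y - x \<le> 3 * int n" if "lab g t x \<noteq> Empty" "lab g t y \<noteq> Empty" for x y
  proof -
    consider r where "positive_speed g" "turning_rule_of r g" "\<not> r ! 1"
      | r where "negative_speed g" "turning_rule_of r g" "\<not> r ! 3"
      using assms by (auto simp: U_def pure_glider_def)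
    then show ?thesis
    proof cases
      case (1 r)
      interpret strand_flow "lab g" "\<lambda>u v. r ! turning_bit u v" p D n by (rule flow_positive[OF 1])
      show ?thesis by (rule width_bound[OF that])
    next
      case (2 r)
      interpret strand_flow "\<lambda>t x. mirror (lab g t (- x - int t))" "\<lambda>u v. r ! turning_bit v u" p "int p - D" n
        by (rule flow_negative[OF 2])
      show ?thesis using width_bound[of t "- y - int t" "- x - int t"] that by simp
    qed
  qed
  have ne: "gen_support (g t) \<noteq> {}" using gen0[of t] by (auto simp: gen_support_def)
  have "j \<le> 3 * int n" if "j \<in> gen_support (g t)" for j
    using bound[of "offset g t" "j + offset g t"] that gen0[of t] by (simp add: lab_def gen_support_def)
  then have "Max (gen_support (g t)) \<le> 3 * int n" using gen_fin[of t] ne by simp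
  then show ?thesis by (simp add: gen_width_def nat_le_iff)
qed

lemma gen_Empty:
  assumes "is_generation n \<delta>" "j < 0 \<or> j \<ge> int (gen_width \<delta>)"
  shows "\<delta> j = Empty"
proof (rule ccontr)
  assume "\<delta> j \<noteq> Empty"
  then have "j \<in> gen_support \<delta>" by (simp add: gen_support_def)
  then have "j \<le> Max (gen_support \<delta>)" using assms(1) by (simp add: is_generation_def)
  then show False
    using assms \<open>\<delta> j \<noteq> Empty\<close> by (auto simp: is_generation_def gen_width_def split: if_splits)
qed

lemma finite_cell: "finite (UNIV :: cell set)" and card_cell: "card (UNIV :: cell set) = 8"
proof -
  have U: "(UNIV :: cell set) = {Empty, SN, NS, SS, RN, NL, ZX, SX}"
    using cell.exhaust by auto
  show "finite (UNIV :: cell set)" unfolding U by simp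
  show "card (UNIV :: cell set) = 8" unfolding U by simp
qed

text \<open>The generations of a period are distinct, and each is a word of \<open>3 * n + 1\<close>
  cells of 8 types.\<close>

lemma length_per_le:
  assumes "g \<in> U n"
  shows "length (per g) \<le> 8 ^ (3 * n + 1)"
proof -
  interpret repeating_pattern g n
    using assms by unfold_locales (auto simp: U_def pure_glider_def glider_def)
  obtain r where r: "turning_rule_of r g" using assms by (auto simp: U_def pure_glider_def)
  let ?L = "{xs :: cell list. set xs \<subseteq> UNIV \<and> length xs = 3 * n + 1}"
  let ?f = "\<lambda>\<delta> :: generation. map (\<lambda>j. \<delta> (int j)) [0..<3 * n + 1]"
  have "inj_on ?f (g ` {..<p})"
  proof (rule inj_onI)
    fix \<delta> \<epsilon> assume mem: "\<delta> \<in> g ` {..<p}" "\<epsilon> \<in> g ` {..<p}" and eq: "?f \<delta> = ?f \<epsilon>"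
    have "g t j = Empty" if "j < 0 \<or> j \<ge> int (3 * n + 1)" for t j
      by (rule gen_Empty[OF gen]) (use that gen_width_le[OF assms, of t] in linarith)
    then have out: "\<delta> j = Empty" "\<epsilon> j = Empty" if "j < 0 \<or> j \<ge> int (3 * n + 1)" for j
      using mem that by auto
    show "\<delta> = \<epsilon>"
    proof
      fix j
      show "\<delta> j = \<epsilon> j"
      proof (cases "j < 0 \<or> j \<ge> int (3 * n + 1)")
        case True
        then show ?thesis using out by simp
      next
        case False
        then have "nat j < 3 * n + 1" "int (nat j) = j" by auto
        then show ?thesis using arg_cong[OF eq, of "\<lambda>xs. xs ! nat j"] by (simp del: upt_Suc)
      qed
    qed
  qed
  then have "card (g ` {..<p}) \<le> card ?L"
    by (rule card_inj_on_le[of ?f]) (use finite_lists_length_eq[OF finite_cell, of "3 * n + 1"] in auto)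
  also have "card ?L = 8 ^ (3 * n + 1)"
    using card_lists_length_eq[OF finite_cell, of "3 * n + 1"] card_cell by simp
  finally show ?thesis using card_image[OF inj_on_period[OF r]] by (simp add: p_def)
qed

lemma prod_encode_mono: "a \<le> a' \<Longrightarrow> b \<le> b' \<Longrightarrow> prod_encode (a, b) \<le> prod_encode (a', b')"
  by (simp add: prod_encode_def triangle_def add_mono div_le_mono mult_le_mono)

text \<open>The code of the list of \<open>l\<close> entries \<open>m\<close>, hence the largest
  code of a list with at most \<open>l\<close> entries, all at most \<open>m\<close>.\<close>

fun list_bound :: "nat \<Rightarrow> nat \<Rightarrow> nat" where
  "list_bound 0 m = 0"
| "list_bound (Suc l) m = Suc (prod_encode (m, list_bound l m))"

lemma list_encode_bound:
  assumes "length xs \<le> l" "\<And>x. x \<in> set xs \<Longrightarrow> x \<le> m"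
  shows "list_encode xs \<le> list_bound l m"
  using assms
proof (induction xs arbitrary: l)
  case (Cons x xs)
  then obtain l' where l: "l = Suc l'" by (cases l) auto
  then have "list_encode xs \<le> list_bound l' m" using Cons by auto
  then show ?case using Cons.prems l by (auto intro: prod_encode_mono)
qed simp

definition per_code :: "pattern \<Rightarrow> nat" where
  "per_code g = list_encode (map gen_code (per g))"

definition per_code_bound :: "nat \<Rightarrow> nat" where
  "per_code_bound n = list_bound (8 ^ (3 * n + 1)) (list_bound (3 * n + 1) 7)"

lemma per_code_le:
  assumes "g \<in> U n"
  shows "per_code g \<le> per_code_bound n"
  unfolding per_code_def per_code_bound_def
proof (rule list_encode_bound)
  interpret repeating_pattern g n
    using assms by unfold_locales (auto simp: U_def pure_glider_def glider_def)
  show "length (map gen_code (per g)) \<le> 8 ^ (3 * n + 1)" using length_per_le[OF assms] by simp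
  fix x assume "x \<in> set (map gen_code (per g))"
  then obtain t where t: "x = gen_code (g t)"
    using g_nth by (auto simp: in_set_conv_nth p_def) (metis mod_less)
  have "cell_code C \<le> 7" for C by (cases C) auto
  then show "x \<le> list_bound (3 * n + 1) 7"
    unfolding t gen_code_def using gen_width_le[OF assms, of t]
    by (intro list_encode_bound) (auto simp: gen_string_def)
qed

lemma inj_on_per_code: "inj_on per_code (U n)"
proof (rule inj_onI)
  fix g h assume gh: "g \<in> U n" "h \<in> U n" and eq: "per_code g = per_code h"
  have pw: "is_power (per g) g \<and> (\<forall>\<delta>\<in>set (per g). is_generation n \<delta>)" if "g \<in> U n" for g
  proof -
    interpret repeating_pattern g n
      using that by unfold_locales (auto simp: U_def pure_glider_def glider_def)
    have "is_generation n \<delta>" if "\<delta> \<in> set (per g)" for \<delta>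
    proof -
      obtain i where "i < p" "\<delta> = per g ! i" using \<open>\<delta> \<in> set (per g)\<close> by (auto simp: in_set_conv_nth p_def)
      then have "\<delta> = g i" by (simp add: g_nth)
      then show ?thesis using gen by simp
    qed
    then show ?thesis using power by blast
  qed
  have "inj_on gen_code (set (per g) \<union> set (per h))"
    by (rule inj_on_subset[OF inj_gen_code]) (use pw gh in blast)
  moreover have "map gen_code (per g) = map gen_code (per h)"
    using eq by (simp add: per_code_def list_encode_eq)
  ultimately have per: "per g = per h" by (rule map_inj_on[rotated])
  show "g = h"
  proof
    fix t
    have "g t = per g ! (t mod length (per g))" "h t = per h ! (t mod length (per h))"
      using pw gh unfolding is_power_def by blast+
    then show "g t = h t" using per by simp
  qed
qed

lemma finite_U: "finite (U n)"
proof (rule finite_imageD[OF _ inj_on_per_code])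
  show "finite (per_code ` U n)"
    by (rule finite_subset[of _ "{..per_code_bound n}"]) (auto intro: per_code_le)
qed

lemma finite_V: "finite (V n)"
  by (simp add: V_def finite_U)

section \<open>Computable functions on encoded types\<close>

text \<open>Numbering by type makes computability of HOL terms a syntax-directed matter. Injectivity
  suffices, as programs are only run on codes of actual values.\<close>

class enc =
  fixes enc :: "'a \<Rightarrow> nat"
  assumes inj_enc: "inj enc"

lemma enc_eq_iff [simp]: "enc x = enc y \<longleftrightarrow> x = y"
  using inj_enc by (auto dest: injD)

instantiation nat :: enc
begin
definition enc_nat :: "nat \<Rightarrow> nat" where "enc_nat n = n"
instance by standard (simp add: enc_nat_def inj_def)
end

instantiation bool :: enc
begin
definition enc_bool :: "bool \<Rightarrow> nat" where "enc_bool b = of_bool b"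
instance by standard (auto simp add: enc_bool_def inj_def)
end

instantiation prod :: (enc, enc) enc
begin
definition enc_prod :: "'a \<times> 'b \<Rightarrow> nat" where "enc_prod q = prod_encode (enc (fst q), enc (snd q))"
instance by standard (auto simp add: enc_prod_def inj_def)
end

instantiation int :: enc
begin
text \<open>Positive and negative part, so that \<open>nat i\<close> and \<open>nat (- i)\<close>
  are projections of the code.\<close>

definition enc_int :: "int \<Rightarrow> nat" where "enc_int i = prod_encode (nat i, nat (- i))"
instance by standard (auto simp add: enc_int_def inj_def)
end

instantiation cell :: enc
begin
definition enc_cell :: "cell \<Rightarrow> nat" where "enc_cell = cell_code"
instance by standard (simp add: enc_cell_def inj_cell_code)
end

lemma enc_Pair: "enc (a, b) = prod_encode (enc a, enc b)"
  by (simp add: enc_prod_def)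

instance cell :: finite
proof
  have "(UNIV :: cell set) = {Empty, SN, NS, SS, RN, NL, ZX, SX}"
    using cell.exhaust by auto
  then show "finite (UNIV :: cell set)" by (metis finite.simps)
qed

text \<open>Several arguments and all free parameters are packed into one value \<open>e\<close>, so
  the closure lemmas have the form \<open>computable (\<lambda>e. ...)\<close>.\<close>

definition computable :: "('a::enc \<Rightarrow> 'b::enc) \<Rightarrow> bool" where
  "computable f \<longleftrightarrow> (\<exists>r. \<forall>x. run r [enc x] = Some (enc (f x)))"

lemma run_Comp:
  assumes "map (\<lambda>h. run h xs) gs = map Some ys"
  shows "run (Comp f gs) xs = run f ys"
proof -
  have "None \<notin> set (map (\<lambda>h. run h xs) gs)" unfolding assms by auto
  moreover have "map the (map (\<lambda>h. run h xs) gs) = ys" unfolding assms by (simp add: comp_def)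
  ultimately show ?thesis by (simp add: comp_def Let_def)
qed

lemma run_Mu:
  assumes "\<And>w. run f (w # xs) = Some (F w)" "F m = 0"
  shows "run (Mu f) xs = Some (LEAST w. F w = 0)"
  using assms by auto

declare run.simps(4) [simp del]

section \<open>Programs for arithmetic and pairing\<close>

definition "rf_add = PrimRec (Proj 0) (Comp Succ [Proj 1])"
definition "rf_triangle = PrimRec Zero (Comp rf_add [Comp Succ [Proj 0], Proj 1])"
definition "rf_pair = Comp rf_add [Comp rf_triangle [rf_add], Proj 0]"
definition "rf_pred = PrimRec Zero (Proj 0)"
text \<open>The subtrahend comes first because the recursion runs over the first argument.\<close>

definition "rf_diff = PrimRec (Proj 0) (Comp rf_pred [Proj 1])"
text \<open>\<open>prod_encode (m, k)\<close> lies between the triangular numbers of index \<open>m + k\<close> and \<open>m + k + 1\<close>.\<close>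

definition "rf_level = Mu (Comp rf_diff [Comp rf_triangle [Comp Succ [Proj 0]], Comp Succ [Proj 1]])"
definition "rf_fst = Comp rf_diff [Comp rf_triangle [rf_level], Proj 0]"
definition "rf_snd = Comp rf_diff [rf_fst, rf_level]"
definition "rf_not = PrimRec (Comp Succ [Zero]) Zero"
text \<open>A recursion of length 0 or 1 as a case distinction: the base returns the second branch,
  the step the first.\<close>

definition "rf_if = PrimRec (Proj 1) (Proj 2)"

lemma rf_add: "run rf_add [m, y] = Some (m + y)"
  unfolding rf_add_def
proof (induction m)
  case (Suc m)
  then show ?case by (simp add: run_Comp[where ys = "[m + y]"])
qed simp

lemma rf_triangle: "run rf_triangle [m] = Some (triangle m)"
  unfolding rf_triangle_def
proof (induction m)
  case (Suc m)
  have "run (Comp rf_add [Comp Succ [Proj 0], Proj 1]) [m, triangle m] = Some (Suc m + triangle m)"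
    by (subst run_Comp[where ys = "[Suc m, triangle m]"]) (simp_all add: run_Comp[where ys = "[m]"] rf_add)
  then show ?case using Suc by (simp add: add.commute)
qed simp

lemma rf_pair: "run rf_pair [m, k] = Some (prod_encode (m, k))"
  unfolding rf_pair_def
  by (subst run_Comp[where ys = "[triangle (m + k), m]"])
    (simp_all add: run_Comp[where ys = "[m + k]"] rf_add rf_triangle prod_encode_def)

lemma rf_pred: "run rf_pred [m] = Some (m - 1)"
  unfolding rf_pred_def by (induction m) simp_all

lemma rf_diff: "run rf_diff [m, y] = Some (y - m)"
  unfolding rf_diff_def
proof (induction m)
  case (Suc m)
  then show ?case by (simp add: run_Comp[where ys = "[y - m]"] rf_pred)
qed simp

lemma rf_level: "run rf_level [prod_encode (m, k)] = Some (m + k)"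
proof -
  let ?z = "prod_encode (m, k)"
  have step: "run (Comp rf_diff [Comp rf_triangle [Comp Succ [Proj 0]], Comp Succ [Proj 1]]) [w, ?z] =
      Some (Suc ?z - triangle (Suc w))" for w
    by (subst run_Comp[where ys = "[triangle (Suc w), Suc ?z]"])
      (simp_all add: run_Comp[where ys = "[Suc w]"] run_Comp[where ys = "[w]"] run_Comp[where ys = "[?z]"]
        rf_diff rf_triangle)
  have mono: "triangle a \<le> triangle b" if "a \<le> b" for a b
    using that by (induction rule: dec_induct) simp_all
  \<comment> \<open>The truncated difference vanishes iff the code lies below the triangular number
    of index \<open>w + 1\<close>.\<close>
  have iff: "Suc ?z - triangle (Suc w) = 0 \<longleftrightarrow> m + k \<le> w" for w
  proof
    assume "m + k \<le> w"
    then show "Suc ?z - triangle (Suc w) = 0"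
      using mono[of "m + k" w] by (simp add: prod_encode_def)
  next
    assume *: "Suc ?z - triangle (Suc w) = 0"
    show "m + k \<le> w"
    proof (rule ccontr)
      assume "\<not> m + k \<le> w"
      then show False using mono[of "Suc w" "m + k"] * by (simp add: prod_encode_def)
    qed
  qed
  have "(LEAST w. m + k \<le> w) = m + k" by (rule Least_equality) auto
  then show ?thesis
    unfolding rf_level_def using run_Mu[OF step, of "m + k"] by (simp only: iff order_refl)
qed

lemma rf_fst: "run rf_fst [prod_encode (m, k)] = Some m"
  unfolding rf_fst_def
  by (subst run_Comp[where ys = "[triangle (m + k), prod_encode (m, k)]"])
    (simp_all add: run_Comp[where ys = "[m + k]"] rf_level rf_triangle rf_diff, simp add: prod_encode_def)

lemma rf_snd: "run rf_snd [prod_encode (m, k)] = Some k"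
  unfolding rf_snd_def
  by (subst run_Comp[where ys = "[m, m + k]"]) (simp_all add: rf_level rf_fst rf_diff)

lemma rf_not: "run rf_not [of_bool b] = Some (of_bool (\<not> b))"
  by (cases b) (simp_all add: rf_not_def run_Comp[where ys = "[0]"])

lemma rf_not_nat: "run rf_not [k] = Some (of_bool (k = 0))"
  unfolding rf_not_def by (induction k) (simp_all add: run_Comp[where ys = "[0]"])

lemma rf_if: "run rf_if [of_bool b, x, y] = Some (if b then x else y)"
  by (cases b) (simp_all add: rf_if_def numeral_2_eq_2)

section \<open>Closure properties of computable functions\<close>

lemma computable_id: "computable (\<lambda>e. e)"
  unfolding computable_def by (rule exI[of _ "Proj 0"]) simp

lemma computable_const: "computable (\<lambda>_. c)"
proof -
  have "\<exists>r. \<forall>x. run r [x] = Some m" for m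
  proof (induction m)
    case 0
    show ?case by (rule exI[of _ Zero]) simp
  next
    case (Suc m)
    then obtain r where "\<forall>x. run r [x] = Some m" by blast
    then show ?case by (intro exI[of _ "Comp Succ [r]"]) (simp add: run_Comp[where ys = "[m]"])
  qed
  then show ?thesis unfolding computable_def by blast
qed

lemma computable_comp:
  assumes "computable f" "computable g"
  shows "computable (\<lambda>e. f (g e))"
proof -
  obtain r s where "\<forall>x. run r [enc x] = Some (enc (f x))" "\<forall>x. run s [enc x] = Some (enc (g x))"
    using assms unfolding computable_def by blast
  then show ?thesis
    unfolding computable_def by (intro exI[of _ "Comp r [s]"]) (simp add: run_Comp[where ys = "[enc (g _)]"])
qed

lemma computable_lift1:
  assumes "\<And>x. run q [enc x] = Some (enc (F x))" "computable A"
  shows "computable (\<lambda>e. F (A e))"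
  by (rule computable_comp[OF _ assms(2)]) (use assms(1) in \<open>auto simp: computable_def\<close>)

lemma computable_lift2:
  assumes "\<And>x y. run q [enc x, enc y] = Some (enc (F x y))" "computable A" "computable B"
  shows "computable (\<lambda>e. F (A e) (B e))"
proof -
  obtain r s where "\<forall>x. run r [enc x] = Some (enc (A x))" "\<forall>x. run s [enc x] = Some (enc (B x))"
    using assms unfolding computable_def by blast
  then have "run (Comp q [r, s]) [enc x] = Some (enc (F (A x) (B x)))" for x
    by (simp add: run_Comp[where ys = "[enc (A x), enc (B x)]"] assms(1))
  then show ?thesis unfolding computable_def by blast
qed

lemma computable_Pair: "computable A \<Longrightarrow> computable B \<Longrightarrow> computable (\<lambda>e. (A e, B e))"
  by (rule computable_lift2[of rf_pair]) (simp add: rf_pair enc_Pair)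

lemma computable_fst: "computable A \<Longrightarrow> computable (\<lambda>e. fst (A e))"
  by (rule computable_lift1[of rf_fst]) (simp add: rf_fst enc_prod_def)

lemma computable_snd: "computable A \<Longrightarrow> computable (\<lambda>e. snd (A e))"
  by (rule computable_lift1[of rf_snd]) (simp add: rf_snd enc_prod_def)

lemma computable_app2:
  assumes "computable (\<lambda>q. F (fst q) (snd q))" "computable A" "computable B"
  shows "computable (\<lambda>e. F (A e) (B e))"
  using computable_comp[OF assms(1) computable_Pair[OF assms(2,3)]] by simp

lemma computable_app3:
  assumes "computable (\<lambda>q. F (fst q) (fst (snd q)) (snd (snd q)))" "computable A" "computable B" "computable C"
  shows "computable (\<lambda>e. F (A e) (B e) (C e))"
  using computable_comp[OF assms(1) computable_Pair[OF assms(2) computable_Pair[OF assms(3,4)]]] by simp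

lemma computable_Suc: "computable A \<Longrightarrow> computable (\<lambda>e. Suc (A e))"
  by (rule computable_lift1[of Succ]) (simp add: enc_nat_def)

lemma computable_add: "computable A \<Longrightarrow> computable B \<Longrightarrow> computable (\<lambda>e. A e + B e :: nat)"
  by (rule computable_lift2[of rf_add]) (simp add: rf_add enc_nat_def)

lemma computable_diff:
  assumes "computable A" "computable B"
  shows "computable (\<lambda>e. A e - B e :: nat)"
  by (rule computable_lift2[of rf_diff "\<lambda>b a. a - b", OF _ assms(2,1)]) (simp add: rf_diff enc_nat_def)

lemma computable_not: "computable A \<Longrightarrow> computable (\<lambda>e. \<not> A e)"
  by (rule computable_lift1[of rf_not]) (simp only: rf_not enc_bool_def)

lemma computable_if:
  assumes "computable P" "computable A" "computable B"
  shows "computable (\<lambda>e. if P e then A e else B e)"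
proof -
  obtain p r s where "\<forall>x. run p [enc x] = Some (of_bool (P x))"
      "\<forall>x. run r [enc x] = Some (enc (A x))" "\<forall>x. run s [enc x] = Some (enc (B x))"
    using assms unfolding computable_def enc_bool_def by blast
  then have "run (Comp rf_if [p, r, s]) [enc x] = Some (enc (if P x then A x else B x))" for x
    by (subst run_Comp[where ys = "[of_bool (P x), enc (A x), enc (B x)]"]) (simp_all add: rf_if)
  then show ?thesis unfolding computable_def by blast
qed

lemma computable_conj: "computable P \<Longrightarrow> computable Q \<Longrightarrow> computable (\<lambda>e. P e \<and> Q e)"
proof -
  assume "computable P" "computable Q"
  then have "computable (\<lambda>e. if P e then Q e else False)" by (intro computable_if computable_const)
  moreover have "(\<lambda>e. if P e then Q e else False) = (\<lambda>e. P e \<and> Q e)" by auto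
  ultimately show ?thesis by (simp only:)
qed

lemma computable_disj: "computable P \<Longrightarrow> computable Q \<Longrightarrow> computable (\<lambda>e. P e \<or> Q e)"
proof -
  assume "computable P" "computable Q"
  then have "computable (\<lambda>e. \<not> (\<not> P e \<and> \<not> Q e))" by (intro computable_not computable_conj)
  then show ?thesis by simp
qed

lemma computable_imp: "computable P \<Longrightarrow> computable Q \<Longrightarrow> computable (\<lambda>e. P e \<longrightarrow> Q e)"
  unfolding imp_conv_disj by (intro computable_disj computable_not)

text \<open>The parameter \<open>e\<close> travels as the last argument of \<open>PrimRec\<close>;
  the step program repacks counter, value and parameter into the triple that \<open>s\<close>
  expects.\<close>

lemma computable_rec:
  assumes "computable z" "computable (\<lambda>q. s (fst q) (fst (snd q)) (snd (snd q)))" "computable N"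
  shows "computable (\<lambda>e. rec_nat (z e) (\<lambda>m r. s e m r) (N e))"
proof -
  obtain rz rs rN where z: "\<And>x. run rz [enc x] = Some (enc (z x))"
      and s: "\<And>q. run rs [enc q] = Some (enc (s (fst q) (fst (snd q)) (snd (snd q))))"
      and N: "\<And>x. run rN [enc x] = Some (enc (N x))"
    using assms unfolding computable_def by blast
  define rstep where "rstep = Comp rs [Comp rf_pair [Proj 2, Comp rf_pair [Proj 0, Proj 1]]]"
  have step: "run rstep [m, enc v, enc x] = Some (enc (s x m v))" for m v x
  proof -
    have "run (Comp rf_pair [Proj 0, Proj 1]) [m, enc v, enc x] = Some (enc (m, v))"
      by (subst run_Comp[where ys = "[m, enc v]"]) (simp_all add: rf_pair enc_Pair enc_nat_def)
    then have "run (Comp rf_pair [Proj 2, Comp rf_pair [Proj 0, Proj 1]]) [m, enc v, enc x] = Some (enc (x, m, v))"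
      by (subst run_Comp[where ys = "[enc x, enc (m, v)]"]) (simp_all add: rf_pair enc_Pair)
    then show ?thesis
      unfolding rstep_def using s[of "(x, m, v)"] by (subst run_Comp[where ys = "[enc (x, m, v)]"]) simp_all
  qed
  have rec: "run (PrimRec rz rstep) [m, enc x] = Some (enc (rec_nat (z x) (\<lambda>m r. s x m r) m))" for m x
    by (induction m) (simp_all add: z step)
  have "run (Comp (PrimRec rz rstep) [rN, Proj 0]) [enc x] = Some (enc (rec_nat (z x) (\<lambda>m r. s x m r) (N x)))" for x
    by (subst run_Comp[where ys = "[N x, enc x]"]) (simp_all add: N rec enc_nat_def del: run.simps(5))
  then show ?thesis unfolding computable_def by blast
qed

text \<open>\<open>Mu\<close> looks for a zero, hence the negated test; the second hypothesis is
  termination.\<close>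

lemma computable_Least:
  fixes P :: "'a :: enc \<Rightarrow> nat \<Rightarrow> bool"
  assumes "computable (\<lambda>q. P (fst q) (snd q))" "\<And>e. \<exists>m. P e m"
  shows "computable (\<lambda>e. LEAST m. P e m)"
proof -
  obtain r where r: "\<And>q. run r [enc q] = Some (of_bool (P (fst q) (snd q)))"
    using assms(1) unfolding computable_def enc_bool_def by blast
  define f where "f = Comp rf_not [Comp r [Comp rf_pair [Proj 1, Proj 0]]]"
  have f: "run f [m, enc x] = Some (of_bool (\<not> P x m))" for m x
  proof -
    have "run (Comp rf_pair [Proj 1, Proj 0]) [m, enc x] = Some (enc (x, m))"
      by (subst run_Comp[where ys = "[enc x, m]"]) (simp_all add: rf_pair enc_Pair enc_nat_def)
    then have "run (Comp r [Comp rf_pair [Proj 1, Proj 0]]) [m, enc x] = Some (of_bool (P x m))"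
      using r[of "(x, m)"] by (subst run_Comp[where ys = "[enc (x, m)]"]) simp_all
    then show ?thesis
      unfolding f_def by (subst run_Comp[where ys = "[of_bool (P x m)]"]) (simp_all only: rf_not list.map)
  qed
  have "run (Mu f) [enc x] = Some (enc (LEAST m. P x m))" for x
  proof -
    obtain m where "P x m" using assms(2) by blast
    then show ?thesis using run_Mu[where f = f and xs = "[enc x]" and F = "\<lambda>m. of_bool (\<not> P x m)" and m = m] f
      by (simp add: enc_nat_def)
  qed
  then show ?thesis unfolding computable_def by blast
qed

lemma computable_le:
  assumes "computable A" "computable B"
  shows "computable (\<lambda>e. A e \<le> (B e :: nat))"
proof -
  have "computable (\<lambda>k :: nat. k = 0)"
    unfolding computable_def
    by (rule exI[of _ rf_not]) (simp add: rf_not_nat enc_nat_def enc_bool_def)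
  from computable_comp[OF this computable_diff[OF assms]] show ?thesis by simp
qed

lemma computable_less: "computable A \<Longrightarrow> computable B \<Longrightarrow> computable (\<lambda>e. A e < (B e :: nat))"
  unfolding less_eq_Suc_le by (intro computable_le computable_Suc)

lemma computable_enc: "computable A \<Longrightarrow> computable (\<lambda>e. enc (A e))"
  by (rule computable_lift1[of "Proj 0"]) (simp add: enc_nat_def)

lemma computable_eq:
  assumes "computable A" "computable B"
  shows "computable (\<lambda>e. A e = B e)"
proof -
  have "computable (\<lambda>e. enc (A e) \<le> enc (B e) \<and> enc (B e) \<le> enc (A e))"
    by (intro computable_conj computable_le computable_enc assms)
  then show ?thesis by (simp add: order_antisym_conv flip: order.eq_iff)
qed

text \<open>The bound makes the search total; without a solution below it the value is
  \<open>N e\<close>.\<close>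

lemma computable_bounded_Least:
  fixes P :: "'a :: enc \<Rightarrow> nat \<Rightarrow> bool"
  assumes "computable (\<lambda>q. P (fst q) (snd q))" "computable N"
  shows "computable (\<lambda>e. LEAST m. P e m \<or> N e \<le> m)"
proof (rule computable_Least)
  show "computable (\<lambda>q. P (fst q) (snd q) \<or> N (fst q) \<le> snd q)"
    by (intro computable_disj assms(1) computable_le computable_comp[OF assms(2)] computable_fst computable_snd computable_id)
qed auto

lemma computable_mult: "computable A \<Longrightarrow> computable B \<Longrightarrow> computable (\<lambda>e. A e * B e :: nat)"
proof (rule computable_app2[of "\<lambda>a b. a * b"])
  have "computable (\<lambda>q :: nat \<times> nat. rec_nat 0 (\<lambda>m r. r + snd q) (fst q))"
    by (intro computable_rec computable_const computable_add computable_fst computable_snd computable_id)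
  moreover have "rec_nat 0 (\<lambda>m r. r + b) a = a * b" for a b :: nat
    by (induction a) auto
  ultimately show "computable (\<lambda>q :: nat \<times> nat. fst q * snd q)" by simp
qed

lemma computable_power:
  assumes "computable A" "computable B"
  shows "computable (\<lambda>e. (A e :: nat) ^ B e)"
proof (rule computable_app2[of "\<lambda>a b. a ^ b", OF _ assms])
  have "computable (\<lambda>q :: nat \<times> nat. rec_nat 1 (\<lambda>m r. fst q * r) (snd q))"
    by (intro computable_rec computable_const computable_mult computable_fst computable_snd computable_id)
  moreover have "rec_nat 1 (\<lambda>m r. a * r) b = a ^ b" for a b :: nat
    by (induction b) auto
  ultimately show "computable (\<lambda>q :: nat \<times> nat. fst q ^ snd q)" by simp
qed

lemma computable_ball:
  fixes P :: "'a :: enc \<Rightarrow> nat \<Rightarrow> bool"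
  assumes "computable (\<lambda>q. P (fst q) (snd q))" "computable N"
  shows "computable (\<lambda>e. \<forall>m<N e. P e m)"
proof -
  have "computable (\<lambda>e. rec_nat True (\<lambda>m r. r \<and> P e m) (N e))"
    by (intro computable_rec computable_const computable_conj computable_app2[OF assms(1)] assms(2)
        computable_fst computable_snd computable_id)
  moreover have "rec_nat True (\<lambda>m r. r \<and> P e m) k \<longleftrightarrow> (\<forall>m<k. P e m)" for e k
    by (induction k) (auto simp: less_Suc_eq)
  ultimately show ?thesis by simp
qed

lemma computable_bex:
  fixes P :: "'a :: enc \<Rightarrow> nat \<Rightarrow> bool"
  assumes "computable (\<lambda>q. P (fst q) (snd q))" "computable N"
  shows "computable (\<lambda>e. \<exists>m<N e. P e m)"
proof -
  have "computable (\<lambda>e. \<not> (\<forall>m<N e. \<not> P e m))"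
    by (intro computable_not computable_ball assms)
  then show ?thesis by simp
qed

lemma computable_sum:
  fixes f :: "'a :: enc \<Rightarrow> nat \<Rightarrow> nat"
  assumes "computable (\<lambda>q. f (fst q) (snd q))" "computable N"
  shows "computable (\<lambda>e. \<Sum>m<N e. f e m)"
proof -
  have "computable (\<lambda>e. rec_nat 0 (\<lambda>m r. r + f e m) (N e))"
    by (intro computable_rec computable_const computable_add computable_app2[OF assms(1)] assms(2)
        computable_fst computable_snd computable_id)
  moreover have "rec_nat 0 (\<lambda>m r. r + f e m) k = (\<Sum>m<k. f e m)" for e k
    by (induction k) auto
  ultimately show ?thesis by simp
qed

text \<open>Division as a search; the disjunct \<open>b = 0\<close> keeps the condition solvable for
  all inputs.\<close>

lemma div_nat_Least: "a div b = (if b = 0 then 0 else LEAST q. b = 0 \<or> a < Suc q * b)" for a b :: nat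
proof (cases "b = 0")
  case False
  have "(LEAST q. b = 0 \<or> a < Suc q * b) = a div b"
  proof (rule Least_equality)
    show "b = 0 \<or> a < Suc (a div b) * b"
      using False by (metis dividend_less_div_times mult_Suc gr0I add.commute mult.commute)
    show "a div b \<le> q" if "b = 0 \<or> a < Suc q * b" for q
      using that False by (metis less_Suc_eq_le less_mult_imp_div_less)
  qed
  then show ?thesis using False by simp
qed simp

lemma computable_div: "computable A \<Longrightarrow> computable B \<Longrightarrow> computable (\<lambda>e. (A e :: nat) div B e)"
proof (rule computable_app2[of "\<lambda>a b. a div b"])
  have "\<exists>q. b = 0 \<or> a < Suc q * b" for a b :: nat
    by (cases b) (auto intro!: exI[of _ a])
  then show "computable (\<lambda>q :: nat \<times> nat. fst q div snd q)"
    unfolding div_nat_Least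
    by (intro computable_if computable_Least computable_disj computable_eq computable_less computable_mult
        computable_Suc computable_const computable_fst computable_snd computable_id)
qed

lemma computable_mod: "computable A \<Longrightarrow> computable B \<Longrightarrow> computable (\<lambda>e. (A e :: nat) mod B e)"
  unfolding minus_div_mult_eq_mod[symmetric]
  by (intro computable_diff computable_mult computable_div)

lemma computable_even: "computable A \<Longrightarrow> computable (\<lambda>e. even (A e :: nat))"
  unfolding even_iff_mod_2_eq_zero by (intro computable_eq computable_mod computable_const)

lemma computable_int_diff: "computable A \<Longrightarrow> computable B \<Longrightarrow> computable (\<lambda>e. int (A e) - int (B e))"
proof (rule computable_app2[of "\<lambda>a b. int a - int b"])
  have "computable (\<lambda>q :: nat \<times> nat. (fst q - snd q, snd q - fst q))"
    by (intro computable_Pair computable_diff computable_fst computable_snd computable_id)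
  moreover have "enc (int a - int b) = enc (a - b, b - a)" for a b
    by (simp add: enc_Pair enc_int_def enc_nat_def nat_minus_as_int)
  ultimately show "computable (\<lambda>q. int (fst q) - int (snd q))" by (simp add: computable_def)
qed

lemma computable_nat: "computable A \<Longrightarrow> computable (\<lambda>e. nat (A e))"
  by (rule computable_lift1[of rf_fst]) (simp add: rf_fst enc_int_def enc_nat_def)

lemma computable_nat_uminus: "computable A \<Longrightarrow> computable (\<lambda>e. nat (- A e))"
  by (rule computable_lift1[of rf_snd]) (simp add: rf_snd enc_int_def enc_nat_def)

lemma computable_int: "computable A \<Longrightarrow> computable (\<lambda>e. int (A e))"
  using computable_int_diff[OF _ computable_const, of A 0] by (simp only: of_nat_0 diff_0_right)

lemma computable_int_add:
  assumes "computable A" "computable B"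
  shows "computable (\<lambda>e. A e + B e :: int)"
proof -
  have "computable (\<lambda>e. int (nat (A e) + nat (B e)) - int (nat (- A e) + nat (- B e)))"
    by (intro computable_int_diff computable_add computable_nat computable_nat_uminus assms)
  moreover have "int (nat a + nat b) - int (nat (- a) + nat (- b)) = a + b" for a b by simp
  ultimately show ?thesis by (simp only:)
qed

lemma computable_int_minus:
  assumes "computable A" "computable B"
  shows "computable (\<lambda>e. A e - B e :: int)"
proof -
  have "computable (\<lambda>e. int (nat (A e) + nat (- B e)) - int (nat (- A e) + nat (B e)))"
    by (intro computable_int_diff computable_add computable_nat computable_nat_uminus assms)
  moreover have "int (nat a + nat (- b)) - int (nat (- a) + nat b) = a - b" for a b by simp
  ultimately show ?thesis by (simp only:)
qed

lemma computable_int_le: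
  assumes "computable A" "computable B"
  shows "computable (\<lambda>e. A e \<le> (B e :: int))"
proof -
  have "computable (\<lambda>e. nat (A e - B e) = 0)"
    by (intro computable_eq computable_nat computable_int_minus computable_const assms)
  moreover have "nat (a - b) = 0 \<longleftrightarrow> a \<le> b" for a b by simp
  ultimately show ?thesis by (simp only:)
qed

lemma computable_int_less:
  assumes "computable A" "computable B"
  shows "computable (\<lambda>e. A e < (B e :: int))"
  unfolding not_le[symmetric] by (intro computable_not computable_int_le assms)

text \<open>A lookup table of nested conditionals. It covers every function of cells, in particular
  all the local conditions checked later.\<close>

lemma computable_finite:
  fixes f :: "'a :: {enc, finite} \<Rightarrow> 'b :: enc"
  shows "computable f"
proof -
  have "computable (\<lambda>x. if x \<in> S then f x else undefined)" if "finite S" for S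
    using that
  proof induction
    case (insert a S)
    have "computable (\<lambda>x. if x = a then f a else if x \<in> S then f x else undefined)"
      by (intro computable_if computable_eq computable_id computable_const insert.IH)
    moreover have "(\<lambda>x. if x = a then f a else if x \<in> S then f x else undefined) =
        (\<lambda>x. if x \<in> insert a S then f x else undefined)" by auto
    ultimately show ?case by (simp only:)
  qed (simp add: computable_const)
  from this[of UNIV] show ?thesis by simp
qed

lemma computable_cell1:
  fixes f :: "cell \<Rightarrow> 'b :: enc"
  shows "computable A \<Longrightarrow> computable (\<lambda>e. f (A e))"
  by (rule computable_comp[OF computable_finite])

lemma computable_cell3:
  fixes f :: "cell \<Rightarrow> cell \<Rightarrow> cell \<Rightarrow> 'b :: enc"
  shows "computable A \<Longrightarrow> computable B \<Longrightarrow> computable C \<Longrightarrow> computable (\<lambda>e. f (A e) (B e) (C e))"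
  by (rule computable_app3[OF computable_finite])

lemma computable_finite_sum:
  assumes "finite S" "\<And>a. a \<in> S \<Longrightarrow> computable (\<lambda>e. f a e)"
  shows "computable (\<lambda>e. \<Sum>a\<in>S. f a e :: nat)"
  using assms by (induction rule: finite_induct) (auto intro: computable_const computable_add)

lemma computable_finite_bex:
  assumes "finite S" "\<And>a. a \<in> S \<Longrightarrow> computable (\<lambda>e. P a e)"
  shows "computable (\<lambda>e. \<exists>a\<in>S. P a e)"
  using assms by (induction rule: finite_induct) (auto intro: computable_const computable_disj)

lemma computable_prod_decode: "computable A \<Longrightarrow> computable (\<lambda>e. prod_decode (A e))"
  by (rule computable_lift1[of "Proj 0"]) (simp add: enc_nat_def enc_prod_def)

lemma computable_prod_encode: "computable A \<Longrightarrow> computable B \<Longrightarrow> computable (\<lambda>e. prod_encode (A e, B e))"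
  by (rule computable_lift2[of rf_pair]) (simp add: rf_pair enc_nat_def)

section \<open>Recognising codes of gliders\<close>

text \<open>The code of a nonempty list is the successor of a pair, hence \<open>z - 1\<close>. At
  0, the code of the empty list, head and tail are 0, so reading past the end gives 0, which is also
  the code of \<open>Empty\<close>.\<close>

definition hd_code :: "nat \<Rightarrow> nat" where "hd_code z = fst (prod_decode (z - 1))"
definition tl_code :: "nat \<Rightarrow> nat" where "tl_code z = snd (prod_decode (z - 1))"
definition nth_code :: "nat \<Rightarrow> nat \<Rightarrow> nat" where "nth_code z i = hd_code ((tl_code ^^ i) z)"
definition len_code :: "nat \<Rightarrow> nat" where "len_code z = (LEAST k. (tl_code ^^ k) z = 0)"

lemma tl_code_funpow: "(tl_code ^^ k) (list_encode xs) = list_encode (drop k xs)"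
proof (induction k arbitrary: xs)
  case (Suc k)
  have "prod_decode 0 = (0, 0)" using prod_encode_inverse[of "(0, 0)"] by (simp add: prod_encode_def)
  then have "tl_code (list_encode xs) = list_encode (tl xs)"
    by (cases xs) (simp_all add: tl_code_def)
  then show ?case by (simp add: funpow_swap1 Suc drop_Suc del: funpow.simps add: funpow_Suc_right)
qed simp

lemma list_encode_0_iff: "list_encode xs = 0 \<longleftrightarrow> xs = []"
  by (cases xs) auto

lemma len_code [simp]: "len_code (list_encode xs) = length xs"
  unfolding len_code_def tl_code_funpow list_encode_0_iff by (rule Least_equality) auto

lemma nth_code [simp]: "nth_code (list_encode xs) i = (if i < length xs then xs ! i else 0)"
proof -
  have "prod_decode 0 = (0, 0)" using prod_encode_inverse[of "(0, 0)"] by (simp add: prod_encode_def)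
  then have "hd_code (list_encode ys) = (if ys = [] then 0 else hd ys)" for ys
    by (cases ys) (simp_all add: hd_code_def)
  then show ?thesis by (simp add: nth_code_def tl_code_funpow hd_drop_conv_nth)
qed

lemma list_encode_cases: obtains xs where "z = list_encode xs"
  using list_decode_inverse[of z] by metis

fun cell_of :: "nat \<Rightarrow> cell" where
  "cell_of m = (if m = 1 then SN else if m = 2 then NS else if m = 3 then SS else if m = 4 then RN
     else if m = 5 then NL else if m = 6 then ZX else if m = 7 then SX else Empty)"

declare cell_of.simps [simp del]

lemma cell_of_code [simp]: "cell_of (cell_code C) = C"
  by (cases C) (simp_all add: cell_of.simps)

lemma cell_code_of: "m < 8 \<Longrightarrow> cell_code (cell_of m) = m"
  by (auto simp: cell_of.simps numeral_eq_Suc less_Suc_eq)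

lemma cell_of_0 [simp]: "cell_of 0 = Empty"
  by (simp add: cell_of.simps)

lemma cell_code_less: "cell_code C < 8"
  by (cases C) auto

lemma cell_code_0_iff: "cell_code C = 0 \<longleftrightarrow> C = Empty"
  by (cases C) auto

definition code_gen :: "nat \<Rightarrow> generation" where
  "code_gen z j = (if j < 0 then Empty else cell_of (nth_code z (nat j)))"

definition code_pattern :: "nat \<Rightarrow> pattern" where
  "code_pattern x i = code_gen (nth_code x (i mod len_code x))"

text \<open>Nonzero first and last entries make the word canonical. Entries above 7 are excluded
  since \<open>cell_of\<close> also sends them to \<open>Empty\<close>.\<close>

definition gen_code_ok :: "nat \<Rightarrow> nat \<Rightarrow> bool" where
  "gen_code_ok n z \<longleftrightarrow> nth_code z 0 \<noteq> 0 \<and> nth_code z (len_code z - 1) \<noteq> 0 \<and>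
     (\<forall>j<len_code z. nth_code z j < 8) \<and> (\<Sum>j<len_code z. strands (code_gen z (int j))) = n"

definition code_ok :: "nat \<Rightarrow> nat \<Rightarrow> bool" where
  "code_ok n x \<longleftrightarrow> len_code x \<noteq> 0 \<and> (\<forall>i<len_code x. gen_code_ok n (nth_code x i))"

lemma gen_width_pos: "gen_width \<delta> > 0"
  by (simp add: gen_width_def)

lemma nth_gen_code: "nth_code (gen_code \<delta>) j = (if j < gen_width \<delta> then cell_code (\<delta> (int j)) else 0)"
  by (simp add: gen_code_def gen_string_def)

lemma len_gen_code: "len_code (gen_code \<delta>) = gen_width \<delta>"
  by (simp add: gen_code_def gen_string_def)

lemma code_gen_code:
  assumes "is_generation n \<delta>"
  shows "code_gen (gen_code \<delta>) = \<delta>"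
proof
  fix j
  show "code_gen (gen_code \<delta>) j = \<delta> j"
    using gen_Empty[OF assms, of j] by (cases "j < 0") (auto simp: code_gen_def nth_gen_code)
qed

lemma strand_count_eq:
  assumes "\<And>j. j < 0 \<or> j \<ge> int w \<Longrightarrow> \<delta> j = Empty"
  shows "strand_count \<delta> = (\<Sum>j<w. strands (\<delta> (int j)))"
proof -
  have "gen_support \<delta> \<subseteq> int ` {..<w}"
  proof
    fix j assume "j \<in> gen_support \<delta>"
    then have "\<delta> j \<noteq> Empty" by (simp add: gen_support_def)
    then have "0 \<le> j" "j < int w" using assms[of j] by fastforce+
    then show "j \<in> int ` {..<w}" by (intro image_eqI[of _ _ "nat j"]) auto
  qed
  then have "strand_count \<delta> = (\<Sum>j\<in>int ` {..<w}. strands (\<delta> j))"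
    unfolding strand_count_def by (intro sum.mono_neutral_left) (auto simp: gen_support_def)
  then show ?thesis by (simp add: sum.reindex)
qed

lemma gen_code_ok_gen_code:
  assumes "is_generation n \<delta>"
  shows "gen_code_ok n (gen_code \<delta>)"
proof -
  have ne: "gen_support \<delta> \<noteq> {}" and fin: "finite (gen_support \<delta>)"
    using assms by (auto simp: is_generation_def gen_support_def)
  have "Max (gen_support \<delta>) \<in> gen_support \<delta>" using Max_in[OF fin ne] .
  then have last: "\<delta> (Max (gen_support \<delta>)) \<noteq> Empty" by (simp add: gen_support_def)
  then have "Max (gen_support \<delta>) \<ge> 0" using assms by (force simp: is_generation_def)
  then have "int (gen_width \<delta> - 1) = Max (gen_support \<delta>)" by (simp add: gen_width_def)
  then have "nth_code (gen_code \<delta>) (gen_width \<delta> - 1) \<noteq> 0"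
    using last gen_width_pos[of \<delta>] by (simp add: nth_gen_code cell_code_0_iff)
  moreover have "strand_count \<delta> = (\<Sum>j<gen_width \<delta>. strands (\<delta> (int j)))"
    by (rule strand_count_eq) (rule gen_Empty[OF assms])
  ultimately show ?thesis
    using assms gen_width_pos[of \<delta>]
    by (auto simp: gen_code_ok_def len_gen_code nth_gen_code cell_code_less cell_code_0_iff
        code_gen_code[OF assms] is_generation_def)
qed

lemma gen_code_code_gen:
  assumes "gen_code_ok n z"
  shows "is_generation n (code_gen z)" "gen_code (code_gen z) = z"
proof -
  obtain zs where zs: "z = list_encode zs" by (rule list_encode_cases)
  have ok: "zs \<noteq> []" "zs ! 0 \<noteq> 0" "zs ! (length zs - 1) \<noteq> 0" "\<And>j. j < length zs \<Longrightarrow> zs ! j < 8"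
    "(\<Sum>j<length zs. strands (code_gen z (int j))) = n"
    using assms unfolding zs gen_code_ok_def by (auto split: if_splits)
  have cell: "code_gen z (int j) = (if j < length zs then cell_of (zs ! j) else Empty)" for j
    by (simp add: code_gen_def zs)
  have nonempty: "cell_of (zs ! j) \<noteq> Empty \<longleftrightarrow> zs ! j \<noteq> 0" if "j < length zs" for j
    using ok(4)[OF that] cell_code_of cell_code_0_iff by metis
  have out: "code_gen z j = Empty" if "j < 0 \<or> j \<ge> int (length zs)" for j
    using that by (cases "j < 0") (auto simp: code_gen_def zs)
  have sub: "gen_support (code_gen z) \<subseteq> {0..<int (length zs)}"
  proof
    fix j assume "j \<in> gen_support (code_gen z)"
    then show "j \<in> {0..<int (length zs)}" using out[of j] by (cases "j < 0 \<or> j \<ge> int (length zs)") (auto simp: gen_support_def)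
  qed
  have fin: "finite (gen_support (code_gen z))" using finite_subset[OF sub] by simp
  show gen: "is_generation n (code_gen z)"
    unfolding is_generation_def using fin strand_count_eq[of "length zs", OF out] ok cell[of 0] nonempty[of 0] out
    by simp
  have "Max (gen_support (code_gen z)) = int (length zs - 1)"
  proof (rule Max_eqI[OF fin])
    show "y \<le> int (length zs - 1)" if "y \<in> gen_support (code_gen z)" for y
      using that sub by fastforce
    show "int (length zs - 1) \<in> gen_support (code_gen z)"
      using ok(1,3) cell[of "length zs - 1"] nonempty[of "length zs - 1"] by (simp add: gen_support_def)
  qed
  then have w: "gen_width (code_gen z) = length zs" using ok(1) by (simp add: gen_width_def)
  have "map cell_code (gen_string (code_gen z)) = zs"
    by (rule nth_equalityI) (use ok(4) in \<open>auto simp: gen_string_def w cell cell_code_of\<close>)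
  then show "gen_code (code_gen z) = z" by (simp add: gen_code_def zs)
qed

lemma code_okD:
  assumes "code_ok n x"
  defines "a \<equiv> map (code_pattern x) [0..<len_code x]"
  shows "a \<noteq> []" "\<And>\<delta>. \<delta> \<in> set a \<Longrightarrow> is_generation n \<delta>" "list_encode (map gen_code a) = x"
    "code_pattern x i = a ! (i mod length a)" "is_generation n (code_pattern x i)"
    "gen_code (code_pattern x i) = nth_code x (i mod len_code x)"
proof -
  obtain xs where xs: "x = list_encode xs" by (rule list_encode_cases)
  have ok: "xs \<noteq> []" "\<And>i. i < length xs \<Longrightarrow> gen_code_ok n (xs ! i)"
    using assms(1) by (auto simp: code_ok_def xs)
  have len: "length a = length xs" by (simp add: a_def xs)
  show "a \<noteq> []" using ok(1) len by auto
  have idx: "i mod length xs < length xs" for i using ok(1) by simp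
  have cp: "code_pattern x i = code_gen (xs ! (i mod length xs))" for i
    by (simp add: code_pattern_def xs idx)
  show gen: "is_generation n (code_pattern x i)" for i
    unfolding cp by (rule gen_code_code_gen(1)[OF ok(2)[OF idx]])
  then show "is_generation n \<delta>" if "\<delta> \<in> set a" for \<delta>
    using that by (auto simp: a_def)
  show "list_encode (map gen_code a) = x"
    unfolding xs list_encode_eq
    by (rule nth_equalityI) (auto simp: len a_def cp[unfolded xs] xs intro: gen_code_code_gen(2)[OF ok(2)])
  show "code_pattern x i = a ! (i mod length a)"
  proof -
    have "len_code x = length xs" by (simp add: xs)
    then show ?thesis using idx[of i] by (simp add: a_def cp)
  qed
  show "gen_code (code_pattern x i) = nth_code x (i mod len_code x)"
  proof -
    have "nth_code x (i mod len_code x) = xs ! (i mod length xs)" by (simp add: xs idx)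
    then show ?thesis using gen_code_code_gen(2)[OF ok(2)[OF idx]] by (simp only: cp)
  qed
qed

lemma code_ok_encode:
  assumes "a \<noteq> []" "\<And>\<delta>. \<delta> \<in> set a \<Longrightarrow> is_generation n \<delta>"
  shows "code_ok n (list_encode (map gen_code a))"
    "code_pattern (list_encode (map gen_code a)) = (\<lambda>i. a ! (i mod length a))"
proof -
  show "code_ok n (list_encode (map gen_code a))"
    using assms gen_code_ok_gen_code by (auto simp: code_ok_def)
  have "i mod length a < length a" for i using assms(1) by simp
  then show "code_pattern (list_encode (map gen_code a)) = (\<lambda>i. a ! (i mod length a))"
    using code_gen_code[OF assms(2)] by (intro ext) (simp add: code_pattern_def)
qed

section \<open>Conditions that can be checked on one period\<close>

text \<open>The pairs of places run from (-1, 0) to (\<open>w - 1\<close>, \<open>w\<close>): one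
  empty cell on either side covers all pairs that are not entirely empty.\<close>

definition local_ok :: "(cell \<Rightarrow> cell \<Rightarrow> cell \<Rightarrow> bool) \<Rightarrow> pattern \<Rightarrow> nat \<Rightarrow> nat \<Rightarrow> bool" where
  "local_ok Q h p w \<longleftrightarrow> (\<forall>i<p. \<forall>m<Suc w.
     Q (h i (int m - 1)) (h i (int m)) (child (h i) (h (Suc i)) (int m - 1)))"

lemma local_ok_iff:
  assumes "p > 0" "\<And>i. h i = h (i mod p)" "\<And>i j. j < 0 \<or> j \<ge> int w \<Longrightarrow> h i j = Empty"
    and "Q Empty Empty Empty"
  shows "local_ok Q h p w \<longleftrightarrow> (\<forall>i k. Q (h i k) (h i (k + 1)) (child (h i) (h (Suc i)) k))"
proof
  assume ok: "local_ok Q h p w"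
  show "\<forall>i k. Q (h i k) (h i (k + 1)) (child (h i) (h (Suc i)) k)"
  proof (intro allI)
    fix i k
    show "Q (h i k) (h i (k + 1)) (child (h i) (h (Suc i)) k)"
    proof (cases "-1 \<le> k \<and> k < int w")
      case True
      have "h i = h (i mod p)" "h (Suc i) = h (Suc (i mod p))"
        using assms(2)[of i] assms(2)[of "Suc i"] assms(2)[of "Suc (i mod p)"] by (simp_all add: mod_Suc_eq)
      moreover have "int (nat (k + 1)) = k + 1" "nat (k + 1) < Suc w" "i mod p < p"
        using True assms(1) by auto
      ultimately show ?thesis
        using ok[unfolded local_ok_def, rule_format, of "i mod p" "nat (k + 1)"] by simp
    next
      case False
      then show ?thesis
        using assms(3)[of k i] assms(3)[of "k + 1" i] assms(3)[of "child_pos (h i) k" "Suc i"] assms(4)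
        by (auto simp: child_def child_pos_def split: if_splits)
    qed
  qed
next
  assume all: "\<forall>i k. Q (h i k) (h i (k + 1)) (child (h i) (h (Suc i)) k)"
  show "local_ok Q h p w"
    unfolding local_ok_def
  proof (intro allI impI)
    fix i m
    show "Q (h i (int m - 1)) (h i (int m)) (child (h i) (h (Suc i)) (int m - 1))"
      using all[rule_format, of i "int m - 1"] by simp
  qed
qed

definition continuous_at :: "cell \<Rightarrow> cell \<Rightarrow> cell \<Rightarrow> bool" where
  "continuous_at A B C \<longleftrightarrow> (left_occupied C \<longleftrightarrow> exits_right A) \<and> (right_occupied C \<longleftrightarrow> exits_left B)"

definition obeys_at :: "turning_rule \<Rightarrow> cell \<Rightarrow> cell \<Rightarrow> cell \<Rightarrow> bool" where
  "obeys_at t A B C \<longleftrightarrow> (C \<noteq> Empty \<longrightarrow>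
     cell_state C = (if t ! turning_bit (cell_state A) (cell_state B) then StateT else StateS))"

text \<open>Testing the left cell suffices, as each cell is the left one of some pair.\<close>

definition crossing_free_at :: "cell \<Rightarrow> cell \<Rightarrow> cell \<Rightarrow> bool" where
  "crossing_free_at A B C \<longleftrightarrow> A \<noteq> ZX \<and> A \<noteq> SX"

context
  fixes p w :: nat and h :: pattern
  assumes h: "p > 0" "\<And>i. h i = h (i mod p)" "\<And>i j. j < 0 \<or> j \<ge> int w \<Longrightarrow> h i j = Empty"
begin

lemma continuous_local: "continuous_pattern h \<longleftrightarrow> local_ok continuous_at h p w"
  by (subst local_ok_iff[where h = h and p = p and w = w, OF h]) (simp_all add: continuous_pattern_def continuous_at_def)

lemma turning_local: "turning_rule_of t h \<longleftrightarrow> t \<in> turning_rules \<and> local_ok (obeys_at t) h p w"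
  by (subst local_ok_iff[where h = h and p = p and w = w, OF h]) (simp_all add: turning_rule_of_def obeys_at_def Let_def)

lemma crossing_local: "non_crossing h \<longleftrightarrow> local_ok crossing_free_at h p w"
  by (subst local_ok_iff[where h = h and p = p and w = w, OF h]) (simp_all add: non_crossing_def crossing_free_at_def)

end

lemma crossing_rule_trivial: "non_crossing h \<Longrightarrow> crossing_rule_of x h"
  by (auto simp: non_crossing_def crossing_rule_of_def Let_def child_def)

section \<open>Deleting strands computably\<close>

lemma keep_slots_Empty [simp]: "keep_slots l r Empty = Empty"
  by (cases l; cases r) auto

lemma keep_slots_nonempty:
  "left_occupied C \<Longrightarrow> keep_slots True r C \<noteq> Empty" "right_occupied C \<Longrightarrow> keep_slots l True C \<noteq> Empty"
  by (cases C; cases r; simp; fail | cases C; cases l; simp; fail)+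

text \<open>A computable form of \<open>select_strands\<close>: the strands before a cell are summed
  over an initial segment instead of the support.\<close>

definition select_nat :: "(nat \<Rightarrow> bool) \<Rightarrow> generation \<Rightarrow> generation" where
  "select_nat P \<delta> j = keep_slots (P (Suc (\<Sum>m<nat j. strands (\<delta> (int m)))))
     (P (Suc ((\<Sum>m<nat j. strands (\<delta> (int m))) + of_bool (left_occupied (\<delta> j))))) (\<delta> j)"

text \<open>Stands in for \<open>Min\<close> of the support; the bound \<open>w\<close> stops the
  search if no strand is left.\<close>

definition first_cell :: "nat \<Rightarrow> generation \<Rightarrow> nat" where
  "first_cell w \<delta> = (LEAST m. \<delta> (int m) \<noteq> Empty \<or> w \<le> m)"

definition substrands :: "(nat \<Rightarrow> bool) \<Rightarrow> nat \<Rightarrow> pattern \<Rightarrow> pattern" where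
  "substrands P w g i j = select_nat P (g i) (j + int (first_cell w (select_nat P (g i))))"

lemma select_strands_eq:
  assumes "is_generation n \<delta>"
  shows "select_strands P \<delta> = select_nat P \<delta>"
proof
  fix j
  have "{i. i \<in> gen_support \<delta> \<and> i < j} \<subseteq> int ` {..<nat j}"
  proof
    fix i assume "i \<in> {i. i \<in> gen_support \<delta> \<and> i < j}"
    moreover from this have "0 \<le> i" using assms by (force simp: gen_support_def is_generation_def)
    ultimately show "i \<in> int ` {..<nat j}" by (intro image_eqI[of _ _ "nat i"]) auto
  qed
  then have "strands_before \<delta> j = (\<Sum>i\<in>int ` {..<nat j}. strands (\<delta> i))"
    unfolding strands_before_def by (intro sum.mono_neutral_left) (auto simp: gen_support_def)
  then have "strands_before \<delta> j = (\<Sum>m<nat j. strands (\<delta> (int m)))"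
    by (simp add: sum.reindex)
  then show "select_strands P \<delta> j = select_nat P \<delta> j"
    by (simp add: select_strands_def select_nat_def Let_def)
qed

lemma select_nat_Empty: "\<delta> j = Empty \<Longrightarrow> select_nat P \<delta> j = Empty"
  by (simp add: select_nat_def)

text \<open>Guarantees that the minimum taken by \<open>renormalize\<close> is one of a nonempty
  set: strand \<open>r\<close> sits in the cell where the partial sums first reach
  \<open>r\<close>.\<close>

lemma select_nat_nonempty:
  assumes \<delta>: "is_generation n \<delta>" and r: "P r" "1 \<le> r" "r \<le> n"
  shows "\<exists>j. select_nat P \<delta> j \<noteq> Empty"
proof -
  define S where "S j = (\<Sum>m<j. strands (\<delta> (int m)))" for j
  have "S (gen_width \<delta>) = n"
    using strand_count_eq[of "gen_width \<delta>", OF gen_Empty[OF \<delta>]] \<delta> by (simp add: S_def is_generation_def)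
  then have ex: "r \<le> S (gen_width \<delta>)" using r by simp
  define k where "k = (LEAST k. r \<le> S k)"
  have k: "r \<le> S k" unfolding k_def using ex by (rule LeastI)
  have "k \<noteq> 0"
  proof
    assume "k = 0"
    then show False using k r by (simp add: S_def)
  qed
  then obtain j where j: "k = Suc j" by (cases k) auto
  have "\<not> r \<le> S j" using not_less_Least[of j "\<lambda>k. r \<le> S k"] j k_def by simp
  then have "S j < r" "r \<le> S j + strands (\<delta> (int j))" using k by (simp_all add: j S_def)
  then consider "r = Suc (S j)" "left_occupied (\<delta> (int j))"
    | "r = Suc (S j + of_bool (left_occupied (\<delta> (int j))))" "right_occupied (\<delta> (int j))"
    by (cases "\<delta> (int j)") (force simp: le_Suc_eq)+
  then have "select_nat P \<delta> (int j) \<noteq> Empty"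
    unfolding select_nat_def nat_int S_def[symmetric]
    using r(1) keep_slots_nonempty by cases auto
  then show ?thesis by blast
qed

lemma renormalize_eq:
  assumes supp: "\<And>j. j < 0 \<or> j \<ge> int w \<Longrightarrow> \<delta> j = Empty" and ne: "\<delta> j0 \<noteq> Empty"
  shows "renormalize \<delta> j = \<delta> (j + int (first_cell w \<delta>))"
proof -
  have sub: "gen_support \<delta> \<subseteq> {0..<int w}"
  proof
    fix j assume "j \<in> gen_support \<delta>"
    then show "j \<in> {0..<int w}" using supp[of j] by (cases "j < 0 \<or> j \<ge> int w") (auto simp: gen_support_def)
  qed
  have fin: "finite (gen_support \<delta>)" using finite_subset[OF sub] by simp
  have j0: "j0 \<in> gen_support \<delta>" using ne by (simp add: gen_support_def)
  define m where "m = Min (gen_support \<delta>)"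
  have m: "m \<in> gen_support \<delta>" "\<And>j. j \<in> gen_support \<delta> \<Longrightarrow> m \<le> j"
    unfolding m_def using Min_in[OF fin] Min_le[OF fin] j0 by auto
  have "first_cell w \<delta> = nat m"
    unfolding first_cell_def
  proof (rule Least_equality)
    show "\<delta> (int (nat m)) \<noteq> Empty \<or> w \<le> nat m" using m(1) sub by (auto simp: gen_support_def)
    show "nat m \<le> k" if "\<delta> (int k) \<noteq> Empty \<or> w \<le> k" for k
      using that m sub by (force simp: gen_support_def)
  qed
  then show ?thesis using m(1) sub by (auto simp: renormalize_def m_def)
qed

lemma substrands_Empty:
  assumes "\<And>i j. j < 0 \<or> j \<ge> int w \<Longrightarrow> g i j = Empty" "j < 0 \<or> j \<ge> int w"
  shows "substrands P w g i j = Empty"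
proof (cases "j \<ge> int w")
  case True
  then show ?thesis unfolding substrands_def by (intro select_nat_Empty assms(1)) simp
next
  case False
  define \<delta> where "\<delta> = select_nat P (g i)"
  define k where "k = j + int (first_cell w \<delta>)"
  have "\<delta> k = Empty"
  proof (cases "k < 0")
    case True
    then show ?thesis unfolding \<delta>_def by (intro select_nat_Empty assms(1)) simp
  next
    case k: False
    then have "nat k < first_cell w \<delta>" using False assms(2) by (simp add: k_def)
    then show ?thesis using not_less_Least[of "nat k" "\<lambda>m. \<delta> (int m) \<noteq> Empty \<or> w \<le> m"] k
      unfolding first_cell_def by auto
  qed
  then show ?thesis by (simp add: substrands_def \<delta>_def k_def)
qed

context
  fixes g :: pattern and n p w :: nat
  assumes gen: "\<And>i. is_generation n (g i)" and p: "p > 0" and per: "\<And>i. g i = g (i mod p)"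
    and wide: "\<And>i. gen_width (g i) \<le> w"
begin

lemma pattern_Empty: "j < 0 \<or> j \<ge> int w \<Longrightarrow> g i j = Empty"
  by (rule gen_Empty[OF gen]) (use wide[of i] in auto)

lemma renormalize_select:
  assumes "P r" "1 \<le> r" "r \<le> n"
  shows "(\<lambda>i. renormalize (select_strands P (g i))) = substrands P w g"
proof (intro ext)
  fix i j
  obtain j0 where "select_nat P (g i) j0 \<noteq> Empty"
    using select_nat_nonempty[where P = P, OF gen assms] by blast
  then show "renormalize (select_strands P (g i)) j = substrands P w g i j"
    unfolding substrands_def select_strands_eq[OF gen]
    by (intro renormalize_eq select_nat_Empty pattern_Empty)
qed

lemma turning_substrands:
  "turning_rule_of t (substrands P w g) \<longleftrightarrow> t \<in> turning_rules \<and> local_ok (obeys_at t) (substrands P w g) p w"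
proof (rule turning_local[OF p])
  show "substrands P w g i = substrands P w g (i mod p)" for i
    unfolding substrands_def using per[of i] by (intro ext) simp
qed (rule substrands_Empty[OF pattern_Empty])

lemma rules_T_eq:
  assumes "n \<ge> 1"
  shows "rules_T n g = {t \<in> turning_rules. \<forall>k<n. local_ok (obeys_at t)
    (substrands (\<lambda>m. if positive_speed g then m \<le> Suc k else n < m + Suc k) w g) p w}"
proof -
  have first: "first_strands (Suc k) g = substrands (\<lambda>m. m \<le> Suc k) w g" for k
    using renormalize_select[of "\<lambda>m. m \<le> Suc k" 1] assms by (simp add: first_strands_def[abs_def])
  have last: "last_strands (Suc k) g = substrands (\<lambda>m. n < m + Suc k) w g" for k
    using renormalize_select[of "\<lambda>m. n < m + Suc k" n] assms gen
    by (simp add: last_strands_def[abs_def] is_generation_def)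
  have all: "(\<forall>k\<in>{Suc 0..n}. P k) \<longleftrightarrow> (\<forall>k<n. P (Suc k))" for P
    by (metis atLeastAtMost_iff Suc_leI Suc_le_eq One_nat_def Suc_pred' le_eq_less_or_eq less_Suc_eq_le zero_less_Suc)
  have "n > 0" using assms by simp
  then show ?thesis
    by (cases "positive_speed g") (auto simp: rules_T_def all first last turning_substrands)
qed

end

section \<open>Tests on codes of periods\<close>

definition width_code :: "nat \<Rightarrow> nat" where
  "width_code x = (LEAST w. \<forall>i<len_code x. len_code (nth_code x i) \<le> w)"

text \<open>No shorter word generates the pattern. Both index functions have period
  \<open>len_code x * q\<close>, so comparing that many generations decides it.\<close>

definition primitive_code :: "nat \<Rightarrow> bool" where
  "primitive_code x \<longleftrightarrow> (\<forall>q<len_code x. q = 0 \<or> (\<exists>i<len_code x * q.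
     nth_code x (i mod len_code x) \<noteq> nth_code x ((i mod q) mod len_code x)))"

text \<open>Only the sign of the speed enters, and comparing two counts avoids a signed sum.\<close>

definition faster_left :: "pattern \<Rightarrow> nat \<Rightarrow> bool" where
  "faster_left g p \<longleftrightarrow> (\<Sum>i<p. of_bool (g i 0 = RN)) < (\<Sum>i<p. of_bool (g i 0 = NL) :: nat)"

definition faster_right :: "pattern \<Rightarrow> nat \<Rightarrow> bool" where
  "faster_right g p \<longleftrightarrow> (\<Sum>i<p. of_bool (g i 0 = NL)) < (\<Sum>i<p. of_bool (g i 0 = RN) :: nat)"

text \<open>The positions of a null chain of period \<open>p\<close> may be negative, but not smaller than \<open>- p\<close>.\<close>

definition chain_pos :: "nat \<Rightarrow> nat \<Rightarrow> nat \<Rightarrow> int" where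
  "chain_pos p z i = int (nth_code z i) - int p"

definition chain_ok :: "pattern \<Rightarrow> nat \<Rightarrow> nat \<Rightarrow> nat \<Rightarrow> bool" where
  "chain_ok g p w z \<longleftrightarrow> (\<forall>i<p. g i (chain_pos p z i) = Empty) \<and>
     (\<exists>j<w. int j < chain_pos p z 0 \<and> g 0 (int j) \<noteq> Empty) \<and>
     (\<exists>j<w. chain_pos p z 0 < int j \<and> g 0 (int j) \<noteq> Empty) \<and>
     (\<forall>i<p - 1. chain_pos p z (Suc i) = child_pos (g i) (chain_pos p z i - 1) \<or>
        chain_pos p z (Suc i) = child_pos (g i) (chain_pos p z i))"

text \<open>A null chain starts between nonempty cells, hence within \<open>0..w\<close>, and moves
  by at most one per generation. Shifted by \<open>p\<close>, its positions are naturals up to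
  \<open>w + 2 * p\<close>, which bounds its code.\<close>

lemma ex_null_chain_iff:
  assumes p: "p > 0" and supp: "\<And>i j. j < 0 \<or> j \<ge> int w \<Longrightarrow> g i j = Empty"
  shows "(\<exists>cs. null_chain (map g [0..<p]) cs) \<longleftrightarrow> (\<exists>z<Suc (list_bound p (w + 2 * p)). chain_ok g p w z)"
proof
  assume "\<exists>cs. null_chain (map g [0..<p]) cs"
  then obtain cs where "null_chain (map g [0..<p]) cs" ..
  then have cs: "length cs = p" "\<And>i. i < p \<Longrightarrow> g i (cs ! i) = Empty"
    "\<exists>j<cs ! 0. g 0 j \<noteq> Empty" "\<exists>j>cs ! 0. g 0 j \<noteq> Empty"
    "\<And>i. Suc i < p \<Longrightarrow> cs ! Suc i \<in> {child_pos (g i) (cs ! i - 1), child_pos (g i) (cs ! i)}"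
    using p unfolding null_chain_def by auto
  have inside: "0 \<le> j \<and> j < int w" if "g i j \<noteq> Empty" for i j
    using supp[of j i] that by (cases "j < 0 \<or> j \<ge> int w") auto
  have bounds: "- int i \<le> cs ! i \<and> cs ! i \<le> int w + int i" if "i < p" for i
    using that
  proof (induction i)
    case 0
    obtain j k where "j < cs ! 0" "g 0 j \<noteq> Empty" "k > cs ! 0" "g 0 k \<noteq> Empty" using cs(3,4) by blast
    then show ?case using inside[of 0 j] inside[of 0 k] by simp
  next
    case (Suc i)
    then show ?case using cs(5)[OF Suc.prems] by (auto simp: child_pos_def split: if_splits)
  qed
  define z where "z = list_encode (map (\<lambda>i. nat (cs ! i + int p)) [0..<p])"
  have "chain_pos p z i = cs ! i" if "i < p" for i
    using bounds[OF that] that by (simp add: chain_pos_def z_def)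
  moreover have "\<exists>j'<w. Q (int j')" if "\<exists>j. Q j \<and> g 0 j \<noteq> Empty" for Q
  proof -
    from that obtain j where "Q j" "g 0 j \<noteq> Empty" by blast
    then show ?thesis using inside[of 0 j] by (intro exI[of _ "nat j"]) auto
  qed
  from this[of "\<lambda>j. j < cs ! 0 \<and> g 0 j \<noteq> Empty"] this[of "\<lambda>j. cs ! 0 < j \<and> g 0 j \<noteq> Empty"]
  have "\<exists>j<w. int j < cs ! 0 \<and> g 0 (int j) \<noteq> Empty" "\<exists>j<w. cs ! 0 < int j \<and> g 0 (int j) \<noteq> Empty"
    using cs(3,4) by blast+
  ultimately have "chain_ok g p w z"
    unfolding chain_ok_def using p cs(2,5) by (auto simp: less_diff_conv)
  moreover have "z \<le> list_bound p (w + 2 * p)"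
    unfolding z_def using bounds by (intro list_encode_bound) (fastforce simp: nat_le_iff)+
  ultimately show "\<exists>z<Suc (list_bound p (w + 2 * p)). chain_ok g p w z" by (auto simp: less_Suc_eq_le)
next
  assume "\<exists>z<Suc (list_bound p (w + 2 * p)). chain_ok g p w z"
  then obtain z where z: "chain_ok g p w z" by blast
  have "null_chain (map g [0..<p]) (map (chain_pos p z) [0..<p])"
    using z p unfolding null_chain_def chain_ok_def by (auto simp: less_diff_conv)
  then show "\<exists>cs. null_chain (map g [0..<p]) cs" by blast
qed

lemma per_eqI:
  assumes "is_power a g" "\<And>b. is_power b g \<Longrightarrow> length a \<le> length b"
  shows "per g = a"
proof (rule nth_equalityI)
  show len: "length (per g) = length a"
    using per_minimal[OF assms(1)] assms(2)[OF per_is_power[OF assms(1)]] by simp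
  fix i assume i: "i < length (per g)"
  have "g i = per g ! (i mod length (per g))" "g i = a ! (i mod length a)"
    using per_is_power[OF assms(1)] assms(1) unfolding is_power_def by blast+
  then show "per g ! i = a ! i" using i len by simp
qed

definition glider_code :: "nat \<Rightarrow> nat \<Rightarrow> bool" where
  "glider_code n x \<longleftrightarrow> code_ok n x \<and> primitive_code x \<and>
     local_ok continuous_at (code_pattern x) (len_code x) (width_code x) \<and>
     local_ok crossing_free_at (code_pattern x) (len_code x) (width_code x) \<and>
     \<not> (\<exists>z<Suc (list_bound (len_code x) (width_code x + 2 * len_code x)).
          chain_ok (code_pattern x) (len_code x) (width_code x) z) \<and>
     (faster_left (code_pattern x) (len_code x) \<and>
        (\<exists>t\<in>turning_rules. \<not> t ! 1 \<and> local_ok (obeys_at t) (code_pattern x) (len_code x) (width_code x)) \<or>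
      faster_right (code_pattern x) (len_code x) \<and>
        (\<exists>t\<in>turning_rules. \<not> t ! 3 \<and> local_ok (obeys_at t) (code_pattern x) (len_code x) (width_code x)))"

text \<open>The whole description is computed from the code of the period; the sum of powers of two
  is \<open>set_encode\<close> of the rule set.\<close>

definition desc_code :: "nat \<Rightarrow> nat \<Rightarrow> nat" where
  "desc_code n x = prod_encode (x, prod_encode
     (\<Sum>t\<in>turning_rules. if \<forall>k<n. local_ok (obeys_at t)
          (substrands (\<lambda>m. if faster_left (code_pattern x) (len_code x) then m \<le> Suc k else n < m + Suc k)
            (width_code x) (code_pattern x)) (len_code x) (width_code x)
        then 2 ^ rule_code t else 0,
      width_code x))"

context
  fixes n x p w :: nat and g :: pattern
  assumes ok: "code_ok n x"
  defines "p \<equiv> len_code x" and "w \<equiv> width_code x" and "g \<equiv> code_pattern x"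
begin

lemma len_code_pos: "p > 0"
  using ok by (simp add: code_ok_def p_def)

lemma code_pattern_mod: "g i = g (i mod p)"
  by (simp add: g_def code_pattern_def p_def)

lemma code_pattern_gen: "is_generation n (g i)"
  unfolding g_def by (rule code_okD(5)[OF ok])

lemma code_pattern_power: "is_power (map g [0..<p]) g" and code_pattern_code: "list_encode (map gen_code (map g [0..<p])) = x"
  using code_okD(1,3,4)[OF ok] len_code_pos by (auto simp: is_power_def g_def p_def)

lemma gen_width_code_pattern: "gen_width (g i) = len_code (nth_code x (i mod p))"
  using code_okD(6)[OF ok, of i] len_gen_code[of "g i"] by (simp add: g_def p_def)

lemma gen_width_le_width_code: "gen_width (g i) \<le> w" and pattern_width_code: "pattern_width g = w"
proof -
  let ?W = "range (\<lambda>i. gen_width (g i))"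
  have W: "?W = (\<lambda>i. len_code (nth_code x i)) ` {..<p}"
    unfolding gen_width_code_pattern using len_code_pos by (auto simp: image_iff) (metis mod_less)
  then have fin: "finite ?W" by simp
  have all: "(\<forall>i<p. len_code (nth_code x i) \<le> v) \<longleftrightarrow> (\<forall>u\<in>?W. u \<le> v)" for v
    unfolding W by auto
  have "w = Max ?W"
    unfolding w_def width_code_def p_def[symmetric] all
    by (rule Least_equality) (use fin in \<open>auto intro!: Max.boundedI\<close>)
  then show "pattern_width g = w" "gen_width (g i) \<le> w"
    using fin by (auto simp: pattern_width_def)
qed

lemma code_pattern_Empty: "j < 0 \<or> j \<ge> int w \<Longrightarrow> g i j = Empty"
  by (rule pattern_Empty[where g = g and n = n and p = p and w = w, OF code_pattern_gen len_code_pos code_pattern_mod gen_width_le_width_code])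

lemma primitive_code_iff: "primitive_code x \<longleftrightarrow> per g = map g [0..<p]"
proof
  have same: "nth_code x (i mod p) = nth_code x (j mod p) \<longleftrightarrow> g i = g j" for i j
  proof -
    have "nth_code x (i mod p) = gen_code (g i)" for i
      using code_okD(6)[OF ok, of i] by (simp add: g_def p_def)
    then show ?thesis using inj_onD[OF inj_gen_code] code_pattern_gen by (metis (mono_tags, lifting) mem_Collect_eq)
  qed
  have prim: "primitive_code x \<longleftrightarrow> (\<forall>q<p. q = 0 \<or> (\<exists>i<p * q. g i \<noteq> g (i mod q)))"
    unfolding primitive_code_def p_def[symmetric] same by simp
  {
    assume *: "primitive_code x"
    show "per g = map g [0..<p]"
    proof (rule per_eqI[OF code_pattern_power])
      fix b assume b: "is_power b g"
      show "length (map g [0..<p]) \<le> length b"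
      proof (rule ccontr)
        assume "\<not> ?thesis"
        then have "length b < p" "length b \<noteq> 0" using b by (auto simp: is_power_def)
        then obtain i where "g i \<noteq> g (i mod length b)" using * prim by blast
        moreover have "g j = b ! (j mod length b)" for j using b by (simp add: is_power_def)
        ultimately show False by simp
      qed
    qed
  }
  {
    assume per: "per g = map g [0..<p]"
    show "primitive_code x"
      unfolding prim
    proof (intro allI impI)
      fix q assume q: "q < p"
      show "q = 0 \<or> (\<exists>i<p * q. g i \<noteq> g (i mod q))"
      proof (rule ccontr)
        assume no: "\<not> ?thesis"
        then have q0: "q > 0" by simp
        have "g i = g (i mod q)" for i
        proof -
          have "g i = g (i mod (p * q))"
            using code_pattern_mod[of i] code_pattern_mod[of "i mod (p * q)"] by (simp add: mod_mod_cancel)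
          also have "\<dots> = g (i mod (p * q) mod q)" using no len_code_pos q0 by auto
          finally show ?thesis by (simp add: mod_mod_cancel)
        qed
        then have "is_power (map g [0..<q]) g" using q0 by (simp add: is_power_def)
        then show False using per_minimal per q by fastforce
      qed
    qed
  }
qed

lemma speed_code_iff:
  assumes "per g = map g [0..<p]"
  shows "positive_speed g \<longleftrightarrow> faster_left g p" "negative_speed g \<longleftrightarrow> faster_right g p"
proof -
  have "edge_shift \<delta> = of_bool (\<delta> 0 = NL) - of_bool (\<delta> 0 = RN)" for \<delta>
    by (simp add: edge_shift_def)
  then have "fst (speed g) = (\<Sum>i<p. of_bool (g i 0 = NL)) - (\<Sum>i<p. of_bool (g i 0 = RN))"
    unfolding speed_def assms by (simp add: sum_list_sum_nth atLeast0LessThan sum_subtractf)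
  moreover have "(\<Sum>i<p. of_bool (g i 0 = C)) = int (\<Sum>i<p. of_bool (g i 0 = C))" for C by simp
  ultimately show "positive_speed g \<longleftrightarrow> faster_left g p" "negative_speed g \<longleftrightarrow> faster_right g p"
    unfolding positive_speed_def negative_speed_def faster_left_def faster_right_def
    by (simp_all only: diff_gt_0_iff_gt diff_less_0_iff_less of_nat_less_iff)
qed

lemma code_pattern_U_iff:
  assumes per: "per g = map g [0..<p]"
  shows "g \<in> U n \<longleftrightarrow> glider_code n x"
proof -
  note loc = len_code_pos code_pattern_mod code_pattern_Empty
  have crossing: "\<exists>y. crossing_rule_of y g" if "non_crossing g"
    using crossing_rule_trivial[OF that] by blast
  have grid: "grid_pattern n g" using code_pattern_gen by (simp add: grid_pattern_def)
  have pow: "\<exists>a. is_power a g" using code_pattern_power by blast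
  have chain: "(\<exists>cs. null_chain (per g) cs) \<longleftrightarrow>
      (\<exists>z<Suc (list_bound p (w + 2 * p)). chain_ok g p w z)"
    unfolding per by (rule ex_null_chain_iff[OF len_code_pos code_pattern_Empty])
  have rules: "(\<exists>t\<in>turning_rules. \<not> t ! k \<and> local_ok (obeys_at t) g p w) \<longleftrightarrow>
      (\<exists>t. turning_rule_of t g \<and> \<not> t ! k)" for k
    by (auto simp: turning_local[where h = g and p = p and w = w, OF loc])
  have code: "glider_code n x \<longleftrightarrow> continuous_pattern g \<and> non_crossing g \<and>
      \<not> (\<exists>cs. null_chain (per g) cs) \<and>
      (positive_speed g \<and> (\<exists>t. turning_rule_of t g \<and> \<not> t ! 1) \<or>
       negative_speed g \<and> (\<exists>t. turning_rule_of t g \<and> \<not> t ! 3))"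
    unfolding glider_code_def p_def[symmetric] w_def[symmetric] g_def[symmetric] rules chain
      speed_code_iff[OF per, symmetric]
    using ok per primitive_code_iff continuous_local[where h = g and p = p and w = w, OF loc]
      crossing_local[where h = g and p = p and w = w, OF loc] by simp
  have "g \<in> U n \<longleftrightarrow> (continuous_pattern g \<and> (\<exists>t. turning_rule_of t g) \<and>
      \<not> (\<exists>cs. null_chain (per g) cs)) \<and> (positive_speed g \<or> negative_speed g) \<and>
      (positive_speed g \<and> (\<exists>t. turning_rule_of t g \<and> \<not> t ! 1) \<or>
       negative_speed g \<and> (\<exists>t. turning_rule_of t g \<and> \<not> t ! 3)) \<and> non_crossing g"
    unfolding U_def pure_glider_def glider_def repeating_sca_def sca_pattern_def mem_Collect_eq
    using grid pow crossing by metis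
  then show ?thesis unfolding code by blast
qed

lemma desc_code_eq:
  assumes per: "per g = map g [0..<p]" and n: "n \<ge> 1"
  shows "desc_code n x = description_code (per g, rules_T n g, pattern_width g)"
proof -
  let ?ok = "\<lambda>t. \<forall>k<n. local_ok (obeys_at t)
    (substrands (\<lambda>m. if positive_speed g then m \<le> Suc k else n < m + Suc k) w g) p w"
  have T: "rules_T n g = {t \<in> turning_rules. ?ok t}"
    by (rule rules_T_eq[where g = g and n = n and p = p and w = w, OF code_pattern_gen len_code_pos code_pattern_mod gen_width_le_width_code n])
  have "set_encode (rule_code ` rules_T n g) = (\<Sum>t\<in>rules_T n g. 2 ^ rule_code t)"
    unfolding set_encode_def by (rule sum.reindex_cong[of rule_code]) (auto intro: inj_on_subset[OF inj_rule_code])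
  also have "\<dots> = (\<Sum>t\<in>turning_rules. if ?ok t then 2 ^ rule_code t else 0)"
    unfolding T by (simp add: sum.inter_filter finite_turning_rules)
  finally show ?thesis
    unfolding desc_code_def p_def[symmetric] w_def[symmetric] g_def[symmetric] speed_code_iff(1)[OF per, symmetric]
    using per code_pattern_code pattern_width_code by simp
qed

end

lemma glider_code_per_code:
  assumes "g \<in> U n"
  shows "code_ok n (per_code g)" "code_pattern (per_code g) = g"
    "per g = map g [0..<len_code (per_code g)]" "glider_code n (per_code g)"
proof -
  interpret repeating_pattern g n
    using assms by unfold_locales (auto simp: U_def pure_glider_def glider_def)
  have mem: "is_generation n \<delta>" if "\<delta> \<in> set (per g)" for \<delta>
  proof -
    from that obtain i where "i < p" "\<delta> = per g ! i" by (auto simp: in_set_conv_nth p_def)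
    then have "\<delta> = g i" by (simp add: g_nth)
    then show ?thesis using gen by simp
  qed
  have ne: "per g \<noteq> []" using p_pos by (simp add: p_def)
  show ok: "code_ok n (per_code g)" and pat: "code_pattern (per_code g) = g"
    unfolding per_code_def using code_ok_encode[OF ne mem] power by (auto simp: is_power_def fun_eq_iff)
  show per: "per g = map g [0..<len_code (per_code g)]"
    by (rule nth_equalityI) (auto simp: per_code_def g_nth p_def)
  show "glider_code n (per_code g)"
    using code_pattern_U_iff[OF ok] assms per unfolding pat by simp
qed

text \<open>Primitivity ensures that an accepted code is that of \<open>per\<close>, and not of a
  repetition of it.\<close>

lemma glider_code_iff: "glider_code n x \<longleftrightarrow> x \<in> per_code ` U n"
proof
  assume gc: "glider_code n x"
  then have ok: "code_ok n x" and "primitive_code x" by (simp_all add: glider_code_def)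
  then have per: "per (code_pattern x) = map (code_pattern x) [0..<len_code x]" using primitive_code_iff by blast
  have "code_pattern x \<in> U n" using code_pattern_U_iff[OF ok per] gc by simp
  moreover have "per_code (code_pattern x) = x"
    unfolding per_code_def per using code_pattern_code[OF ok] by simp
  ultimately show "x \<in> per_code ` U n" by force
qed (auto intro: glider_code_per_code)

lemma desc_code_per_code:
  assumes "g \<in> U n" "n \<ge> 1"
  shows "desc_code n (per_code g) = description_code (per g, rules_T n g, pattern_width g)"
  using desc_code_eq[OF glider_code_per_code(1)[OF assms(1)]] glider_code_per_code(2,3)[OF assms(1)] assms(2)
  by simp

lemma codes_V:
  assumes "n \<ge> 1"
  shows "description_code ` V n = desc_code n ` {x. glider_code n x}"
  unfolding V_def glider_code_iff Collect_mem_eq image_image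
  by (rule image_cong[OF refl]) (rule desc_code_per_code[OF _ assms, symmetric])

lemma inj_desc_code: "inj (desc_code n)"
  by (rule injI) (simp add: desc_code_def)

text \<open>Exhaustive search up to a bound for the codes of all periods; a sum of distinct powers
  of two is the code of the set of exponents.\<close>

definition V_code :: "nat \<Rightarrow> nat" where
  "V_code n = (\<Sum>x<Suc (per_code_bound n). if glider_code n x then 2 ^ desc_code n x else 0)"

lemma V_code:
  assumes "n \<ge> 1"
  shows "description_set_code (V n) = V_code n"
proof -
  have "{x. glider_code n x} = {x \<in> {..<Suc (per_code_bound n)}. glider_code n x}"
    using per_code_le by (auto simp: glider_code_iff less_Suc_eq_le)
  moreover have "description_set_code (V n) = (\<Sum>x\<in>{x. glider_code n x}. 2 ^ desc_code n x)"
    unfolding description_set_code_def codes_V[OF assms] set_encode_def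
    by (rule sum.reindex_cong[of "desc_code n"]) (auto intro: inj_on_subset[OF inj_desc_code])
  ultimately show ?thesis
    unfolding V_code_def using sum.inter_filter[of "{..<Suc (per_code_bound n)}" "\<lambda>x. 2 ^ desc_code n x" "glider_code n"]
    by simp
qed

section \<open>The algorithms\<close>

lemma computable_of_bool: "computable A \<Longrightarrow> computable (\<lambda>e. of_bool (A e) :: nat)"
  by (rule computable_lift1[of "Proj 0"]) (simp add: enc_nat_def enc_bool_def)

lemmas computable_intros = computable_const computable_id computable_fst computable_snd computable_Suc
  computable_add computable_diff computable_mult computable_power computable_not computable_conj
  computable_disj computable_imp computable_if computable_ball computable_bex computable_sum computable_le
  computable_less computable_eq computable_div computable_mod computable_even computable_int_diff
  computable_nat computable_int computable_int_add computable_int_minus computable_int_le computable_int_less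
  computable_of_bool computable_prod_decode computable_prod_encode

lemma computable_hd_code: "computable A \<Longrightarrow> computable (\<lambda>e. hd_code (A e))"
  and computable_tl_code: "computable A \<Longrightarrow> computable (\<lambda>e. tl_code (A e))"
  unfolding hd_code_def tl_code_def by (intro computable_intros; assumption)+

lemma funpow_rec: "(f ^^ k) z = rec_nat z (\<lambda>_. f) k"
  by (induction k) auto

lemma computable_nth_code: "computable A \<Longrightarrow> computable B \<Longrightarrow> computable (\<lambda>e. nth_code (A e) (B e))"
  unfolding nth_code_def funpow_rec
  by (intro computable_hd_code computable_rec computable_tl_code computable_intros)

lemma computable_len_code: "computable A \<Longrightarrow> computable (\<lambda>e. len_code (A e))"
proof (rule computable_comp[of len_code])
  have "\<exists>k. (tl_code ^^ k) z = 0" for z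
    by (rule list_encode_cases[of z]) (auto simp: tl_code_funpow list_encode_0_iff intro!: exI[of _ "length _"])
  then have "computable (\<lambda>z. LEAST k. rec_nat z (\<lambda>_. tl_code) k = 0)"
    unfolding funpow_rec by (intro computable_Least computable_rec computable_tl_code computable_intros) blast
  then show "computable len_code" unfolding len_code_def[abs_def] funpow_rec .
qed

lemma computable_cell_of: "computable A \<Longrightarrow> computable (\<lambda>e. cell_of (A e))"
  unfolding cell_of.simps by (intro computable_intros)

lemma computable_code_gen: "computable A \<Longrightarrow> computable B \<Longrightarrow> computable (\<lambda>e. code_gen (A e) (B e))"
  unfolding code_gen_def by (intro computable_cell_of computable_nth_code computable_intros)

lemma computable_code_pattern:
  "computable A \<Longrightarrow> computable B \<Longrightarrow> computable C \<Longrightarrow> computable (\<lambda>e. code_pattern (A e) (B e) (C e))"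
  unfolding code_pattern_def
  by (intro computable_code_gen computable_nth_code computable_len_code computable_intros)

lemmas code_intros = computable_nth_code computable_len_code computable_code_gen computable_code_pattern
  computable_intros

lemma computable_gen_code_ok: "computable A \<Longrightarrow> computable B \<Longrightarrow> computable (\<lambda>e. gen_code_ok (A e) (B e))"
proof (rule computable_app2[of gen_code_ok])
  show "computable (\<lambda>q. gen_code_ok (fst q) (snd q))"
    unfolding gen_code_ok_def by (intro code_intros computable_cell1[of _ strands])
qed

lemma computable_code_ok: "computable A \<Longrightarrow> computable B \<Longrightarrow> computable (\<lambda>e. code_ok (A e) (B e))"
proof (rule computable_app2[of code_ok])
  show "computable (\<lambda>q. code_ok (fst q) (snd q))"
    unfolding code_ok_def by (intro computable_gen_code_ok code_intros)
qed

lemma computable_width_code: "computable A \<Longrightarrow> computable (\<lambda>e. width_code (A e))"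
proof (rule computable_comp[of width_code])
  have "\<exists>w. \<forall>i<len_code x. len_code (nth_code x i) \<le> w" for x
    by (rule exI[of _ "\<Sum>i<len_code x. len_code (nth_code x i)"]) (auto intro: member_le_sum)
  then have "computable (\<lambda>x. LEAST w. \<forall>i<len_code x. len_code (nth_code x i) \<le> w)"
    by (intro computable_Least code_intros)
  then show "computable width_code" unfolding width_code_def[abs_def] .
qed

lemma computable_primitive_code: "computable A \<Longrightarrow> computable (\<lambda>e. primitive_code (A e))"
proof (rule computable_comp[of primitive_code])
  show "computable primitive_code"
    unfolding primitive_code_def[abs_def] by (intro code_intros)
qed

lemma computable_list_bound: "computable A \<Longrightarrow> computable B \<Longrightarrow> computable (\<lambda>e. list_bound (A e) (B e))"
proof (rule computable_app2[of list_bound])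
  have "list_bound l m = rec_nat 0 (\<lambda>_ r. Suc (prod_encode (m, r))) l" for l m
    by (induction l) auto
  then show "computable (\<lambda>q. list_bound (fst q) (snd q))"
    by (simp only:) (intro computable_rec computable_intros)
qed

text \<open>The pattern may depend on the environment \<open>e\<close>; it is computable as a map
  from \<open>e\<close>, generation and place to a cell.\<close>

context
  fixes h :: "'e :: enc \<Rightarrow> pattern" and p w :: "'e \<Rightarrow> nat"
  assumes h: "computable (\<lambda>q. h (fst q) (fst (snd q)) (snd (snd q)))"
    and p: "computable p" and w: "computable w"
begin

lemmas h_intros = computable_app3[where F = h, OF h] computable_comp[OF p] computable_comp[OF w]
  p w code_intros

lemma computable_local_ok: "computable (\<lambda>e. local_ok Q (h e) (p e) (w e))"
  unfolding local_ok_def child_def child_pos_def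
  by (intro computable_cell3[of _ _ _ Q] computable_cell1[of _ exits_left] h_intros)

lemma computable_faster:
  "computable (\<lambda>e. faster_left (h e) (p e))" "computable (\<lambda>e. faster_right (h e) (p e))"
  unfolding faster_left_def faster_right_def by (intro h_intros)+

lemma computable_chain_ok:
  assumes "computable z"
  shows "computable (\<lambda>e. chain_ok (h e) (p e) (w e) (z e))"
  unfolding chain_ok_def child_pos_def chain_pos_def
  by (intro computable_cell1[of _ exits_left] computable_comp[OF assms] h_intros)

lemma computable_substrands:
  assumes P: "computable (\<lambda>q. P (fst q) (snd q))"
  shows "computable (\<lambda>q. substrands (P (fst q)) (w (fst q)) (h (fst q)) (fst (snd q)) (snd (snd q)))"
proof -
  have sel: "computable (\<lambda>q. select_nat (P (fst q)) (h (fst q) (fst (snd q))) (snd (snd q)))"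
    unfolding select_nat_def
    by (intro computable_app3[where F = keep_slots, OF computable_finite] computable_app2[where F = P, OF P]
        computable_cell1[of _ strands] computable_cell1[of _ left_occupied] h_intros)
  note sel' = computable_app3[where F = "\<lambda>e i j. select_nat (P e) (h e i) j", OF sel]
  have first: "computable (\<lambda>q. first_cell (w (fst q)) (select_nat (P (fst q)) (h (fst q) (snd q))))"
    unfolding first_cell_def by (intro computable_bounded_Least sel' h_intros)
  note first' = computable_app2[where F = "\<lambda>e i. first_cell (w e) (select_nat (P e) (h e i))", OF first]
  show ?thesis
    unfolding substrands_def by (intro sel' first' h_intros)
qed

end

lemma computable_glider_code: "computable A \<Longrightarrow> computable B \<Longrightarrow> computable (\<lambda>e. glider_code (A e) (B e))"
proof (rule computable_app2[of glider_code])
  have pat: "computable (\<lambda>q :: (nat \<times> nat) \<times> nat \<times> int. code_pattern (snd (fst q)) (fst (snd q)) (snd (snd q)))"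
    and len: "computable (\<lambda>q :: nat \<times> nat. len_code (snd q))"
    and width: "computable (\<lambda>q :: nat \<times> nat. width_code (snd q))"
    by (intro code_intros computable_width_code)+
  \<comment> \<open>The primed versions live in the environment extended by the bound variable of
    the search for a chain.\<close>
  have pat': "computable (\<lambda>q :: ((nat \<times> nat) \<times> nat) \<times> nat \<times> int. code_pattern (snd (fst (fst q))) (fst (snd q)) (snd (snd q)))"
    and len': "computable (\<lambda>q :: (nat \<times> nat) \<times> nat. len_code (snd (fst q)))"
    and width': "computable (\<lambda>q :: (nat \<times> nat) \<times> nat. width_code (snd (fst q)))"
    by (intro code_intros computable_width_code)+
  note loc = computable_local_ok[where h = "\<lambda>q. code_pattern (snd q)" and p = "\<lambda>q. len_code (snd q)"
      and w = "\<lambda>q. width_code (snd q)", OF pat len width]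
  have chain: "computable (\<lambda>q :: (nat \<times> nat) \<times> nat.
      chain_ok (code_pattern (snd (fst q))) (len_code (snd (fst q))) (width_code (snd (fst q))) (snd q))"
    by (rule computable_chain_ok[where h = "\<lambda>q. code_pattern (snd (fst q))", OF pat' len' width'])
      (intro computable_intros)
  have rules: "computable (\<lambda>q :: nat \<times> nat. \<exists>t\<in>turning_rules. \<not> t ! k \<and>
      local_ok (obeys_at t) (code_pattern (snd q)) (len_code (snd q)) (width_code (snd q)))" for k
    by (rule computable_finite_bex[OF finite_turning_rules]) (intro loc computable_intros)
  show "computable (\<lambda>q. glider_code (fst q) (snd q))"
    unfolding glider_code_def
    by (intro computable_conj computable_disj computable_not computable_bex loc rules chain
        computable_faster[where h = "\<lambda>q. code_pattern (snd q)" and p = "\<lambda>q. len_code (snd q)", OF pat len width]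
        computable_code_ok computable_primitive_code computable_Suc computable_list_bound computable_width_code
        code_intros)
qed

lemma computable_desc_code: "computable A \<Longrightarrow> computable B \<Longrightarrow> computable (\<lambda>e. desc_code (A e) (B e))"
proof (rule computable_app2[of desc_code])
  let ?left = "\<lambda>x. faster_left (code_pattern x) (len_code x)"
  let ?P = "\<lambda>(q :: (nat \<times> nat) \<times> nat) m. if ?left (snd (fst q)) then m \<le> Suc (snd q) else fst (fst q) < m + Suc (snd q)"
  have pat: "computable (\<lambda>q :: nat \<times> nat \<times> int. code_pattern (fst q) (fst (snd q)) (snd (snd q)))"
    and len: "computable (\<lambda>x :: nat. len_code x)" and width: "computable (\<lambda>x :: nat. width_code x)"
    by (intro code_intros computable_width_code)+
  have left: "computable ?left"
    by (rule computable_faster(1)[where h = code_pattern, OF pat len width])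
  have pat': "computable (\<lambda>q :: ((nat \<times> nat) \<times> nat) \<times> nat \<times> int. code_pattern (snd (fst (fst q))) (fst (snd q)) (snd (snd q)))"
    and len': "computable (\<lambda>q :: (nat \<times> nat) \<times> nat. len_code (snd (fst q)))"
    and width': "computable (\<lambda>q :: (nat \<times> nat) \<times> nat. width_code (snd (fst q)))"
    by (intro code_intros computable_width_code)+
  have P: "computable (\<lambda>q. ?P (fst q) (snd q))"
    by (intro computable_comp[OF left] computable_intros)
  have sub: "computable (\<lambda>q. substrands (?P (fst q)) (width_code (snd (fst (fst q))))
      (code_pattern (snd (fst (fst q)))) (fst (snd q)) (snd (snd q)))"
    by (rule computable_substrands[where h = "\<lambda>q. code_pattern (snd (fst q))" and P = ?P, OF pat' len' width' P])
  have "computable (\<lambda>q. local_ok Q (substrands (?P q) (width_code (snd (fst q))) (code_pattern (snd (fst q))))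
      (len_code (snd (fst q))) (width_code (snd (fst q))))" for Q
    by (rule computable_local_ok[where h = "\<lambda>q. substrands (?P q) (width_code (snd (fst q))) (code_pattern (snd (fst q)))",
          OF sub len' width'])
  then show "computable (\<lambda>q. desc_code (fst q) (snd q))"
    unfolding desc_code_def
    by (intro computable_prod_encode computable_finite_sum[OF finite_turning_rules] computable_if
        computable_ball computable_width_code computable_intros)
qed

lemma computable_V_code: "computable V_code"
proof -
  have "computable per_code_bound"
    unfolding per_code_bound_def[abs_def] by (intro computable_list_bound computable_intros)
  then show ?thesis
    unfolding V_code_def[abs_def]
    by (intro computable_sum computable_if computable_glider_code computable_desc_code computable_power
        computable_Suc computable_intros)
qed

text \<open>Recovers \<open>n\<close> from the code of a period, all of whose generations have the
  same number of strands.\<close>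

definition count_code :: "nat \<Rightarrow> nat" where
  "count_code x = (\<Sum>j<len_code (nth_code x 0). strands (code_gen (nth_code x 0) (int j)))"

lemma computable_count_code: "computable A \<Longrightarrow> computable (\<lambda>e. count_code (A e))"
proof (rule computable_comp[of count_code])
  show "computable count_code"
    unfolding count_code_def[abs_def] by (intro computable_cell1[of _ strands] code_intros)
qed

lemma count_code: "code_ok n x \<Longrightarrow> count_code x = n"
  by (auto simp: code_ok_def gen_code_ok_def count_code_def)

text \<open>Adjacent strands that all turn left for ever: the witness that \<open>V n\<close> is
  never empty.\<close>

definition row :: "nat \<Rightarrow> generation" where
  "row n j = (if 0 \<le> j \<and> j < int n then NL else Empty)"

lemma row_in_U:
  assumes "n \<ge> 1"
  shows "(\<lambda>_. row n) \<in> U n"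
proof -
  let ?g = "\<lambda>_ :: nat. row n"
  \<comment> \<open>Only ET and TT are set: a nonempty child has right parent \<open>NL\<close>, and
    left parent \<open>Empty\<close> or \<open>NL\<close>.\<close>
  let ?t = "[False, False, False, False, False, True, False, False, True]"
  have supp: "gen_support (row n) = {0..<int n}" by (auto simp: gen_support_def row_def)
  have "(\<Sum>j\<in>{0..<int n}. strands (row n j)) = (\<Sum>j\<in>{0..<int n}. 1)"
    by (rule sum.cong) (auto simp: row_def)
  then have gen: "is_generation n (row n)"
    using assms by (simp add: is_generation_def supp strand_count_def) (simp add: row_def)
  have child: "child (row n) (row n) k = row n (k + 1)" for k
    using assms by (simp add: child_def child_pos_def row_def)
  have cont: "continuous_pattern ?g"
    unfolding continuous_pattern_def child by (simp add: row_def)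
  have rule: "turning_rule_of ?t ?g"
    unfolding turning_rule_of_def child Let_def by (auto simp: row_def turning_rules_def)
  have nc: "non_crossing ?g" by (simp add: non_crossing_def row_def)
  have pow: "is_power [row n] ?g" by (simp add: is_power_def)
  have per: "per ?g = [row n]"
    by (rule per_eqI[OF pow]) (auto simp: is_power_def Suc_le_eq)
  have chain: "\<not> null_chain [row n] cs" for cs
    unfolding null_chain_def by (auto simp: row_def split: if_splits)
  have speed: "positive_speed ?g"
    using assms by (simp add: positive_speed_def speed_def per edge_shift_def row_def)
  show ?thesis
    unfolding U_def pure_glider_def glider_def repeating_sca_def sca_pattern_def grid_pattern_def per mem_Collect_eq
    using gen cont rule crossing_rule_trivial[OF nc] pow chain speed nc
    by (intro conjI disjI1 exI[of _ ?t]) auto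
qed

theorem mainTheorem4:
  shows "(\<forall>n\<ge>1. finite (V n)) \<and>
    (\<exists>step. \<forall>n\<ge>1. run step [description_set_code (V n)] = Some (description_set_code (V (n + 1)))) \<and>
    (\<exists>comp. \<forall>n\<ge>1. run comp [n] = Some (description_set_code (V n))) \<and>
    (\<exists>decide. \<forall>n\<ge>1. \<forall>d\<in>descriptions n.
       run decide [description_code d] = Some (if d \<in> V n then 1 else 0))"
proof (intro conjI)
  show "\<forall>n\<ge>1. finite (V n)" by (simp add: finite_V)
next
  obtain r where "\<And>n. run r [n] = Some (V_code n)"
    using computable_V_code by (auto simp: computable_def enc_nat_def)
  then show "\<exists>comp. \<forall>n\<ge>1. run comp [n] = Some (description_set_code (V n))"
    using V_code by metis
next
  text \<open>Since \<open>V n\<close> is nonempty, \<open>n\<close> can be read off any element of it.\<close>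
  let ?d = "\<lambda>v :: nat. LEAST d. odd (v div 2 ^ d) \<or> v \<le> d"
  let ?step = "\<lambda>v. V_code (Suc (count_code (fst (prod_decode (?d v)))))"
  have "computable ?step"
    by (intro computable_comp[OF computable_V_code] computable_count_code computable_bounded_Least computable_intros)
  then obtain r where r: "\<And>v. run r [v] = Some (?step v)"
    by (auto simp: computable_def enc_nat_def)
  have "run r [description_set_code (V n)] = Some (description_set_code (V (n + 1)))" if n: "n \<ge> 1" for n
  proof -
    define v where "v = description_set_code (V n)"
    have decode: "odd (v div 2 ^ d) \<longleftrightarrow> d \<in> description_code ` V n" for d
    proof -
      have "set_decode v = description_code ` V n"
        unfolding v_def description_set_code_def by (rule set_encode_inverse) (simp add: finite_V)
      then show ?thesis by (auto simp: set_decode_def)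
    qed
    have "V n \<noteq> {}" using row_in_U[OF n] by (auto simp: V_def)
    then obtain d where d: "odd (v div 2 ^ d)" using decode by blast
    \<comment> \<open>A set bit of \<open>v\<close> lies below the bound \<open>v\<close>, so the
      search ends at a set bit and not at the bound.\<close>
    then have "2 ^ d \<le> v" by (metis div_less even_zero not_le)
    then have "d < v" using less_exp[of d] by linarith
    have "odd (v div 2 ^ ?d v) \<or> v \<le> ?d v" by (rule LeastI[of _ d]) (simp add: d)
    moreover have "?d v \<le> d" by (rule Least_le) (simp add: d)
    ultimately have "odd (v div 2 ^ ?d v)" using \<open>d < v\<close> by linarith
    then have "?d v \<in> desc_code n ` {x. glider_code n x}" by (simp add: decode codes_V[OF n])
    then obtain x where "glider_code n x" "?d v = desc_code n x" by blast
    then have "count_code (fst (prod_decode (?d v))) = n"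
      by (simp add: desc_code_def count_code glider_code_def)
    then show ?thesis using r[of v] V_code[of "Suc n"] by (simp add: v_def)
  qed
  then show "\<exists>step. \<forall>n\<ge>1. run step [description_set_code (V n)] = Some (description_set_code (V (n + 1)))"
    by blast
next
  let ?x = "\<lambda>z :: nat. fst (prod_decode z)"
  \<comment> \<open>The number of strands is read off the period inside the description; comparing
    the whole code then checks rule set and width at once.\<close>
  let ?dec = "\<lambda>z. glider_code (count_code (?x z)) (?x z) \<and> z = desc_code (count_code (?x z)) (?x z)"
  have "computable ?dec"
    by (intro computable_conj computable_eq computable_glider_code computable_desc_code computable_count_code computable_intros)
  then obtain r where r: "\<And>z. run r [z] = Some (of_bool (?dec z))"
    by (auto simp: computable_def enc_nat_def enc_bool_def)
  have "run r [description_code d] = Some (if d \<in> V n then 1 else 0)" if n: "n \<ge> 1" and d: "d \<in> descriptions n" for n d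
  proof -
    obtain a T w where dd: "d = (a, T, w)" by (cases d)
    then have x: "?x (description_code d) = list_encode (map gen_code a)" by simp
    have ok: "code_ok n (?x (description_code d))"
      unfolding x by (rule code_ok_encode) (use d dd in \<open>auto simp: descriptions_def\<close>)
    have "?dec (description_code d) \<longleftrightarrow> description_code d \<in> desc_code n ` {x. glider_code n x}"
      unfolding count_code[OF ok] by (auto simp: desc_code_def)
    also have "\<dots> \<longleftrightarrow> description_code d \<in> description_code ` V n" by (simp add: codes_V[OF n])
    also have "\<dots> \<longleftrightarrow> d \<in> V n"
      using inj_on_image_mem_iff[OF inj_description_code, of d "V n"] d V_subset_descriptions[OF n] by blast
    finally show ?thesis using r[of "description_code d"] by simp
  qed
  then show "\<exists>decide. \<forall>n\<ge>1. \<forall>d\<in>descriptions n. run decide [description_code d] = Some (if d \<in> V n then 1 else 0)"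
    by blast
qed

end
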